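(* Let $\Phi,\Psi$ be two doubling functions. Assume the slow volume regular condition $\mathrm{SVR}(\Phi,\Psi)$. Then the following are equivalent. (1) The resistance estimate $\mathrm{R}(\Phi,\Psi)$ holds. (2) The Poincaré inequality $\mathrm{PI}(\Psi)$ and the capacity upper bound $\mathrm{cap}(\Psi)_{\le}$ hold. (3) The Poincaré inequality $\mathrm{PI}(\Psi)$ and the cutoff Sobolev inequality $\mathrm{CS}(\Psi)$ hold.
   Context: **Space.** Throughout, $p\in(1,+\infty)$ is fixed. $(X,d)$ is a complete, locally compact, separable metric space all of whose metric balls $B(x,r)=\{y\in X:d(x,y)<r\}$ are relatively compact, and $m$ is a positive Radon measure on $X$ with full support. Write $V(x,r)=m(B(x,r))$, and $\delta B=B(x,\delta r)$ for a ball $B=B(x,r)$ and $\delta>0$; $u_A=\frac1{m(A)}\int_A u\,\mathrm{d}m$. $\mathrm{diam}(X)\in[0,+\infty]$ is the diameter. The following chain condition CC is always assumed: there is $C_{cc}>0$ such that for all $x,y\in X$ and all positive integers $n$ there are points $x_0=x,x_1,\dots,x_n=y$ in $X$ with $d(x_k,x_{k-1})\le C_{cc}\,d(x,y)/n$ for $k=1,\dots,n$. $\mathcal{B}(X)$ is the Borel $\sigma$-algebra, $C(X)$ (resp. $C_c(X)$) the continuous functions on $X$ (resp. those with compact support), and $\mathrm{supp}(f)$ is the support of the measure $|f|\,\mathrm{d}m$. **Doubling function.** A homeomorphism $\Phi:[0,+\infty)\to[0,+\infty)$ (hence strictly increasing, $\Phi(0)=0$) such that there is $C_\Phi>1$ with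 $\Phi(2r)\le C_\Phi\Phi(r)$ for all $r>0$. **$p$-energy.** $(\mathcal{E},\mathcal{F})$ is a fixed $p$-energy on $(X,d,m)$: $\mathcal{F}$ is a dense subspace of $L^p(X;m)$ and $\mathcal{E}:\mathcal{F}\to[0,+\infty)$ satisfies: (1) $\mathcal{E}^{1/p}$ is a semi-norm on $\mathcal{F}$; (2) $(\mathcal{F},\mathcal{E}(\cdot)^{1/p}+\|\cdot\|_{L^p(X;m)})$ is a Banach space; (3) (Markovian) if $\varphi\in C(\mathbb{R})$, $\varphi(0)=0$, $|\varphi(t)-\varphi(s)|\le|t-s|$ for all $t,s$, then for $f\in\mathcal{F}$ one has $\varphi(f)\in\mathcal{F}$ and $\mathcal{E}(\varphi(f))\le\mathcal{E}(f)$; (4) (Regular) $\mathcal{F}\cap C_c(X)$ is uniformly dense in $C_c(X)$ and dense in $\mathcal{F}$ for the norm in (2); (5) (Strongly local) if $f,g\in\mathcal{F}$ have compact support and $g$ is constant in an open neighborhood of $\mathrm{supp}(f)$, then $\mathcal{E}(f+g)=\mathcal{E}(f)+\mathcal{E}(g)$; (6) ($p$-Clarkson) for $f,g\in\mathcal{F}$, $\mathcal{E}(f+g)+\mathcal{E}(f-g)\ge2(\mathcal{E}(f)^{\frac1{p-1}}+\mathcal{E}(g)^{\frac1{p-1}})^{p-1}$ if $p\in(1,2]$, and the reverse inequality $\le$ if $p\in[2,+\infty)$; (7) (Algebra, always assumed) for $f,g\in\mathcal{F}\cap L^\infty(X;m)$, $fg\in\mathcal{F}$ and $\mathcal{E}(fg)^{1/p}\le\|f\|_{L^\infty}\mathcal{E}(g)^{1/p}+\|g\|_{L^\infty}\mathcal{E}(f)^{1/p}$.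 Write $\mathcal{E}_1(\cdot)=\mathcal{E}(\cdot)+\|\cdot\|_{L^p(X;m)}^p$. **$p$-energy measure.** $\Gamma:\mathcal{F}\times\mathcal{B}(X)\to[0,+\infty)$ is the (canonical) $p$-energy measure associated with $(\mathcal{E},\mathcal{F})$; it satisfies: (a) for $f\in\mathcal{F}$, $\Gamma(f)$ is a positive Radon measure with $\Gamma(f)(X)=\mathcal{E}(f)$; (b) for $A\in\mathcal{B}(X)$, $\Gamma(\cdot)(A)^{1/p}$ is a semi-norm on $\mathcal{F}$; (c) for $f,g\in\mathcal{F}\cap C_c(X)$ and $A\in\mathcal{B}(X)$, if $f-g$ is constant on $A$ then $\Gamma(f)(A)=\Gamma(g)(A)$; (d) the $p$-Clarkson inequality (6) holds with $\mathcal{E}(\cdot)$ replaced by $\Gamma(\cdot)(A)$, for every $A\in\mathcal{B}(X)$; (e) (chain rule) for $f,g\in\mathcal{F}\cap C_c(X)$ and piecewise $C^1$ functions $\varphi,\psi:\mathbb{R}\to\mathbb{R}$ with $\varphi(0)=\psi(0)=0$, $\mathrm{d}\Gamma(\varphi(f);\psi(g))=\mathrm{sgn}(\varphi'(f))|\varphi'(f)|^{p-1}\psi'(g)\,\mathrm{d}\Gamma(f;g)$, where $\Gamma(f;g)=\frac1p\frac{\mathrm{d}}{\mathrm{d}t}\Gamma(f+tg)|_{t=0}$ is a signed measure; (f) (Leibniz rule) for $f,g,h\in\mathcal{F}\cap C_c(X)$, $\mathrm{d}\Gamma(f;gh)=g\,\mathrm{d}\Gamma(f;h)+h\,\mathrm{d}\Gamma(f;g)$.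 **Quasi-continuity.** For $U$ open, $\mathrm{cap}_1(U)=\inf\{\mathcal{E}_1(\varphi):\varphi\in\mathcal{F},\ \varphi\ge1\ m\text{-a.e. in }U\}$, and $\mathrm{cap}_1(A)=\inf\{\mathrm{cap}_1(U):U\supseteq A\text{ open}\}$. "q.e." means outside a set of zero $\mathrm{cap}_1$. $u$ is quasi-continuous if for every $\varepsilon>0$ there is an open $G$ with $\mathrm{cap}_1(G)<\varepsilon$ and $u|_{X\setminus G}$ continuous. Each $f\in\mathcal{F}$ has a quasi-continuous modification $\widetilde f$, unique q.e., and uniquely determined $\Gamma(\phi)$-a.e. for each $\phi\in\mathcal{F}$. **Conditions.** $\mathrm{V}(\Phi)$: there is $C_{VR}>0$ with $\frac1{C_{VR}}\Phi(r)\le V(x,r)\le C_{VR}\Phi(r)$ for all $x\in X$, $r\in(0,\mathrm{diam}(X))$. $\mathrm{SVR}(\Phi,\Psi)$: $\mathrm{V}(\Phi)$ holds and there is an increasing continuous $\Theta:[0,1]\to[0,+\infty)$ with $\Theta(0)=0$, $\Theta(1)\ge1$, $\sum_{n=0}^{+\infty}\Theta(2^{-n})^{1/p}<+\infty$ and $\frac{\Phi(R)}{\Phi(r)}\le\Theta\left(\frac rR\right)\frac{\Psi(R)}{\Psi(r)}$ for all $R,r\in(0,\mathrm{diam}(X))$ with $r\le R$. $\mathrm{PI}(\Psi)$: there are $C_{PI}>0$, $A_{PI}\ge1$ such that for every ball $B$ of radius $r\in(0,\mathrm{diam}(X)/A_{PI})$ and every $f\in\mathcal{F}$, $\int_B|f-f_B|^p\mathrm{d}m\le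 C_{PI}\Psi(r)\int_{A_{PI}B}\mathrm{d}\Gamma(f)$. Cutoff function: for open $U\subseteq\overline U\subseteq V$, $\phi\in\mathcal{F}$ is a cutoff function for $U\subseteq V$ if $0\le\phi\le1$ in $X$, $\phi=1$ in an open neighborhood of $\overline U$, and $\mathrm{supp}(\phi)\subseteq V$. $\mathrm{CS}(\Psi)$: there are $C_1,C_2>0$, $A_S>1$ such that for every ball $B(x,r)$ there is a cutoff function $\phi\in\mathcal{F}$ for $B(x,r)\subseteq B(x,A_Sr)$ such that for every $f\in\mathcal{F}$, $\int_{B(x,A_Sr)}|\widetilde f|^p\mathrm{d}\Gamma(\phi)\le C_1\int_{B(x,A_Sr)}\mathrm{d}\Gamma(f)+\frac{C_2}{\Psi(r)}\int_{B(x,A_Sr)}|f|^p\mathrm{d}m$. Capacity: $\mathrm{cap}(A_1,A_2)=\inf\{\mathcal{E}(\varphi):\varphi\in\mathcal{F},\ \varphi=1\text{ in an open neighborhood of }A_1,\ \varphi=0\text{ in an open neighborhood of }A_2\}$, with $\inf\emptyset=+\infty$. $\mathrm{cap}(\Psi)_{\le}$: there are $C_{cap}>0$, $A_{cap}>1$ with $\mathrm{cap}(B(x,r),X\setminus B(x,A_{cap}r))\le C_{cap}\frac{V(x,r)}{\Psi(r)}$ for every ball $B(x,r)$. Effective resistance: for $A,B\in\mathcal{B}(X)$, $R(A,B)=\left(\inf\{\mathcal{E}(u):u\in\mathcal{F},\ u=0\text{ on }A,\ u=1\text{ on }B\}\right)^{-1}$ with $0^{-1}=+\infty$, $(+\infty)^{-1}=0$,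 where $u$ ranges over elements of $\mathcal{F}$ having a continuous version, and pointwise values are those of that version; $R(x,y)=R(\{x\},\{y\})$. $\mathrm{R}(\Phi,\Psi)$: there is $C_R>0$ such that $\frac1{C_R}\frac{\Psi(d(x,y))}{\Phi(d(x,y))}\le R(x,y)\le C_R\frac{\Psi(d(x,y))}{\Phi(d(x,y))}$ for all $x,y\in X$ with $x\ne y$. *)

theory Defs
  imports "HOL-Analysis.Analysis" "HOL-Probability.Essential_Supremum"
begin

section \<open>Metric measure spaces\<close>

definition radon_measure :: "'a::topological_space measure \<Rightarrow> bool" where
  "radon_measure M \<longleftrightarrow>
     sets M = sets borel \<and>
     (\<forall>K. compact K \<longrightarrow> emeasure M K < \<infinity>) \<and>
     (\<forall>A\<in>sets borel. emeasure M A = (SUP K\<in>{K. compact K \<and> K \<subseteq> A \<and> K \<in> sets borel}. emeasure M K))"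

definition chain_condition :: "'a::metric_space itself \<Rightarrow> bool" where
  "chain_condition _ \<longleftrightarrow>
     (\<exists>C>0. \<forall>x y :: 'a. \<forall>n\<ge>1. \<exists>z :: nat \<Rightarrow> 'a. z 0 = x \<and> z n = y \<and>
        (\<forall>k\<in>{1..n}. dist (z k) (z (k - 1)) \<le> C * dist x y / real n))"

text \<open>The library constant \<^const>\<open>diameter\<close> is real-valued and carries no information about
  unbounded sets; here the diameter takes the value \<open>\<infinity>\<close>.\<close>

definition ediam :: "'a::metric_space set \<Rightarrow> ennreal" where
  "ediam A = (SUP (x, y)\<in>A \<times> A. ennreal (dist x y))"

locale metric_measure_space =
  fixes m :: "'a::polish_space measure"
  assumes locally_compact: "locally compact (UNIV :: 'a set)"
    and balls_relatively_compact: "compact (closure (ball (x :: 'a) r))"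
    and radon: "radon_measure m"
    and full_support: "open U \<Longrightarrow> U \<noteq> {} \<Longrightarrow> emeasure m U > 0"
    and chain: "chain_condition TYPE('a)"

section \<open>Function spaces\<close>

text \<open>Elements of \<open>L\<^sup>p\<close> and of the domain of the energy are represented by Borel functions; all
  sets of such functions considered below are closed under \<open>m\<close>-a.e. equality, so that they
  are unions of equivalence classes.\<close>

definition Lp_space :: "real \<Rightarrow> 'a measure \<Rightarrow> ('a \<Rightarrow> real) set" where
  "Lp_space p m = {f \<in> borel_measurable m. integrable m (\<lambda>x. \<bar>f x\<bar> powr p)}"

definition Lp_norm :: "real \<Rightarrow> 'a measure \<Rightarrow> ('a \<Rightarrow> real) \<Rightarrow> real" where
  "Lp_norm p m f = (\<integral>x. \<bar>f x\<bar> powr p \<partial>m) powr (1 / p)"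

definition Linf_space :: "'a measure \<Rightarrow> ('a \<Rightarrow> real) set" where
  "Linf_space m = {f \<in> borel_measurable m. esssup m (\<lambda>x. ereal \<bar>f x\<bar>) < \<infinity>}"

definition Linf_norm :: "'a measure \<Rightarrow> ('a \<Rightarrow> real) \<Rightarrow> real" where
  "Linf_norm m f = real_of_ereal (esssup m (\<lambda>x. ereal \<bar>f x\<bar>))"

definition Cc_space :: "('a::topological_space \<Rightarrow> real) set" where
  "Cc_space = {f. continuous_on UNIV f \<and> compact (closure {x. f x \<noteq> 0})}"

definition measure_support :: "'a::topological_space measure \<Rightarrow> 'a set" where
  "measure_support M = {x. \<forall>U. open U \<and> x \<in> U \<longrightarrow> emeasure M U > 0}"

definition fun_support :: "'a::topological_space measure \<Rightarrow> ('a \<Rightarrow> real) \<Rightarrow> 'a set" where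
  "fun_support m f = measure_support (density m (\<lambda>x. ennreal \<bar>f x\<bar>))"

definition ae_eq_on :: "'a measure \<Rightarrow> 'a set \<Rightarrow> ('a \<Rightarrow> real) \<Rightarrow> real \<Rightarrow> bool" where
  "ae_eq_on m U f c \<longleftrightarrow> (AE x in m. x \<in> U \<longrightarrow> f x = c)"

definition seminorm_on :: "('a \<Rightarrow> real) set \<Rightarrow> (('a \<Rightarrow> real) \<Rightarrow> real) \<Rightarrow> bool" where
  "seminorm_on F N \<longleftrightarrow>
     (\<forall>f\<in>F. 0 \<le> N f) \<and>
     (\<forall>f\<in>F. \<forall>c. N (\<lambda>x. c * f x) = \<bar>c\<bar> * N f) \<and>
     (\<forall>f\<in>F. \<forall>g\<in>F. N (\<lambda>x. f x + g x) \<le> N f + N g)"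

definition p_Clarkson :: "real \<Rightarrow> ('a \<Rightarrow> real) set \<Rightarrow> (('a \<Rightarrow> real) \<Rightarrow> real) \<Rightarrow> bool" where
  "p_Clarkson p F N \<longleftrightarrow>
     (\<forall>f\<in>F. \<forall>g\<in>F.
        (p \<le> 2 \<longrightarrow>
           N (\<lambda>x. f x + g x) + N (\<lambda>x. f x - g x)
             \<ge> 2 * (N f powr (1 / (p - 1)) + N g powr (1 / (p - 1))) powr (p - 1)) \<and>
        (p \<ge> 2 \<longrightarrow>
           N (\<lambda>x. f x + g x) + N (\<lambda>x. f x - g x)
             \<le> 2 * (N f powr (1 / (p - 1)) + N g powr (1 / (p - 1))) powr (p - 1)))"

section \<open>Energies\<close>

definition energy_norm ::
  "real \<Rightarrow> 'a measure \<Rightarrow> (('a \<Rightarrow> real) \<Rightarrow> real) \<Rightarrow> ('a \<Rightarrow> real) \<Rightarrow> real" where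
  "energy_norm p m E f = E f powr (1 / p) + Lp_norm p m f"

locale p_energy = metric_measure_space m for m :: "'a::polish_space measure" +
  fixes p :: real
    and F :: "('a \<Rightarrow> real) set"
    and E :: "('a \<Rightarrow> real) \<Rightarrow> real"
  assumes p_gt_1: "1 < p"
    and F_subset: "F \<subseteq> Lp_space p m"
    and F_ae_closed: "f \<in> F \<Longrightarrow> g \<in> borel_measurable m \<Longrightarrow> (AE x in m. f x = g x) \<Longrightarrow> g \<in> F"
    and E_ae_cong: "f \<in> F \<Longrightarrow> g \<in> F \<Longrightarrow> (AE x in m. f x = g x) \<Longrightarrow> E f = E g"
    and F_zero: "(\<lambda>_. 0) \<in> F"
    and F_add: "f \<in> F \<Longrightarrow> g \<in> F \<Longrightarrow> (\<lambda>x. f x + g x) \<in> F"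
    and F_scale: "f \<in> F \<Longrightarrow> (\<lambda>x. c * f x) \<in> F"
    and F_dense: "f \<in> Lp_space p m \<Longrightarrow> \<epsilon> > 0 \<Longrightarrow> \<exists>g\<in>F. Lp_norm p m (\<lambda>x. f x - g x) < \<epsilon>"
    and E_nonneg: "f \<in> F \<Longrightarrow> 0 \<le> E f"
    and E_seminorm: "seminorm_on F (\<lambda>f. E f powr (1 / p))"
    and F_complete:
      "(\<And>n. u n \<in> F) \<Longrightarrow>
       (\<And>\<epsilon>. \<epsilon> > 0 \<Longrightarrow>
          \<exists>N. \<forall>k\<ge>N. \<forall>l\<ge>N. energy_norm p m E (\<lambda>x. u k x - u l x) < \<epsilon>) \<Longrightarrow>
       \<exists>v\<in>F. (\<lambda>n. energy_norm p m E (\<lambda>x. u n x - v x)) \<longlonglongrightarrow> 0"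
    and Markovian:
      "continuous_on UNIV \<phi> \<Longrightarrow> \<phi> 0 = 0 \<Longrightarrow> (\<And>s t :: real. \<bar>\<phi> t - \<phi> s\<bar> \<le> \<bar>t - s\<bar>) \<Longrightarrow>
       f \<in> F \<Longrightarrow> (\<lambda>x. \<phi> (f x)) \<in> F \<and> E (\<lambda>x. \<phi> (f x)) \<le> E f"
    and regular_Cc:
      "f \<in> Cc_space \<Longrightarrow> \<epsilon> > 0 \<Longrightarrow> \<exists>g\<in>F \<inter> Cc_space. \<forall>x. \<bar>f x - g x\<bar> < \<epsilon>"
    and regular_F:
      "f \<in> F \<Longrightarrow> \<epsilon> > 0 \<Longrightarrow> \<exists>g\<in>F \<inter> Cc_space. energy_norm p m E (\<lambda>x. f x - g x) < \<epsilon>"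
    and strongly_local:
      "f \<in> F \<Longrightarrow> g \<in> F \<Longrightarrow> compact (fun_support m f) \<Longrightarrow> compact (fun_support m g) \<Longrightarrow>
       (\<exists>U c. open U \<and> fun_support m f \<subseteq> U \<and> ae_eq_on m U g c) \<Longrightarrow>
       E (\<lambda>x. f x + g x) = E f + E g"
    and Clarkson: "p_Clarkson p F E"
    and algebra:
      "f \<in> F \<inter> Linf_space m \<Longrightarrow> g \<in> F \<inter> Linf_space m \<Longrightarrow>
       (\<lambda>x. f x * g x) \<in> F \<and>
       E (\<lambda>x. f x * g x) powr (1 / p)
         \<le> Linf_norm m f * E g powr (1 / p) + Linf_norm m g * E f powr (1 / p)"

section \<open>Energy measures\<close>

text \<open>\<open>d\<mu> = h d\<nu>\<close> for finite signed Borel measures \<open>\<nu>\<close> and \<open>\<mu>\<close>, given as set functions. A finite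
  signed measure is a difference \<open>P - N\<close> of two finite measures, and \<open>\<integral> h d\<nu> = \<integral> h dP - \<integral> h dN\<close>
  does not depend on the decomposition as long as \<open>h\<close> is integrable with respect to both.\<close>

definition signed_density ::
  "('a::topological_space set \<Rightarrow> real) \<Rightarrow> ('a \<Rightarrow> real) \<Rightarrow> ('a set \<Rightarrow> real) \<Rightarrow> bool" where
  "signed_density \<nu> h \<mu> \<longleftrightarrow>
     (\<exists>P N. finite_measure P \<and> finite_measure N \<and> sets P = sets borel \<and> sets N = sets borel \<and>
        (\<forall>A\<in>sets borel. \<nu> A = measure P A - measure N A) \<and>
        integrable P h \<and> integrable N h \<and>
        (\<forall>A\<in>sets borel. \<mu> A = (LINT x:A|P. h x) - (LINT x:A|N. h x)))"

text \<open>A continuous function whose restriction to each closed interval between consecutive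
  breakpoints (the points of \<open>S\<close>) is continuously differentiable. The library notion
  \<^const>\<open>piecewise_C1_differentiable_on\<close> does not suffice here: it admits derivatives that are
  unbounded near a breakpoint.\<close>

definition piecewise_C1 :: "(real \<Rightarrow> real) \<Rightarrow> bool" where
  "piecewise_C1 \<phi> \<longleftrightarrow> continuous_on UNIV \<phi> \<and>
     (\<exists>S. finite S \<and> (\<forall>t. t \<notin> S \<longrightarrow> \<phi> differentiable (at t)) \<and> continuous_on (- S) (deriv \<phi>) \<and>
        (\<forall>s\<in>S. (\<exists>l. (deriv \<phi> \<longlongrightarrow> l) (at_left s)) \<and> (\<exists>l. (deriv \<phi> \<longlongrightarrow> l) (at_right s))))"

definition mixed_energy ::
  "real \<Rightarrow> (('a \<Rightarrow> real) \<Rightarrow> 'a measure) \<Rightarrow> ('a \<Rightarrow> real) \<Rightarrow> ('a \<Rightarrow> real) \<Rightarrow> 'a set \<Rightarrow> real" where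
  "mixed_energy p \<Gamma> f g A = 1 / p * deriv (\<lambda>t. measure (\<Gamma> (\<lambda>x. f x + t * g x)) A) 0"

text \<open>In the chain rule, \<^term>\<open>deriv \<phi>\<close> has an unspecified value at the breakpoints of \<open>\<phi>\<close>. This is
  harmless: by \<open>\<Gamma>_const\<close>, the level sets of \<open>f\<close> and \<open>g\<close> are null for \<open>\<Gamma> f\<close> and \<open>\<Gamma> g\<close> respectively,
  hence for the mixed measure.\<close>

locale p_energy_measure = p_energy m p F E
  for m :: "'a::polish_space measure" and p F E +
  fixes \<Gamma> :: "('a \<Rightarrow> real) \<Rightarrow> 'a measure"
  assumes \<Gamma>_ae_cong: "f \<in> F \<Longrightarrow> g \<in> F \<Longrightarrow> (AE x in m. f x = g x) \<Longrightarrow> \<Gamma> f = \<Gamma> g"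
    and \<Gamma>_radon: "f \<in> F \<Longrightarrow> radon_measure (\<Gamma> f)"
    and \<Gamma>_total: "f \<in> F \<Longrightarrow> emeasure (\<Gamma> f) UNIV = ennreal (E f)"
    and \<Gamma>_seminorm: "A \<in> sets borel \<Longrightarrow> seminorm_on F (\<lambda>f. measure (\<Gamma> f) A powr (1 / p))"
    and \<Gamma>_const:
      "f \<in> F \<inter> Cc_space \<Longrightarrow> g \<in> F \<inter> Cc_space \<Longrightarrow> A \<in> sets borel \<Longrightarrow>
       (\<exists>c. \<forall>x\<in>A. f x - g x = c) \<Longrightarrow> measure (\<Gamma> f) A = measure (\<Gamma> g) A"
    and \<Gamma>_Clarkson: "A \<in> sets borel \<Longrightarrow> p_Clarkson p F (\<lambda>f. measure (\<Gamma> f) A)"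
    and \<Gamma>_differentiable:
      "f \<in> F \<inter> Cc_space \<Longrightarrow> g \<in> F \<inter> Cc_space \<Longrightarrow> A \<in> sets borel \<Longrightarrow>
       (\<lambda>t :: real. measure (\<Gamma> (\<lambda>x. f x + t * g x)) A) differentiable (at 0)"
    and \<Gamma>_chain_rule:
      "f \<in> F \<inter> Cc_space \<Longrightarrow> g \<in> F \<inter> Cc_space \<Longrightarrow> piecewise_C1 \<phi> \<Longrightarrow> piecewise_C1 \<psi> \<Longrightarrow>
       \<phi> 0 = 0 \<Longrightarrow> \<psi> 0 = 0 \<Longrightarrow>
       signed_density (mixed_energy p \<Gamma> f g)
         (\<lambda>x. sgn (deriv \<phi> (f x)) * \<bar>deriv \<phi> (f x)\<bar> powr (p - 1) * deriv \<psi> (g x))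
         (mixed_energy p \<Gamma> (\<lambda>x. \<phi> (f x)) (\<lambda>x. \<psi> (g x)))"
    and \<Gamma>_Leibniz:
      "f \<in> F \<inter> Cc_space \<Longrightarrow> g \<in> F \<inter> Cc_space \<Longrightarrow> h \<in> F \<inter> Cc_space \<Longrightarrow>
       \<exists>\<mu> \<nu>. signed_density (mixed_energy p \<Gamma> f h) g \<mu> \<and>
             signed_density (mixed_energy p \<Gamma> f g) h \<nu> \<and>
             (\<forall>A\<in>sets borel. mixed_energy p \<Gamma> f (\<lambda>x. g x * h x) A = \<mu> A + \<nu> A)"

section \<open>Quasi-continuity\<close>

definition energy1 ::
  "real \<Rightarrow> 'a measure \<Rightarrow> (('a \<Rightarrow> real) \<Rightarrow> real) \<Rightarrow> ('a \<Rightarrow> real) \<Rightarrow> real" where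
  "energy1 p m E f = E f + Lp_norm p m f powr p"

definition cap1_open ::
  "real \<Rightarrow> 'a measure \<Rightarrow> ('a \<Rightarrow> real) set \<Rightarrow> (('a \<Rightarrow> real) \<Rightarrow> real) \<Rightarrow> 'a set \<Rightarrow> ennreal" where
  "cap1_open p m F E U =
     (INF \<phi>\<in>{\<phi>\<in>F. AE x in m. x \<in> U \<longrightarrow> 1 \<le> \<phi> x}. ennreal (energy1 p m E \<phi>))"

definition cap1 ::
  "real \<Rightarrow> 'a::topological_space measure \<Rightarrow> ('a \<Rightarrow> real) set \<Rightarrow> (('a \<Rightarrow> real) \<Rightarrow> real) \<Rightarrow> 'a set \<Rightarrow> ennreal"
  where
  "cap1 p m F E A = (INF U\<in>{U. open U \<and> A \<subseteq> U}. cap1_open p m F E U)"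

definition quasi_continuous ::
  "real \<Rightarrow> 'a::topological_space measure \<Rightarrow> ('a \<Rightarrow> real) set \<Rightarrow> (('a \<Rightarrow> real) \<Rightarrow> real) \<Rightarrow>
   ('a \<Rightarrow> real) \<Rightarrow> bool" where
  "quasi_continuous p m F E u \<longleftrightarrow>
     (\<forall>\<epsilon>>0. \<exists>G. open G \<and> cap1 p m F E G < ennreal \<epsilon> \<and> continuous_on (- G) u)"

definition quasi_continuous_version ::
  "real \<Rightarrow> 'a::topological_space measure \<Rightarrow> ('a \<Rightarrow> real) set \<Rightarrow> (('a \<Rightarrow> real) \<Rightarrow> real) \<Rightarrow>
   ('a \<Rightarrow> real) \<Rightarrow> ('a \<Rightarrow> real) \<Rightarrow> bool" where
  "quasi_continuous_version p m F E f u \<longleftrightarrow>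
     u \<in> borel_measurable borel \<and> (AE x in m. u x = f x) \<and> quasi_continuous p m F E u"

section \<open>Volume, Poincare, cutoff Sobolev, capacity and resistance conditions\<close>

definition doubling_function :: "(real \<Rightarrow> real) \<Rightarrow> bool" where
  "doubling_function \<Phi> \<longleftrightarrow>
     (\<exists>\<Phi>'. homeomorphism {0..} {0..} \<Phi> \<Phi>') \<and> (\<exists>C>1. \<forall>r>0. \<Phi> (2 * r) \<le> C * \<Phi> r)"

definition volume_regular :: "'a::metric_space measure \<Rightarrow> (real \<Rightarrow> real) \<Rightarrow> bool" where
  "volume_regular m \<Phi> \<longleftrightarrow>
     (\<exists>C>0. \<forall>x. \<forall>r>0. ennreal r < ediam (UNIV :: 'a set) \<longrightarrow>
        1 / C * \<Phi> r \<le> measure m (ball x r) \<and> measure m (ball x r) \<le> C * \<Phi> r)"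

definition slow_volume_regular ::
  "real \<Rightarrow> 'a::metric_space measure \<Rightarrow> (real \<Rightarrow> real) \<Rightarrow> (real \<Rightarrow> real) \<Rightarrow> bool" where
  "slow_volume_regular p m \<Phi> \<Psi> \<longleftrightarrow> volume_regular m \<Phi> \<and>
     (\<exists>\<Theta> :: real \<Rightarrow> real.
        mono_on {0..1} \<Theta> \<and> continuous_on {0..1} \<Theta> \<and> \<Theta> ` {0..1} \<subseteq> {0..} \<and>
        \<Theta> 0 = 0 \<and> \<Theta> 1 \<ge> 1 \<and> summable (\<lambda>n. \<Theta> (1 / 2 ^ n) powr (1 / p)) \<and>
        (\<forall>R>0. \<forall>r>0. ennreal R < ediam (UNIV :: 'a set) \<longrightarrow> ennreal r < ediam (UNIV :: 'a set) \<longrightarrow>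
           r \<le> R \<longrightarrow> \<Phi> R / \<Phi> r \<le> \<Theta> (r / R) * (\<Psi> R / \<Psi> r)))"

definition mean_value :: "'a measure \<Rightarrow> 'a set \<Rightarrow> ('a \<Rightarrow> real) \<Rightarrow> real" where
  "mean_value m A u = 1 / measure m A * (LINT x:A|m. u x)"

definition Poincare ::
  "real \<Rightarrow> 'a::metric_space measure \<Rightarrow> ('a \<Rightarrow> real) set \<Rightarrow> (('a \<Rightarrow> real) \<Rightarrow> 'a measure) \<Rightarrow>
   (real \<Rightarrow> real) \<Rightarrow> bool" where
  "Poincare p m F \<Gamma> \<Psi> \<longleftrightarrow>
     (\<exists>C>0. \<exists>A\<ge>1. \<forall>x. \<forall>r>0. ennreal r < ediam (UNIV :: 'a set) / ennreal A \<longrightarrow>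
        (\<forall>f\<in>F. (\<integral>\<^sup>+y\<in>ball x r. ennreal (\<bar>f y - mean_value m (ball x r) f\<bar> powr p) \<partial>m)
                \<le> ennreal (C * \<Psi> r) * emeasure (\<Gamma> f) (ball x (A * r))))"

definition cutoff_function ::
  "'a::topological_space measure \<Rightarrow> ('a \<Rightarrow> real) set \<Rightarrow> 'a set \<Rightarrow> 'a set \<Rightarrow> ('a \<Rightarrow> real) \<Rightarrow> bool" where
  "cutoff_function m F U V \<phi> \<longleftrightarrow>
     \<phi> \<in> F \<and> (AE x in m. 0 \<le> \<phi> x \<and> \<phi> x \<le> 1) \<and>
     (\<exists>W. open W \<and> closure U \<subseteq> W \<and> ae_eq_on m W \<phi> 1) \<and>
     fun_support m \<phi> \<subseteq> V"

text \<open>Quasi-continuous versions are unique up to \<open>\<Gamma> \<phi>\<close>-null sets, so it is immaterial which one is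
  used on the left-hand side.\<close>

definition cutoff_Sobolev ::
  "real \<Rightarrow> 'a::metric_space measure \<Rightarrow> ('a \<Rightarrow> real) set \<Rightarrow> (('a \<Rightarrow> real) \<Rightarrow> real) \<Rightarrow>
   (('a \<Rightarrow> real) \<Rightarrow> 'a measure) \<Rightarrow> (real \<Rightarrow> real) \<Rightarrow> bool" where
  "cutoff_Sobolev p m F E \<Gamma> \<Psi> \<longleftrightarrow>
     (\<exists>C\<^sub>1>0. \<exists>C\<^sub>2>0. \<exists>A>1. \<forall>x. \<forall>r>0.
        \<exists>\<phi>. cutoff_function m F (ball x r) (ball x (A * r)) \<phi> \<and>
          (\<forall>f\<in>F. \<forall>u. quasi_continuous_version p m F E f u \<longrightarrow>
             (\<integral>\<^sup>+y\<in>ball x (A * r). ennreal (\<bar>u y\<bar> powr p) \<partial>\<Gamma> \<phi>)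
               \<le> ennreal C\<^sub>1 * emeasure (\<Gamma> f) (ball x (A * r))
                  + ennreal (C\<^sub>2 / \<Psi> r) * (\<integral>\<^sup>+y\<in>ball x (A * r). ennreal (\<bar>f y\<bar> powr p) \<partial>m)))"

definition capacity ::
  "'a::topological_space measure \<Rightarrow> ('a \<Rightarrow> real) set \<Rightarrow> (('a \<Rightarrow> real) \<Rightarrow> real) \<Rightarrow>
   'a set \<Rightarrow> 'a set \<Rightarrow> ennreal" where
  "capacity m F E A\<^sub>1 A\<^sub>2 =
     (INF \<phi>\<in>{\<phi>\<in>F. (\<exists>U. open U \<and> A\<^sub>1 \<subseteq> U \<and> ae_eq_on m U \<phi> 1) \<and>
                    (\<exists>U. open U \<and> A\<^sub>2 \<subseteq> U \<and> ae_eq_on m U \<phi> 0)}. ennreal (E \<phi>))"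

definition capacity_upper ::
  "'a::metric_space measure \<Rightarrow> ('a \<Rightarrow> real) set \<Rightarrow> (('a \<Rightarrow> real) \<Rightarrow> real) \<Rightarrow> (real \<Rightarrow> real) \<Rightarrow> bool" where
  "capacity_upper m F E \<Psi> \<longleftrightarrow>
     (\<exists>C>0. \<exists>A>1. \<forall>x. \<forall>r>0.
        capacity m F E (ball x r) (UNIV - ball x (A * r)) \<le> ennreal (C * (measure m (ball x r) / \<Psi> r)))"

text \<open>The set \<open>F\<close> is closed under a.e. equality, so the continuous version of an element of \<open>F\<close>
  (unique since \<open>m\<close> has full support) is itself in \<open>F\<close>. In \<^typ>\<open>ennreal\<close>, \<open>inverse 0 = \<infinity>\<close>,
  \<open>inverse \<infinity> = 0\<close> and \<open>Inf {} = \<infinity>\<close>.\<close>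

definition eff_resistance ::
  "('a::topological_space \<Rightarrow> real) set \<Rightarrow> (('a \<Rightarrow> real) \<Rightarrow> real) \<Rightarrow> 'a set \<Rightarrow> 'a set \<Rightarrow> ennreal" where
  "eff_resistance F E A B =
     inverse (INF u\<in>{u\<in>F. continuous_on UNIV u \<and> (\<forall>x\<in>A. u x = 0) \<and> (\<forall>x\<in>B. u x = 1)}. ennreal (E u))"

definition resistance_estimate ::
  "('a::metric_space \<Rightarrow> real) set \<Rightarrow> (('a \<Rightarrow> real) \<Rightarrow> real) \<Rightarrow>
   (real \<Rightarrow> real) \<Rightarrow> (real \<Rightarrow> real) \<Rightarrow> bool" where
  "resistance_estimate F E \<Phi> \<Psi> \<longleftrightarrow>
     (\<exists>C>0. \<forall>x y. x \<noteq> y \<longrightarrow>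
        ennreal (1 / C * (\<Psi> (dist x y) / \<Phi> (dist x y))) \<le> eff_resistance F E {x} {y} \<and>
        eff_resistance F E {x} {y} \<le> ennreal (C * (\<Psi> (dist x y) / \<Phi> (dist x y))))"

end

theory Submission
  imports Defs
begin

text \<open>
  The quotient \<open>\<Psi> r / \<Phi> r\<close>, called \<open>res r\<close> below, is the expected size of the resistance between points at
  distance \<open>r\<close>. Slow volume growth bounds \<open>res r\<close> by \<open>\<Theta> (r / R)\<close> times \<open>res R\<close>, where \<open>\<Theta>\<close> vanishes at \<open>0\<close> and
  its powers \<open>\<Theta> (2\<^bsup>-n\<^esup>)\<^bsup>1/p\<^esup>\<close> have a finite sum. So functions of finite energy oscillate little at small
  scales, and points have positive capacity; this is what makes pointwise statements (resistances)
  equivalent to integral ones (Poincare inequalities and capacities).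

  Given the Poincare inequality, the averages of \<open>f\<close> over the balls \<open>B(x, r / 2\<^bsup>n\<^esup>)\<close> change in the \<open>n\<close>-th
  step by at most a constant times \<open>(res (r / 2\<^bsup>n\<^esup>) \<Gamma>(f)(B(x, A r)))\<^bsup>1/p\<^esup>\<close>, which is summable
  (\<open>mean_telescope\<close>). Hence every \<open>f\<close> in the domain has a continuous version (\<open>continuous_version\<close>),
  quasi-continuous functions are continuous (\<open>quasi_continuous_imp_continuous\<close>), values of \<open>f\<close> are bounded
  by local averages and energy (\<open>point_powr_le\<close>), and a chain of points gives
  \<open>\<bar>f x - f y\<bar>\<^sup>p \<le> K res (d(x,y)) \<E>(f)\<close> (\<open>osc_global\<close>). The last estimate is the upper bound for the
  resistance; the potential of a ball is a competitor that gives the lower bound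
  (\<open>capacity_imp_resistance\<close>). For the cutoff Sobolev inequality, the integral of \<open>\<bar>f\<bar>\<^sup>p\<close> against the energy
  measure of the potential is at most the local supremum of \<open>\<bar>f\<bar>\<^sup>p\<close> times the capacity
  (\<open>capacity_imp_cutoff_Sobolev\<close>); conversely, the inequality is tested with a function that is \<open>1\<close> on the
  larger ball (\<open>cutoff_Sobolev_imp_capacity\<close>).

  Given the resistance estimate, functions that separate two points \<open>z\<close> and \<open>y\<close> are almost constant on
  balls of radius \<open>\<delta> r\<close> around these points (\<open>ball_separating\<close>). By doubling, boundedly many such balls cover
  \<open>B(x, r)\<close> and an annulus around it, and taking minima and maxima of the separating functions yields a
  cutoff function of energy at most a constant times \<open>1 / res r\<close> (\<open>cutoff_exists\<close>). This is the capacity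
  bound. For the Poincare inequality, the resistance estimate has to be localized (\<open>osc_local\<close>): if
  \<open>0 \<le> f \<le> 1\<close>, \<open>f x = 0\<close>, \<open>f y = 1\<close> with \<open>d(x, y) \<le> \<delta> r\<close>, and \<open>\<phi>\<close> is a cutoff function at scale \<open>r\<close>, then \<open>min f \<phi>\<close>
  has the same two values and energy at most \<open>\<Gamma>(f)(B(x, 4 r)) + \<E>(\<phi>)\<close>. By the resistance estimate at the
  small scale this energy is at least a large multiple of \<open>1 / res r\<close>, which \<open>\<E>(\<phi>)\<close> cannot account for when
  \<open>\<delta>\<close> is small. So \<open>\<Gamma>(f)(B(x, 4 r))\<close> bounds the oscillation of \<open>f\<close> in \<open>B(x, \<delta> r)\<close>.

  Energies of minima, maxima and clippings are read off from locality: functions that differ by a constant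
  on a set have the same energy there, and up to a constant a minimum, say, agrees with one of the two
  functions on each piece of a partition of the space.
\<close>

section \<open>Doubling functions and powers\<close>

lemma less_ediam_iff:
  assumes "0 \<le> r"
  shows "ennreal r < ediam (UNIV :: 'a::metric_space set) \<longleftrightarrow> (\<exists>a b :: 'a. r < dist a b)"
  using assms unfolding ediam_def less_SUP_iff by (auto simp: ennreal_less_iff)

lemma less_ediam_divide_iff:
  assumes "0 \<le> r" "0 < A"
  shows "ennreal r < ediam (UNIV :: 'a::metric_space set) / ennreal A
         \<longleftrightarrow> ennreal (A * r) < ediam (UNIV :: 'a set)"
proof (cases "ediam (UNIV :: 'a set)")
  case (real D)
  then show ?thesis using assms
    by (simp add: divide_ennreal ennreal_less_iff field_simps)
next
  case top
  then show ?thesis using assms by (simp add: ennreal_top_divide)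
qed

text \<open>The growth properties of a doubling function that are used. Monotonicity comes from surjectivity: a
  continuous function that once decreased would, on its way to large values, take some value twice.\<close>

lemma doubling_functionE:
  assumes "doubling_function \<Phi>"
  obtains C where "C \<ge> 1" "\<And>r. 0 < r \<Longrightarrow> 0 < \<Phi> r" "\<And>r s. 0 < r \<Longrightarrow> r \<le> s \<Longrightarrow> \<Phi> r \<le> \<Phi> s"
    "\<And>r. 0 < r \<Longrightarrow> \<Phi> (2 * r) \<le> C * \<Phi> r"
proof -
  obtain \<Phi>' C where hom: "homeomorphism {0..} {0..} \<Phi> \<Phi>'" and C: "C > 1" "\<And>r. r > 0 \<Longrightarrow> \<Phi> (2 * r) \<le> C * \<Phi> r"
    using assms unfolding doubling_function_def by blast
  have cont: "continuous_on {0..} \<Phi>" and im: "\<Phi> ` {0..} = {0..}"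
    using hom by (auto simp: homeomorphism_def)
  have inj: "inj_on \<Phi> {0..}" using hom by (metis homeomorphism_apply1 inj_on_inverseI)
  have nn: "0 \<le> \<Phi> r" if "0 \<le> r" for r using im that by force
  have sm: "\<Phi> r < \<Phi> s" if rs: "0 \<le> r" "r < s" for r s
  proof (rule ccontr)
    assume "\<not> \<Phi> r < \<Phi> s"
    then have lt: "\<Phi> s < \<Phi> r" using inj that by (metis atLeast_iff inj_onD less_eq_real_def less_irrefl linorder_neqE_linordered_idom order.trans)
    obtain B where B: "\<And>t. t \<in> {0..s} \<Longrightarrow> \<Phi> t \<le> B"
    proof -
      have "compact (\<Phi> ` {0..s})" by (rule compact_continuous_image[OF continuous_on_subset[OF cont]]) auto
      then have "bdd_above (\<Phi> ` {0..s})" by (intro bounded_imp_bdd_above compact_imp_bounded)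
      then obtain B where "\<And>y. y \<in> \<Phi> ` {0..s} \<Longrightarrow> y \<le> B" unfolding bdd_above_def by blast
      then show ?thesis by (intro that[of B]) blast
    qed
    \<comment> \<open>A value above both \<open>\<Phi> r\<close> and all values on \<open>[0, s]\<close> is attained to the right of \<open>s\<close>, so the
       value \<open>\<Phi> r\<close> is attained a second time.\<close>
    obtain T where T: "T \<ge> 0" "\<Phi> T = max (B + 1) (\<Phi> r + 1)"
    proof -
      have "max (B + 1) (\<Phi> r + 1) \<in> \<Phi> ` {0..}" using nn[OF rs(1)] by (simp add: im)
      then show ?thesis using that by force
    qed
    have Ts: "T > s" using B[of T] T by fastforce
    have "\<exists>t\<ge>s. t \<le> T \<and> \<Phi> t = \<Phi> r"
      by (rule IVT') (use T Ts lt that in \<open>auto intro: continuous_on_subset[OF cont]\<close>)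
    then obtain t where "t \<ge> s" "\<Phi> t = \<Phi> r" by blast
    then show False using inj that by (metis atLeast_iff inj_onD less_le_not_le order.trans less_imp_le)
  qed
  show ?thesis
  proof (rule that[of C])
    show "0 < \<Phi> r" if "0 < r" for r using sm[of 0 r] nn[of 0] that by auto
    show "\<Phi> r \<le> \<Phi> s" if "0 < r" "r \<le> s" for r s using sm[of r s] that by (cases "r = s") auto
  qed (use C in auto)
qed

lemma doubling_dilate:
  fixes f :: "real \<Rightarrow> real"
  assumes "1 \<le> C" and pos: "\<And>r. 0 < r \<Longrightarrow> 0 < f r" and mono: "\<And>r s. 0 < r \<Longrightarrow> r \<le> s \<Longrightarrow> f r \<le> f s"
    and dbl: "\<And>r. 0 < r \<Longrightarrow> f (2 * r) \<le> C * f r" and "0 < K"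
  obtains C' where "1 \<le> C'" "\<And>r. 0 < r \<Longrightarrow> f (K * r) \<le> C' * f r"
proof -
  have pw: "f (2 ^ n * r) \<le> C ^ n * f r" if "0 < r" for n r
  proof (induction n)
    case (Suc n)
    have "f (2 ^ Suc n * r) \<le> C * f (2 ^ n * r)" using dbl[of "2 ^ n * r"] that by (simp add: mult.assoc)
    also have "\<dots> \<le> C * (C ^ n * f r)" using Suc assms(1) by (intro mult_left_mono) auto
    finally show ?case by (simp add: mult.assoc)
  qed simp
  obtain n :: nat where n: "K \<le> 2 ^ n" by (metis less_imp_le one_less_numeral_iff real_arch_pow semiring_norm(76))
  show ?thesis
  proof (rule that[of "C ^ n"])
    show "f (K * r) \<le> C ^ n * f r" if "0 < r" for r
      using mono[of "K * r" "2 ^ n * r"] pw[OF that, of n] that n assms(5) by (smt (verit) mult_pos_pos mult_right_mono)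
  qed (use assms in auto)
qed

lemma powr_add_le:
  fixes a b p :: real
  assumes "0 \<le> a" "0 \<le> b" "0 < p"
  shows "(a + b) powr p \<le> 2 powr p * (a powr p + b powr p)"
proof -
  have "(a + b) powr p \<le> (2 * max a b) powr p" using assms by (intro powr_mono2) auto
  also have "\<dots> = 2 powr p * max a b powr p" using assms by (simp add: powr_mult)
  also have "max a b powr p \<le> a powr p + b powr p" by (auto simp: max_def)
  finally show ?thesis by simp
qed

lemma powr_inverse_le_iff:
  fixes a b p :: real
  assumes "0 \<le> a" "0 \<le> b" "0 < p"
  shows "a \<le> b powr (1 / p) \<longleftrightarrow> a powr p \<le> b"
proof
  assume "a \<le> b powr (1 / p)"
  then have "a powr p \<le> (b powr (1 / p)) powr p" using assms by (intro powr_mono2) auto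
  then show "a powr p \<le> b" using assms by (simp add: powr_powr)
next
  assume "a powr p \<le> b"
  then have "(a powr p) powr (1 / p) \<le> b powr (1 / p)" using assms by (intro powr_mono2) auto
  then show "a \<le> b powr (1 / p)" using assms by (simp add: powr_powr)
qed

lemma inverse_ennreal_antimono: "a \<le> b \<Longrightarrow> inverse b \<le> inverse a" for a b :: ennreal
  by (simp add: less_eq_ennreal.rep_eq inverse_ennreal.rep_eq ereal_inverse_antimono)

text \<open>Constants need not belong to the domain of the energy, so that \<open>f - f x\<close> is not available. Subtracting
  the retraction to the interval between \<open>0\<close> and \<open>a\<close> also moves the value \<open>a\<close> to \<open>0\<close>, and it keeps \<open>0\<close> fixed.
  Half of the distance to \<open>b\<close> may be lost when \<open>a\<close> and \<open>b\<close> have opposite signs.\<close>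

lemma threshold_map:
  fixes a b :: real
  assumes "\<bar>a\<bar> \<le> \<bar>b\<bar>"
  obtains \<phi> :: "real \<Rightarrow> real" where "\<And>s t. \<bar>\<phi> t - \<phi> s\<bar> \<le> \<bar>t - s\<bar>" "\<phi> 0 = 0" "\<phi> a = 0" "\<bar>a - b\<bar> \<le> 2 * \<bar>\<phi> b\<bar>"
proof (rule that[of "\<lambda>t. t - max (min a 0) (min t (max a 0))"])
  show "\<bar>(t - max (min a 0) (min t (max a 0))) - (s - max (min a 0) (min s (max a 0)))\<bar> \<le> \<bar>t - s\<bar>" for s t
    by (auto simp: min_def max_def)
  show "\<bar>a - b\<bar> \<le> 2 * \<bar>b - max (min a 0) (min b (max a 0))\<bar>"
    using assms by (auto simp: min_def max_def)
qed auto

section \<open>The metric measure space\<close>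

context metric_measure_space
begin

lemma sets_m [simp, measurable_cong]: "sets m = sets borel"
  using radon by (simp add: radon_measure_def)

lemma emeasure_bounded: "bounded S \<Longrightarrow> emeasure m S < \<infinity>"
proof -
  assume "bounded S"
  then obtain x r where "S \<subseteq> cball x r" by (meson bounded_subset_cball)
  then have "S \<subseteq> closure (ball x (r + 1))" using closure_subset[of "ball x (r + 1)"] by force
  moreover have "emeasure m (closure (ball x (r + 1))) < \<infinity>"
    using radon balls_relatively_compact unfolding radon_measure_def by blast
  ultimately show ?thesis
    by (metis (no_types, lifting) borel_closed closed_closure emeasure_mono order_le_less_trans sets_m)
qed

lemma emeasure_ball: "emeasure m (ball x r) = ennreal (measure m (ball x r))"
  using emeasure_bounded[OF bounded_ball, of x r] by (simp add: emeasure_eq_ennreal_measure top.not_eq_extremum)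

lemma fmeasurable_ball [simp, intro]: "ball x r \<in> fmeasurable m"
  using emeasure_bounded[OF bounded_ball, of x r] by (simp add: fmeasurable_def)

lemma measure_ball_pos: "0 < r \<Longrightarrow> 0 < measure m (ball x r)"
  using full_support[of "ball x r"] emeasure_ball[of x r] by (metis ball_eq_empty ennreal_0 measure_nonneg not_less open_ball order_less_irrefl less_eq_real_def)

lemma compact_closure_bounded: "bounded (S :: 'a set) \<Longrightarrow> compact (closure S)"
proof -
  assume "bounded S"
  then obtain x r where "S \<subseteq> cball x r" by (meson bounded_subset_cball)
  then have "S \<subseteq> ball x (r + 1)" by force
  then show ?thesis
    using compact_Int_closed[OF balls_relatively_compact closed_closure, of x "r + 1" S]
    by (simp add: inf_absorb2 closure_mono)
qed

lemma Cc_space_iff: "(f :: 'a \<Rightarrow> real) \<in> Cc_space \<longleftrightarrow> continuous_on UNIV f \<and> bounded {x. f x \<noteq> 0}"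
  unfolding Cc_space_def
  using compact_closure_bounded[of "{x. f x \<noteq> 0}"] compact_imp_bounded[of "closure {x. f x \<noteq> 0}"]
    bounded_subset[OF _ closure_subset, of "{x. f x \<noteq> 0}"] by auto

text \<open>A continuous function that vanishes almost everywhere on an open set vanishes there, because
  \<open>m\<close> charges every nonempty open set.\<close>

lemma AE_eq_imp_eq_on_open:
  fixes u :: "'a \<Rightarrow> real"
  assumes cont: "continuous_on UNIV u" and "open U" and ae: "AE x in m. x \<in> U \<longrightarrow> u x = c" and "x \<in> U"
  shows "u x = c"
proof (rule ccontr)
  assume "u x \<noteq> c"
  define W where "W = U \<inter> {y. u y \<noteq> c}"
  have "open {y. u y \<noteq> c}" using cont by (intro open_Collect_neq) auto
  then have W: "open W" "x \<in> W" using assms \<open>u x \<noteq> c\<close> by (auto simp: W_def)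
  have "AE x in m. x \<notin> W" using ae by eventually_elim (auto simp: W_def)
  then have "emeasure m W = 0" using W by (subst (asm) AE_iff_measurable[OF _ refl, of _ ]) (auto simp: Collect_conj_eq)
  then show False using full_support[OF W(1)] W(2) by auto
qed

end

section \<open>Averages over balls\<close>

context p_energy
begin

abbreviation mean :: "'a set \<Rightarrow> ('a \<Rightarrow> real) \<Rightarrow> real" where
  "mean \<equiv> mean_value m"

lemma borel_measurable_F: "f \<in> F \<Longrightarrow> f \<in> borel_measurable borel"
  using F_subset unfolding Lp_space_def by (auto simp: measurable_cong_sets[OF sets_m refl])

lemma p_pos [simp]: "0 < p" "p \<noteq> 0" "1 < p" "0 \<le> p" "1 \<le> p"
  using p_gt_1 by auto

lemma integrable_powr: "f \<in> F \<Longrightarrow> integrable m (\<lambda>x. \<bar>f x\<bar> powr p)"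
  using F_subset unfolding Lp_space_def by auto

lemma set_integrable_powr_diff:
  assumes "f \<in> F" shows "set_integrable m (ball x r) (\<lambda>y. \<bar>f y - c\<bar> powr p)"
proof (unfold set_integrable_def, rule Bochner_Integration.integrable_bound)
  have [measurable]: "f \<in> borel_measurable m" "ball x r \<in> sets m"
    using borel_measurable_F[OF assms] by (simp_all add: measurable_cong_sets[OF sets_m refl])
  show "integrable m (\<lambda>y. 2 powr p * (\<bar>f y\<bar> powr p + indicator (ball x r) y * \<bar>c\<bar> powr p))"
    using fmeasurable_ball[of x r] integrable_powr[OF assms]
    by (intro integrable_mult_right Bochner_Integration.integrable_add integrable_mult_left integrable_real_indicator) (auto simp: fmeasurable_def)
  show "(\<lambda>y. indicat_real (ball x r) y *\<^sub>R \<bar>f y - c\<bar> powr p) \<in> borel_measurable m" by measurable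
  have "\<bar>f y - c\<bar> powr p \<le> 2 powr p * (\<bar>f y\<bar> powr p + \<bar>c\<bar> powr p)" for y
  proof -
    have "\<bar>f y - c\<bar> powr p \<le> (\<bar>f y\<bar> + \<bar>c\<bar>) powr p" using p_gt_1 by (intro powr_mono2) auto
    also have "\<dots> \<le> 2 powr p * (\<bar>f y\<bar> powr p + \<bar>c\<bar> powr p)" using p_gt_1 by (intro powr_add_le) auto
    finally show ?thesis .
  qed
  then show "AE y in m. norm (indicat_real (ball x r) y *\<^sub>R \<bar>f y - c\<bar> powr p)
      \<le> norm (2 powr p * (\<bar>f y\<bar> powr p + indicator (ball x r) y * \<bar>c\<bar> powr p))"
    by (intro AE_I2) (auto simp: indicator_def abs_mult)
qed

lemma set_integrable_const: "set_integrable m (ball x r) (\<lambda>_. c :: real)"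
  using fmeasurable_ball[of x r] unfolding set_integrable_def
  by (simp add: fmeasurable_def)

lemma LINT_const: "(LINT y:ball x r|m. c) = c * measure m (ball x r)" for c :: real
  using fmeasurable_ball[of x r] unfolding set_lebesgue_integral_def
  by (simp add: fmeasurable_def)

lemma set_integrable_F:
  assumes "f \<in> F" shows "set_integrable m (ball x r) f"
proof (unfold set_integrable_def, rule Bochner_Integration.integrable_bound)
  have [measurable]: "f \<in> borel_measurable m" "ball x r \<in> sets m"
    using borel_measurable_F[OF assms] by (simp_all add: measurable_cong_sets[OF sets_m refl])
  show "integrable m (\<lambda>y. indicator (ball x r) y + \<bar>f y\<bar> powr p)"
    using fmeasurable_ball[of x r] integrable_powr[OF assms]
    by (intro Bochner_Integration.integrable_add integrable_real_indicator) (auto simp: fmeasurable_def)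
  show "(\<lambda>y. indicat_real (ball x r) y *\<^sub>R f y) \<in> borel_measurable m" by measurable
  have "\<bar>f y\<bar> \<le> 1 + \<bar>f y\<bar> powr p" for y
  proof (cases "\<bar>f y\<bar> \<le> 1")
    case False
    then have "\<bar>f y\<bar> powr 1 \<le> \<bar>f y\<bar> powr p" using p_gt_1 by (intro powr_mono) auto
    then show ?thesis by simp
  qed (simp add: add_increasing2)
  then show "AE y in m. norm (indicat_real (ball x r) y *\<^sub>R f y)
      \<le> norm (indicator (ball x r) y + \<bar>f y\<bar> powr p)"
    by (intro AE_I2) (auto simp: indicator_def)
qed

lemma mean_diff_const:
  assumes "f \<in> F" "0 < r"
  shows "mean (ball x r) f - c = (LINT y:ball x r|m. f y - c) / measure m (ball x r)"
proof -
  have "(LINT y:ball x r|m. f y - c) = (LINT y:ball x r|m. f y) - c * measure m (ball x r)"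
    by (subst set_integral_diff(2)) (auto simp: LINT_const set_integrable_F[OF assms(1)] set_integrable_const)
  then show ?thesis using measure_ball_pos[OF assms(2), of x] by (simp add: mean_value_def field_simps)
qed

lemma mean_ge:
  assumes "f \<in> F" "0 < r" and ae: "AE y in m. y \<in> ball x r \<longrightarrow> c \<le> f y"
  shows "c \<le> mean (ball x r) f"
proof -
  have "0 \<le> (LINT y:ball x r|m. f y - c)"
    unfolding set_lebesgue_integral_def
    by (rule integral_nonneg_AE) (use ae in \<open>eventually_elim, auto simp: indicator_def\<close>)
  then show ?thesis using mean_diff_const[OF assms(1,2), of x c] measure_ball_pos[OF assms(2), of x]
    by (metis diff_ge_0_iff_ge divide_nonneg_pos)
qed

lemma mean_le:
  assumes "f \<in> F" "0 < r" and ae: "AE y in m. y \<in> ball x r \<longrightarrow> f y \<le> c"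
  shows "mean (ball x r) f \<le> c"
proof -
  have "0 \<le> - (LINT y:ball x r|m. f y - c)"
    unfolding set_lebesgue_integral_def
    by (subst Bochner_Integration.integral_minus[symmetric], rule integral_nonneg_AE) (use ae in \<open>eventually_elim, auto simp: indicator_def\<close>)
  then show ?thesis using mean_diff_const[OF assms(1,2), of x c] measure_ball_pos[OF assms(2), of x]
    by (metis diff_le_0_iff_le divide_nonpos_pos neg_0_le_iff_le)
qed

text \<open>An average is controlled by the \<open>p\<close>-th moment: where \<open>\<bar>g\<bar>\<close> exceeds a level \<open>M\<close>, it is at most
  \<open>\<bar>g\<bar>\<^sup>p M\<^bsup>1-p\<^esup>\<close>; the level \<open>M = K\<^bsup>1/p\<^esup>\<close> balances the two contributions.\<close>

lemma mean_powr_le: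
  assumes f: "f \<in> F" and "0 < r"
    and le: "(LINT y:ball x r|m. \<bar>f y - c\<bar> powr p) \<le> K * measure m (ball x r)"
  shows "\<bar>mean (ball x r) f - c\<bar> powr p \<le> 2 powr p * K"
proof (rule dense_ge)
  fix L assume L: "2 powr p * K < L"
  let ?B = "ball x r" and ?V = "measure m (ball x r)"
  have V: "0 < ?V" by (rule measure_ball_pos[OF assms(2)])
  have "0 \<le> (LINT y:?B|m. \<bar>f y - c\<bar> powr p)" unfolding set_lebesgue_integral_def by (auto intro!: integral_nonneg_AE)
  then have "0 \<le> K * ?V" using le by simp
  then have K0: "0 \<le> K" using V by (simp add: zero_le_mult_iff)
  define M where "M = (L / 2 powr p) powr (1 / p)"
  have "0 \<le> 2 powr p * K" using K0 by simp
  then have "0 < L" using L by linarith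
  then have M: "0 < M" "M powr p = L / 2 powr p" by (auto simp: M_def powr_powr)
  have "K \<le> M powr p" using L by (simp add: M(2) field_simps)
  then have le': "(LINT y:?B|m. \<bar>f y - c\<bar> powr p) \<le> M powr p * ?V"
    using le V by (meson less_imp_le mult_right_mono order_trans)
  have pt: "\<bar>t\<bar> \<le> M + M powr (1 - p) * \<bar>t\<bar> powr p" for t
  proof (cases "\<bar>t\<bar> \<le> M")
    case False
    have "\<bar>t\<bar> = \<bar>t\<bar> powr (1 - p) * \<bar>t\<bar> powr p" using False M(1) by (simp flip: powr_add)
    also have "\<dots> \<le> M powr (1 - p) * \<bar>t\<bar> powr p"
      using False M(1) p_gt_1 by (intro mult_right_mono powr_mono2') auto
    finally show ?thesis using M(1) by simp
  qed (simp add: add_increasing2)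
  have I: "set_integrable m ?B (\<lambda>y. M + M powr (1 - p) * \<bar>f y - c\<bar> powr p)"
    by (intro set_integral_add set_integrable_mult_right set_integrable_const set_integrable_powr_diff f)
  have I': "set_integrable m ?B (\<lambda>y. f y - c)"
    by (intro set_integral_diff set_integrable_const set_integrable_F f)
  have "\<bar>LINT y:?B|m. f y - c\<bar> \<le> (LINT y:?B|m. \<bar>f y - c\<bar>)"
    using set_integral_norm_bound[OF I'] by simp
  also have "\<dots> \<le> (LINT y:?B|m. M + M powr (1 - p) * \<bar>f y - c\<bar> powr p)"
    by (rule set_integral_mono[OF _ I]) (use pt I' in \<open>auto intro: set_integrable_abs\<close>)
  also have "\<dots> = M * ?V + M powr (1 - p) * (LINT y:?B|m. \<bar>f y - c\<bar> powr p)"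
    by (subst set_integral_add(2))
      (auto intro!: set_integrable_const set_integrable_mult_right set_integrable_powr_diff f simp: LINT_const)
  also have "\<dots> \<le> M * ?V + M powr (1 - p) * (M powr p * ?V)"
    using le' by (intro add_left_mono mult_left_mono) auto
  also have "M powr (1 - p) * (M powr p * ?V) = M * ?V"
    using M(1) by (simp flip: powr_add mult.assoc)
  finally have "\<bar>mean ?B f - c\<bar> \<le> 2 * M"
    using V by (simp add: mean_diff_const[OF f assms(2)] field_simps)
  then have "\<bar>mean ?B f - c\<bar> powr p \<le> (2 * M) powr p" using p_gt_1 by (intro powr_mono2) auto
  also have "\<dots> = L" using M by (simp add: powr_mult)
  finally show "\<bar>mean ?B f - c\<bar> powr p \<le> L" .
qed

lemma mean_tendsto_of_continuous:
  assumes f: "f \<in> F" and cont: "continuous_on UNIV f" and r: "0 < r"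
  shows "(\<lambda>n. mean (ball x (r / 2 ^ n)) f) \<longlonglongrightarrow> f x"
proof (rule LIMSEQ_I)
  fix e :: real assume "0 < e"
  then obtain d where d: "0 < d" "\<And>y. dist y x < d \<Longrightarrow> dist (f y) (f x) < e / 2"
    using cont unfolding continuous_on_iff by (metis UNIV_I half_gt_zero)
  have "(\<lambda>n. r / 2 ^ n) \<longlonglongrightarrow> 0" by real_asymp
  then have "eventually (\<lambda>n. r / 2 ^ n < d) sequentially" using d(1) by (rule order_tendstoD)
  then obtain N where N: "\<And>n. n \<ge> N \<Longrightarrow> r / 2 ^ n < d" unfolding eventually_sequentially by auto
  have "norm (mean (ball x (r / 2 ^ n)) f - f x) < e" if "n \<ge> N" for n
  proof -
    have near: "\<bar>f y - f x\<bar> \<le> e / 2" if "y \<in> ball x (r / 2 ^ n)" for y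
      using d(2)[of y] N[OF \<open>n \<ge> N\<close>] that by (auto simp: dist_real_def dist_commute)
    have near': "f x - e / 2 \<le> f y" "f y \<le> f x + e / 2" if "y \<in> ball x (r / 2 ^ n)" for y
      using near[OF that] by linarith+
    have "f x - e / 2 \<le> mean (ball x (r / 2 ^ n)) f"
      by (rule mean_ge[OF f]) (use r near' in \<open>auto intro!: AE_I2\<close>)
    moreover have "mean (ball x (r / 2 ^ n)) f \<le> f x + e / 2"
      by (rule mean_le[OF f]) (use r near' in \<open>auto intro!: AE_I2\<close>)
    ultimately show ?thesis using \<open>0 < e\<close> by (auto simp: abs_less_iff)
  qed
  then show "\<exists>N. \<forall>n\<ge>N. norm (mean (ball x (r / 2 ^ n)) f - f x) < e" by blast
qed

lemma nn_integral_powr_diff: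
  assumes "f \<in> F"
  shows "(\<integral>\<^sup>+y\<in>ball x r. ennreal (\<bar>f y - c\<bar> powr p) \<partial>m) = ennreal (LINT y:ball x r|m. \<bar>f y - c\<bar> powr p)"
proof -
  have "(\<integral>\<^sup>+y\<in>ball x r. ennreal (\<bar>f y - c\<bar> powr p) \<partial>m)
      = (\<integral>\<^sup>+y. ennreal (indicator (ball x r) y *\<^sub>R \<bar>f y - c\<bar> powr p) \<partial>m)"
    by (intro nn_integral_cong) (auto simp: indicator_def)
  also have "\<dots> = ennreal (LINT y:ball x r|m. \<bar>f y - c\<bar> powr p)"
    unfolding set_lebesgue_integral_def
    using set_integrable_powr_diff[OF assms, of x r c]
    by (intro nn_integral_eq_integral) (auto simp: set_integrable_def)
  finally show ?thesis .
qed

lemma LINT_powr_diff_nonneg: "0 \<le> (LINT y:ball x r|m. \<bar>f y - c\<bar> powr p)"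
  unfolding set_lebesgue_integral_def by (auto intro!: integral_nonneg_AE)

lemma LINT_powr_le_total:
  assumes "f \<in> F" shows "(LINT y:ball x r|m. \<bar>f y\<bar> powr p) \<le> (\<integral>y. \<bar>f y\<bar> powr p \<partial>m)"
  unfolding set_lebesgue_integral_def
  using set_integrable_powr_diff[OF assms, of x r 0] integrable_powr[OF assms]
  by (intro integral_mono) (auto simp: set_integrable_def indicator_def)

lemma energy1_eq: "energy1 p m E f = E f + (\<integral>x. \<bar>f x\<bar> powr p \<partial>m)"
  by (simp add: energy1_def Lp_norm_def powr_powr)

lemma mean_abs_powr_le:
  assumes "f \<in> F" "0 < r"
  shows "\<bar>mean (ball x r) f\<bar> powr p \<le> 2 powr p * ((LINT y:ball x r|m. \<bar>f y\<bar> powr p) / measure m (ball x r))"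
  using mean_powr_le[OF assms, of x 0 "(LINT y:ball x r|m. \<bar>f y\<bar> powr p) / measure m (ball x r)"]
    measure_ball_pos[OF assms(2), of x] by simp

text \<open>The measures \<open>\<bar>f\<bar> m\<close> and \<open>\<bar>u\<bar> m\<close> coincide, and an open set is null for them exactly if \<open>u\<close> vanishes on it.\<close>

lemma fun_support_continuous:
  assumes f: "f \<in> F" and cont: "continuous_on UNIV u" and ae: "AE x in m. u x = f x"
  shows "fun_support m f = closure {x. u x \<noteq> 0}"
proof -
  have [measurable]: "f \<in> borel_measurable m" "u \<in> borel_measurable m"
    using borel_measurable_F[OF f] borel_measurable_continuous_onI[OF cont]
    by (simp_all add: measurable_cong_sets[OF sets_m refl])
  have dens: "density m (\<lambda>x. ennreal \<bar>f x\<bar>) = density m (\<lambda>x. ennreal \<bar>u x\<bar>)"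
    by (rule density_cong) (use ae in auto)
  have key: "0 < emeasure (density m (\<lambda>x. ennreal \<bar>u x\<bar>)) U \<longleftrightarrow> U \<inter> {x. u x \<noteq> 0} \<noteq> {}" if "open U" for U
  proof -
    have [measurable]: "U \<in> sets m" unfolding sets_m by (rule borel_open[OF that])
    have "emeasure (density m (\<lambda>x. ennreal \<bar>u x\<bar>)) U = (\<integral>\<^sup>+x. ennreal \<bar>u x\<bar> * indicator U x \<partial>m)"
      by (rule emeasure_density) (use borel_open[OF that] in auto)
    also have "\<dots> = 0 \<longleftrightarrow> (AE x in m. ennreal \<bar>u x\<bar> * indicator U x = 0)"
      by (rule nn_integral_0_iff_AE) measurable
    also have "\<dots> \<longleftrightarrow> (AE x in m. x \<in> U \<longrightarrow> u x = 0)"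
      by (intro AE_cong) (auto simp: indicator_def)
    also have "\<dots> \<longleftrightarrow> (\<forall>x\<in>U. u x = 0)"
    proof
      assume "AE x in m. x \<in> U \<longrightarrow> u x = 0"
      then show "\<forall>x\<in>U. u x = 0" using AE_eq_imp_eq_on_open[OF cont that, of 0] by blast
    qed auto
    finally show ?thesis by (auto simp: zero_less_iff_neq_zero)
  qed
  show ?thesis
  proof (intro set_eqI iffI)
    fix y assume y: "y \<in> fun_support m f"
    show "y \<in> closure {x. u x \<noteq> 0}"
    proof (rule ccontr)
      assume "y \<notin> closure {x. u x \<noteq> 0}"
      then have "open (- closure {x. u x \<noteq> 0})" "y \<in> - closure {x. u x \<noteq> 0}" by auto
      then have "0 < emeasure (density m (\<lambda>x. ennreal \<bar>u x\<bar>)) (- closure {x. u x \<noteq> 0})"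
        using y unfolding fun_support_def measure_support_def dens by blast
      then show False using key[of "- closure {x. u x \<noteq> 0}"] closure_subset[of "{x. u x \<noteq> 0}"] by blast
    qed
  next
    fix y assume y: "y \<in> closure {x. u x \<noteq> 0}"
    have "0 < emeasure (density m (\<lambda>x. ennreal \<bar>u x\<bar>)) U" if "open U" "y \<in> U" for U
      using key[OF that(1)] open_Int_closure_eq_empty[OF that(1), of "{x. u x \<noteq> 0}"] that(2) y by blast
    then show "y \<in> fun_support m f" unfolding fun_support_def measure_support_def dens by blast
  qed
qed

end

section \<open>The core and the energy measures\<close>

context p_energy_measure
begin

text \<open>Locality of the energy measures is stated for these functions; arguments that cut and paste are carried
  out in the core and then extended by density.\<close>

definition core :: "('a \<Rightarrow> real) set" where
  "core = F \<inter> Cc_space"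

abbreviation En :: "('a \<Rightarrow> real) \<Rightarrow> 'a set \<Rightarrow> real" where
  "En f A \<equiv> measure (\<Gamma> f) A"

lemma core_F: "f \<in> core \<Longrightarrow> f \<in> F"
  by (simp add: core_def)

lemma core_cont: "f \<in> core \<Longrightarrow> continuous_on UNIV f"
  by (simp add: core_def Cc_space_def)

lemma core_I: "f \<in> F \<Longrightarrow> continuous_on UNIV f \<Longrightarrow> bounded {x. f x \<noteq> 0} \<Longrightarrow> f \<in> core"
  by (simp add: core_def Cc_space_iff)

lemma core_bounded: "f \<in> core \<Longrightarrow> bounded {x. f x \<noteq> 0}"
  by (simp add: core_def Cc_space_iff)

lemma borel_measurable_core: "f \<in> core \<Longrightarrow> f \<in> borel_measurable borel"
  using core_cont by (rule borel_measurable_continuous_onI)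

lemma F_diff: "f \<in> F \<Longrightarrow> g \<in> F \<Longrightarrow> (\<lambda>x. f x - g x) \<in> F"
  using F_add[OF _ F_scale[of g "-1"], of f] by simp

lemma core_zero: "(\<lambda>_. 0) \<in> core"
  by (rule core_I[OF F_zero]) auto

lemma core_scale: "f \<in> core \<Longrightarrow> (\<lambda>x. c * f x) \<in> core"
proof (rule core_I)
  assume f: "f \<in> core"
  show "(\<lambda>x. c * f x) \<in> F" "continuous_on UNIV (\<lambda>x. c * f x)"
    using core_F[OF f] core_cont[OF f] by (auto intro: F_scale intro!: continuous_intros)
  show "bounded {x. c * f x \<noteq> 0}" by (rule bounded_subset[OF core_bounded[OF f]]) auto
qed

lemma core_uminus: "f \<in> core \<Longrightarrow> (\<lambda>x. - f x) \<in> core"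
  using core_scale[of f "-1"] by simp

lemma core_add: "f \<in> core \<Longrightarrow> g \<in> core \<Longrightarrow> (\<lambda>x. f x + g x) \<in> core"
proof (rule core_I)
  assume fg: "f \<in> core" "g \<in> core"
  show "(\<lambda>x. f x + g x) \<in> F" "continuous_on UNIV (\<lambda>x. f x + g x)"
    using fg[THEN core_F] fg[THEN core_cont] by (auto intro: F_add intro!: continuous_intros)
  have "bounded ({x. f x \<noteq> 0} \<union> {x. g x \<noteq> 0})" using fg by (auto simp: core_bounded)
  then show "bounded {x. f x + g x \<noteq> 0}" by (rule bounded_subset) auto
qed

lemma core_diff: "f \<in> core \<Longrightarrow> g \<in> core \<Longrightarrow> (\<lambda>x. f x - g x) \<in> core"
  using core_add[OF _ core_scale[of g "-1"], of f] by simp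

lemma Markov:
  assumes lip: "\<And>s t :: real. \<bar>\<phi> t - \<phi> s\<bar> \<le> \<bar>t - s\<bar>" and "\<phi> 0 = 0" and "f \<in> F"
  shows "(\<lambda>x. \<phi> (f x)) \<in> F" "E (\<lambda>x. \<phi> (f x)) \<le> E f"
proof -
  have "1-lipschitz_on UNIV \<phi>" using lip by (intro lipschitz_onI) (auto simp: dist_real_def)
  then have "continuous_on UNIV \<phi>" by (rule lipschitz_on_continuous_on)
  then show "(\<lambda>x. \<phi> (f x)) \<in> F" "E (\<lambda>x. \<phi> (f x)) \<le> E f"
    using Markovian[of \<phi> f] assms by auto
qed

lemma core_Markov:
  assumes lip: "\<And>s t :: real. \<bar>\<phi> t - \<phi> s\<bar> \<le> \<bar>t - s\<bar>" and "\<phi> 0 = 0" and "f \<in> core"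
  shows "(\<lambda>x. \<phi> (f x)) \<in> core"
proof (rule core_I)
  have "1-lipschitz_on UNIV \<phi>" using lip by (intro lipschitz_onI) (auto simp: dist_real_def)
  then have "continuous_on UNIV \<phi>" by (rule lipschitz_on_continuous_on)
  then show "continuous_on UNIV (\<lambda>x. \<phi> (f x))"
    using core_cont[OF assms(3)] by (auto intro: continuous_on_compose2)
  show "(\<lambda>x. \<phi> (f x)) \<in> F" using Markov(1)[of \<phi> f] lip assms(2,3) core_F by auto
  show "bounded {x. \<phi> (f x) \<noteq> 0}" using core_bounded[OF assms(3)] assms(2) by (auto elim!: bounded_subset)
qed

lemma core_max:
  assumes "f \<in> core" "g \<in> core" shows "(\<lambda>x. max (f x) (g x)) \<in> core"
proof -
  have abs: "(\<lambda>x. \<bar>f x - g x\<bar>) \<in> core"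
    using core_Markov[of abs, OF _ _ core_diff[OF assms]] by auto
  have "(\<lambda>x. max (f x) (g x)) = (\<lambda>x. (1/2) * (f x + g x + \<bar>f x - g x\<bar>))"
    by (rule ext) (auto simp: max_def)
  then show ?thesis using core_scale[OF core_add[OF core_add[OF assms] abs], of "1/2"] by simp
qed

lemma core_min:
  assumes "f \<in> core" "g \<in> core" shows "(\<lambda>x. min (f x) (g x)) \<in> core"
proof -
  have "(\<lambda>x. min (f x) (g x)) = (\<lambda>x. f x + g x - max (f x) (g x))"
    by (rule ext) (auto simp: max_def)
  then show ?thesis using core_diff[OF core_add[OF assms] core_max[OF assms]] by simp
qed

lemma clip_lip: "a \<le> b \<Longrightarrow> \<bar>(min b (max a t) - a) - (min b (max a s) - a)\<bar> \<le> \<bar>t - s\<bar>" for t s :: real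
  by (auto simp: min_def max_def)

lemma core_clip: "f \<in> core \<Longrightarrow> 0 \<le> a \<Longrightarrow> a \<le> b \<Longrightarrow> (\<lambda>x. min b (max a (f x)) - a) \<in> core"
  by (rule core_Markov[of "\<lambda>t. min b (max a t) - a"]) (auto simp: clip_lip)

text \<open>Regularity only provides functions near a given one in the uniform norm; clipping such an
  approximation between two levels makes it equal to \<open>1\<close> and to \<open>0\<close> where prescribed.\<close>

lemma plateau_exists:
  assumes "r < s"
  obtains \<psi> where "\<psi> \<in> core" "\<And>y. 0 \<le> \<psi> y \<and> \<psi> y \<le> 1" "\<And>y. dist x y \<le> r \<Longrightarrow> \<psi> y = 1"
    "\<And>y. s \<le> dist x y \<Longrightarrow> \<psi> y = 0"
proof -
  define f where "f y = max 0 (min 1 ((s - dist x y) / (s - r)))" for y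
  have "f \<in> Cc_space"
  proof (unfold Cc_space_iff, rule conjI)
    show "continuous_on UNIV f" unfolding f_def using assms by (intro continuous_intros) auto
    have "f y = 0" if "s \<le> dist x y" for y using that assms by (simp add: f_def divide_le_0_iff)
    then have "{y. f y \<noteq> 0} \<subseteq> cball x s" by (force simp: not_le[symmetric])
    then show "bounded {y. f y \<noteq> 0}" by (rule bounded_subset[OF bounded_cball])
  qed
  then obtain g where g: "g \<in> core" "\<And>y. \<bar>f y - g y\<bar> < 1/4"
    using regular_Cc[of f "1/4"] by (auto simp: core_def)
  show ?thesis
  proof (rule that[of "\<lambda>y. 2 * (min (3/4) (max (1/4) (g y)) - 1/4)"])
    show "(\<lambda>y. 2 * (min (3/4) (max (1/4) (g y)) - 1/4)) \<in> core" using g by (intro core_scale core_clip) auto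
    fix y
    show "0 \<le> 2 * (min (3/4) (max (1/4) (g y)) - 1/4) \<and> 2 * (min (3/4) (max (1/4) (g y)) - 1/4) \<le> 1" by auto
    { assume "dist x y \<le> r"
      then have "f y = 1" using assms by (simp add: f_def le_divide_eq)
      then have "3/4 \<le> g y" using g(2)[of y] by arith
      then show "2 * (min (3/4) (max (1/4) (g y)) - 1/4) = 1" by simp }
    { assume "s \<le> dist x y"
      then have "f y = 0" using assms by (simp add: f_def divide_le_0_iff)
      then have "g y \<le> 1/4" using g(2)[of y] by arith
      then show "2 * (min (3/4) (max (1/4) (g y)) - 1/4) = 0" by simp }
  qed
qed

lemma one_core:
  assumes "bounded (UNIV :: 'a set)" shows "(\<lambda>_. 1) \<in> core"
proof -
  obtain x r where r: "UNIV \<subseteq> cball (x::'a) r" using assms by (meson bounded_subset_cball)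
  obtain \<psi> where "\<psi> \<in> core" "\<And>y. dist x y \<le> r \<Longrightarrow> \<psi> y = 1"
    using plateau_exists[of r "r + 1" x] by (metis less_add_one)
  moreover have "\<psi> = (\<lambda>_. 1)"
    using subsetD[OF r UNIV_I] calculation(2) by (intro ext) (simp only: mem_cball)
  ultimately show ?thesis by simp
qed

lemma sets_\<Gamma>: "f \<in> F \<Longrightarrow> sets (\<Gamma> f) = sets borel"
  using \<Gamma>_radon by (simp add: radon_measure_def)

lemma finite_\<Gamma>: "f \<in> F \<Longrightarrow> finite_measure (\<Gamma> f)"
  using \<Gamma>_total[of f] sets_eq_imp_space_eq[OF sets_\<Gamma>, of f] by (intro finite_measureI) auto

lemma emeasure_\<Gamma>: "f \<in> F \<Longrightarrow> emeasure (\<Gamma> f) A = ennreal (En f A)"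
  using finite_\<Gamma> finite_measure.emeasure_eq_measure by blast

lemma E_eq: "f \<in> F \<Longrightarrow> E f = En f UNIV"
  using \<Gamma>_total[of f] emeasure_\<Gamma>[of f UNIV] E_nonneg[of f] by simp

lemma En_mono: "f \<in> F \<Longrightarrow> B \<in> sets borel \<Longrightarrow> A \<subseteq> B \<Longrightarrow> En f A \<le> En f B"
  by (rule finite_measure.finite_measure_mono) (auto simp: finite_\<Gamma> sets_\<Gamma>)

lemma En_le_E: "f \<in> F \<Longrightarrow> En f A \<le> E f"
  using En_mono[of f UNIV A] by (auto simp: E_eq)

lemma En_Un: "f \<in> F \<Longrightarrow> A \<in> sets borel \<Longrightarrow> B \<in> sets borel \<Longrightarrow> A \<inter> B = {} \<Longrightarrow> En f (A \<union> B) = En f A + En f B"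
  by (rule finite_measure.finite_measure_Union) (auto simp: finite_\<Gamma> sets_\<Gamma>)

lemma En_const:
  "f \<in> core \<Longrightarrow> g \<in> core \<Longrightarrow> A \<in> sets borel \<Longrightarrow> (\<And>x. x \<in> A \<Longrightarrow> f x - g x = c) \<Longrightarrow> En f A = En g A"
  using \<Gamma>_const[of f g A] by (auto simp: core_def)

lemma En_triangle:
  "f \<in> F \<Longrightarrow> g \<in> F \<Longrightarrow> A \<in> sets borel \<Longrightarrow>
   En (\<lambda>x. f x + g x) A powr (1 / p) \<le> En f A powr (1 / p) + En g A powr (1 / p)"
  using \<Gamma>_seminorm[of A] by (auto simp: seminorm_on_def)

lemma En_scale:
  assumes "f \<in> F" "A \<in> sets borel"
  shows "En (\<lambda>x. c * f x) A = \<bar>c\<bar> powr p * En f A"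
proof -
  have "En (\<lambda>x. c * f x) A powr (1 / p) = \<bar>c\<bar> * En f A powr (1 / p)"
    using \<Gamma>_seminorm[of A] assms by (auto simp: seminorm_on_def)
  then have "(En (\<lambda>x. c * f x) A powr (1 / p)) powr p = (\<bar>c\<bar> * En f A powr (1 / p)) powr p" by simp
  then show ?thesis by (simp add: powr_powr powr_mult)
qed

lemma En_uminus: "f \<in> F \<Longrightarrow> A \<in> sets borel \<Longrightarrow> En (\<lambda>x. - f x) A = En f A"
  using En_scale[of f A "-1"] by simp

lemma E_scale: "f \<in> F \<Longrightarrow> E (\<lambda>x. c * f x) = \<bar>c\<bar> powr p * E f"
  using En_scale[of f UNIV c] by (simp add: E_eq F_scale)

lemma E_zero: "E (\<lambda>_. 0) = 0"
  using E_scale[OF F_zero, of 0] by simp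

lemma En_zero: "En (\<lambda>_. 0) A = 0"
  using En_le_E[OF F_zero, of A] measure_nonneg[of "\<Gamma> (\<lambda>_. 0)" A] by (simp add: E_zero del: measure_nonneg)

lemma En_constant:
  "f \<in> core \<Longrightarrow> A \<in> sets borel \<Longrightarrow> (\<And>x. x \<in> A \<Longrightarrow> f x = c) \<Longrightarrow> En f A = 0"
  using En_const[of f "\<lambda>_. 0" A c] by (simp add: core_zero En_zero)

lemma levelset_borel:
  assumes "f \<in> core" "g \<in> core" shows "{x. f x < g x} \<in> sets borel" "{x. f x \<le> g x} \<in> sets borel"
  using assms[THEN core_cont] by (blast intro: borel_open open_Collect_less borel_closed closed_Collect_le)+

text \<open>Where one function is smaller, it is the minimum; so on each of the two pieces of the space the
  energy measure of the minimum is that of one of the functions.\<close>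

lemma En_min_eq:
  assumes "f \<in> core" "g \<in> core" "A \<in> sets borel"
  shows "En (\<lambda>x. min (f x) (g x)) A = En f (A \<inter> {x. f x < g x}) + En g (A \<inter> {x. g x \<le> f x})"
proof -
  let ?h = "\<lambda>x. min (f x) (g x)"
  have h: "?h \<in> core" by (rule core_min[OF assms(1,2)])
  have "A = (A \<inter> {x. f x < g x}) \<union> (A \<inter> {x. g x \<le> f x})" by auto
  then have "En ?h A = En ?h ((A \<inter> {x. f x < g x}) \<union> (A \<inter> {x. g x \<le> f x}))" by simp
  also have "\<dots> = En ?h (A \<inter> {x. f x < g x}) + En ?h (A \<inter> {x. g x \<le> f x})"
    by (rule En_Un[OF core_F[OF h]]) (use assms levelset_borel in auto)
  finally have "En ?h A = En ?h (A \<inter> {x. f x < g x}) + En ?h (A \<inter> {x. g x \<le> f x})" .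
  moreover have "En ?h (A \<inter> {x. f x < g x}) = En f (A \<inter> {x. f x < g x})"
    by (rule En_const[OF h assms(1), of _ 0]) (use assms levelset_borel in auto)
  moreover have "En ?h (A \<inter> {x. g x \<le> f x}) = En g (A \<inter> {x. g x \<le> f x})"
    by (rule En_const[OF h assms(2), of _ 0]) (use assms levelset_borel in auto)
  ultimately show ?thesis by simp
qed

lemma En_min:
  assumes "f \<in> core" "g \<in> core" "A \<in> sets borel"
  shows "En (\<lambda>x. min (f x) (g x)) A \<le> En f A + En g A"
  unfolding En_min_eq[OF assms] using assms
  by (intro add_mono En_mono core_F) auto

lemma En_max:
  assumes "f \<in> core" "g \<in> core" "A \<in> sets borel"
  shows "En (\<lambda>x. max (f x) (g x)) A \<le> En f A + En g A"
proof -
  have eq: "(\<lambda>x. max (f x) (g x)) = (\<lambda>x. - min (- f x) (- g x))" by (auto simp: min_def max_def)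
  have "En (\<lambda>x. max (f x) (g x)) A = En (\<lambda>x. min (- f x) (- g x)) A"
    unfolding eq by (subst En_uminus) (use assms in \<open>auto intro!: core_F core_min core_uminus\<close>)
  also have "\<dots> \<le> En (\<lambda>x. - f x) A + En (\<lambda>x. - g x) A"
    by (rule En_min) (use assms in \<open>auto intro!: core_uminus\<close>)
  also have "\<dots> = En f A + En g A" using assms by (simp add: En_uminus core_F)
  finally show ?thesis .
qed

text \<open>Clipping is constant where it acts and a translation elsewhere.\<close>

lemma En_clip:
  assumes f: "f \<in> core" and A: "A \<in> sets borel" and "0 \<le> a" "a \<le> b"
  shows "En (\<lambda>x. min b (max a (f x)) - a) A \<le> En f A"
proof -
  let ?h = "\<lambda>x. min b (max a (f x)) - a"
  have h: "?h \<in> core" using assms by (intro core_clip)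
  have [measurable]: "f \<in> borel_measurable borel" using borel_measurable_core f by blast
  let ?L = "A \<inter> {x. f x < a}" and ?M = "A \<inter> {x. a \<le> f x \<and> f x \<le> b}" and ?U = "A \<inter> {x. b < f x}"
  have m: "?L \<in> sets borel" "?M \<in> sets borel" "?U \<in> sets borel"
    using A by (auto intro!: sets.Int)
  have "En ?h A = En ?h (?L \<union> (?M \<union> ?U))" by (rule arg_cong[where f = "En ?h"]) auto
  also have "\<dots> = En ?h ?L + (En ?h ?M + En ?h ?U)"
    using m assms(4) by (subst En_Un[OF core_F[OF h]], auto)+
  also have "En ?h ?L = 0" using m assms by (intro En_constant[OF h, of _ 0]) auto
  also have "En ?h ?U = 0" using m assms by (intro En_constant[OF h, of _ "b - a"]) auto
  also have "En ?h ?M = En f ?M" using m assms by (intro En_const[OF h f, of _ "-a"]) auto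
  also have "En f ?M \<le> En f A" using A by (intro En_mono core_F f) auto
  finally show ?thesis by simp
qed

lemma E_one: "bounded (UNIV :: 'a set) \<Longrightarrow> E (\<lambda>_. 1) = 0"
  using En_constant[OF one_core, of UNIV 1] by (simp add: E_eq core_F one_core)

lemma En_add_le:
  assumes "f \<in> F" "g \<in> F" "B \<in> sets borel"
  shows "En (\<lambda>x. f x + g x) B \<le> 2 powr p * (En f B + En g B)"
proof -
  have "(En (\<lambda>x. f x + g x) B powr (1 / p)) powr p \<le> (En f B powr (1 / p) + En g B powr (1 / p)) powr p"
    by (intro powr_mono2 En_triangle assms) auto
  also have "\<dots> \<le> 2 powr p * ((En f B powr (1 / p)) powr p + (En g B powr (1 / p)) powr p)"
    by (intro powr_add_le) auto
  finally show ?thesis by (simp add: powr_powr)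
qed

lemma E_add_le:
  assumes "f \<in> F" "g \<in> F" shows "E (\<lambda>x. f x + g x) \<le> 2 powr p * (E f + E g)"
  using En_add_le[OF assms, of UNIV] assms by (simp add: E_eq F_add)

text \<open>Up to the factor \<open>2\<^sup>p\<close>, the functional \<open>energy1\<close> is subadditive by a pointwise inequality; it thereby takes the
  place of the energy norm, whose triangle inequality would require that of \<open>L\<^sup>p\<close>.\<close>

lemma energy1_add_le:
  assumes "f \<in> F" "g \<in> F"
  shows "energy1 p m E (\<lambda>x. f x + g x) \<le> 2 powr p * (energy1 p m E f + energy1 p m E g)"
proof -
  have fg: "(\<lambda>x. f x + g x) \<in> F" using F_add assms .
  have "(\<integral>x. \<bar>f x + g x\<bar> powr p \<partial>m) \<le> (\<integral>x. 2 powr p * (\<bar>f x\<bar> powr p + \<bar>g x\<bar> powr p) \<partial>m)"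
  proof (rule integral_mono)
    show "integrable m (\<lambda>x. \<bar>f x + g x\<bar> powr p)" using integrable_powr[OF fg] .
    show "integrable m (\<lambda>x. 2 powr p * (\<bar>f x\<bar> powr p + \<bar>g x\<bar> powr p))" using assms[THEN integrable_powr] by auto
    fix x
    have "\<bar>f x + g x\<bar> powr p \<le> (\<bar>f x\<bar> + \<bar>g x\<bar>) powr p" by (intro powr_mono2) auto
    also have "\<dots> \<le> 2 powr p * (\<bar>f x\<bar> powr p + \<bar>g x\<bar> powr p)" by (intro powr_add_le) auto
    finally show "\<bar>f x + g x\<bar> powr p \<le> 2 powr p * (\<bar>f x\<bar> powr p + \<bar>g x\<bar> powr p)" .
  qed
  also have "\<dots> = 2 powr p * ((\<integral>x. \<bar>f x\<bar> powr p \<partial>m) + (\<integral>x. \<bar>g x\<bar> powr p \<partial>m))"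
    using assms[THEN integrable_powr] by simp
  finally show ?thesis using E_add_le[OF assms] unfolding energy1_eq by (simp add: algebra_simps)
qed

lemma energy1_minus_commute:
  assumes "f \<in> F" "g \<in> F"
  shows "energy1 p m E (\<lambda>x. f x - g x) = energy1 p m E (\<lambda>x. g x - f x)"
proof -
  have "E (\<lambda>x. (-1) * (f x - g x)) = E (\<lambda>x. f x - g x)" by (subst E_scale) (use F_diff assms in auto)
  then show ?thesis by (simp add: energy1_eq abs_minus_commute)
qed

lemma regular_energy1:
  assumes "f \<in> F" "0 < \<epsilon>" obtains g where "g \<in> core" "energy1 p m E (\<lambda>x. f x - g x) < \<epsilon>"
proof -
  let ?\<delta> = "(\<epsilon> / 2) powr (1 / p)"
  obtain g where g: "g \<in> core" "energy_norm p m E (\<lambda>x. f x - g x) < ?\<delta>"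
    using regular_F[OF assms(1), of ?\<delta>] assms(2) by (auto simp: core_def)
  let ?d = "\<lambda>x. f x - g x"
  have d: "?d \<in> F" using F_diff assms(1) core_F[OF g(1)] by blast
  have "E ?d powr (1 / p) < ?\<delta>" "Lp_norm p m ?d < ?\<delta>"
    using g(2) powr_ge_zero[of "E ?d" "1 / p"] unfolding energy_norm_def
    by (auto simp: Lp_norm_def intro: le_less_trans[rotated])
  then have "(E ?d powr (1 / p)) powr p < ?\<delta> powr p" "Lp_norm p m ?d powr p < ?\<delta> powr p"
    by (auto intro!: powr_less_mono2 simp: Lp_norm_def)
  then have "energy1 p m E ?d < \<epsilon>"
    using assms(2) d by (simp add: energy1_def powr_powr E_nonneg)
  then show ?thesis using that g(1) by blast
qed

text \<open>A minimum of functions vanishes wherever one of them does. With one function for each of finitely many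
  balls, it vanishes on all of the balls, at the price of adding up the energies.\<close>

lemma finite_min:
  assumes "finite Y" "Y \<noteq> {}" "B \<in> sets borel" "\<And>y. y \<in> Y \<Longrightarrow> w y \<in> core"
    "\<And>y z. y \<in> Y \<Longrightarrow> 0 \<le> w y z \<and> w y z \<le> 1" "\<And>y. y \<in> Y \<Longrightarrow> En (w y) B \<le> c"
  shows "\<exists>W\<in>core. (\<forall>z. 0 \<le> W z \<and> W z \<le> 1) \<and> En W B \<le> real (card Y) * c \<and>
    (\<forall>z. (\<exists>y\<in>Y. w y z = 0) \<longrightarrow> W z = 0) \<and> (\<forall>z. (\<forall>y\<in>Y. w y z = 1) \<longrightarrow> W z = (1::real))"
  using assms(1,2,4-)
proof (induction rule: finite_ne_induct)
  case (singleton y)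
  then show ?case by (intro bexI[of _ "w y"]) auto
next
  case (insert y Y)
  then obtain W where W: "W \<in> core" "\<And>z. 0 \<le> W z \<and> W z \<le> 1" "En W B \<le> real (card Y) * c"
    "\<And>z. (\<exists>y\<in>Y. w y z = 0) \<longrightarrow> W z = 0" "\<And>z. (\<forall>y\<in>Y. w y z = 1) \<longrightarrow> W z = 1" by auto
  have wy: "w y \<in> core" "\<And>z. 0 \<le> w y z \<and> w y z \<le> 1" "En (w y) B \<le> c" using insert.prems by auto
  have en: "En (\<lambda>z. min (w y z) (W z)) B \<le> real (card (insert y Y)) * c"
    using En_min[OF wy(1) W(1) assms(3)] wy(3) W(3) insert.hyps by (simp add: algebra_simps)
  have "min (w y z) (W z) = 0" if "\<exists>u\<in>insert y Y. w u z = 0" for z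
    using that W(2)[of z] W(4)[of z] wy(2)[of z] by (auto simp: min_def)
  moreover have "min (w y z) (W z) = 1" if "\<forall>u\<in>insert y Y. w u z = 1" for z
    using that W(5)[of z] by auto
  ultimately show ?case
    using W(2) wy(2) by (intro bexI[OF _ core_min[OF wy(1) W(1)]] conjI allI impI en) (auto simp: min_def)
qed

text \<open>The dual construction, for being \<open>1\<close> on the union of finitely many balls.\<close>

lemma finite_max:
  assumes "finite Y" "Y \<noteq> {}" "B \<in> sets borel" "\<And>y. y \<in> Y \<Longrightarrow> w y \<in> core"
    "\<And>y z. y \<in> Y \<Longrightarrow> 0 \<le> w y z \<and> w y z \<le> 1" "\<And>y. y \<in> Y \<Longrightarrow> En (w y) B \<le> c"
  shows "\<exists>W\<in>core. (\<forall>z. 0 \<le> W z \<and> W z \<le> 1) \<and> En W B \<le> real (card Y) * c \<and>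
    (\<forall>z. (\<exists>y\<in>Y. w y z = 1) \<longrightarrow> W z = 1) \<and> (\<forall>z. (\<forall>y\<in>Y. w y z = 0) \<longrightarrow> W z = (0::real))"
  using assms(1,2,4-)
proof (induction rule: finite_ne_induct)
  case (singleton y)
  then show ?case by (intro bexI[of _ "w y"]) auto
next
  case (insert y Y)
  then obtain W where W: "W \<in> core" "\<And>z. 0 \<le> W z \<and> W z \<le> 1" "En W B \<le> real (card Y) * c"
    "\<And>z. (\<exists>y\<in>Y. w y z = 1) \<longrightarrow> W z = 1" "\<And>z. (\<forall>y\<in>Y. w y z = 0) \<longrightarrow> W z = 0" by auto
  have wy: "w y \<in> core" "\<And>z. 0 \<le> w y z \<and> w y z \<le> 1" "En (w y) B \<le> c" using insert.prems by auto
  have en: "En (\<lambda>z. max (w y z) (W z)) B \<le> real (card (insert y Y)) * c"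
    using En_max[OF wy(1) W(1) assms(3)] wy(3) W(3) insert.hyps by (simp add: algebra_simps)
  have "max (w y z) (W z) = 1" if "\<exists>u\<in>insert y Y. w u z = 1" for z
    using that W(2)[of z] W(4)[of z] wy(2)[of z] by (auto simp: max_def)
  moreover have "max (w y z) (W z) = 0" if "\<forall>u\<in>insert y Y. w u z = 0" for z
    using that W(5)[of z] by auto
  ultimately show ?case
    using W(2) wy(2) by (intro bexI[OF _ core_max[OF wy(1) W(1)]] conjI allI impI en) (auto simp: max_def)
qed

lemma continuous_imp_quasi_continuous:
  assumes "continuous_on UNIV u" shows "quasi_continuous p m F E u"
proof -
  have "energy1 p m E (\<lambda>_. 0) = 0" by (simp add: energy1_def Lp_norm_def E_zero)
  then have "cap1_open p m F E {} \<le> 0"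
    unfolding cap1_open_def by (intro INF_lower2[of "\<lambda>_. 0"]) (auto simp: F_zero)
  then have "cap1 p m F E {} \<le> 0"
    unfolding cap1_def by (intro INF_lower2[of "{}"]) auto
  then show ?thesis
    unfolding quasi_continuous_def using assms by (auto intro!: exI[of _ "{}"])
qed

end

section \<open>Capacity and effective resistance\<close>

context p_energy_measure
begin

lemma eff_resistance_le:
  assumes "0 < K" "\<And>u. u \<in> F \<Longrightarrow> continuous_on UNIV u \<Longrightarrow> u x = 0 \<Longrightarrow> u y = 1 \<Longrightarrow> 1 \<le> K * E u"
  shows "eff_resistance F E {x} {y} \<le> ennreal K"
proof -
  have "ennreal (1 / K) \<le> (INF u\<in>{u\<in>F. continuous_on UNIV u \<and> (\<forall>x\<in>{x}. u x = 0) \<and> (\<forall>x\<in>{y}. u x = 1)}. ennreal (E u))"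
    by (intro INF_greatest ennreal_leI) (use assms in \<open>auto simp: field_simps\<close>)
  from inverse_ennreal_antimono[OF this] show ?thesis
    unfolding eff_resistance_def using assms(1) by (simp add: inverse_ennreal inverse_eq_divide)
qed

lemma eff_resistance_ge:
  assumes "0 < K" "u \<in> F" "continuous_on UNIV u" "u x = 0" "u y = 1" "K * E u \<le> 1"
  shows "ennreal K \<le> eff_resistance F E {x} {y}"
proof -
  have "(INF u\<in>{u\<in>F. continuous_on UNIV u \<and> (\<forall>x\<in>{x}. u x = 0) \<and> (\<forall>x\<in>{y}. u x = 1)}. ennreal (E u)) \<le> ennreal (1 / K)"
    by (rule INF_lower2[of u]) (use assms in \<open>auto simp: field_simps intro!: ennreal_leI\<close>)
  from inverse_ennreal_antimono[OF this] show ?thesis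
    unfolding eff_resistance_def using assms(1) by (simp add: inverse_ennreal inverse_eq_divide)
qed

lemma capacity_le:
  assumes "\<phi> \<in> F" "open U" "A\<^sub>1 \<subseteq> U" "ae_eq_on m U \<phi> 1" "open V" "A\<^sub>2 \<subseteq> V" "ae_eq_on m V \<phi> 0"
  shows "capacity m F E A\<^sub>1 A\<^sub>2 \<le> ennreal (E \<phi>)"
  unfolding capacity_def by (rule INF_lower) (use assms in auto)

text \<open>On a bounded space the constant \<open>1\<close> belongs to the domain and has no energy.\<close>

lemma capacity_bounded_space:
  assumes "bounded (UNIV :: 'a set)" "ball x r = (UNIV :: 'a set)"
  shows "capacity m F E B (UNIV - ball x r) = 0"
proof -
  have "capacity m F E B (UNIV - ball x r) \<le> ennreal (E (\<lambda>_. 1))"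
    by (rule capacity_le[of _ UNIV _ "{}"]) (use assms core_F[OF one_core] in \<open>auto simp: ae_eq_on_def\<close>)
  then show ?thesis by (simp add: E_one assms)
qed

lemma eff_resistance_leD:
  assumes le: "eff_resistance F E {x} {y} \<le> ennreal K" and "0 < K"
    and u: "u \<in> F" "continuous_on UNIV u" "u x = 0" "u y = 1"
  shows "1 \<le> K * E u"
proof -
  have "(INF u\<in>{u\<in>F. continuous_on UNIV u \<and> (\<forall>x\<in>{x}. u x = 0) \<and> (\<forall>x\<in>{y}. u x = 1)}. ennreal (E u)) \<le> ennreal (E u)"
    by (rule INF_lower) (use u in auto)
  then have inv: "inverse (ennreal (E u)) \<le> ennreal K"
    using le unfolding eff_resistance_def by (meson inverse_ennreal_antimono order_trans)
  then have "E u \<noteq> 0" by (auto simp: top_unique)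
  then have "0 < E u" using E_nonneg[OF u(1)] by simp
  then show ?thesis using inv \<open>0 < K\<close> by (simp add: inverse_ennreal field_simps)
qed

text \<open>The factor \<open>2\<close> absorbs the error of an almost optimal function; the infimum need not be attained.\<close>

lemma eff_resistance_geD:
  assumes "ennreal K \<le> eff_resistance F E {x} {y}" "0 < K"
  obtains u where "u \<in> F" "continuous_on UNIV u" "u x = 0" "u y = 1" "K * E u \<le> 2"
proof (rule ccontr)
  note obt = that
  assume "\<not> thesis"
  then have "2 < K * E u" if "u \<in> F" "continuous_on UNIV u" "u x = 0" "u y = 1" for u
    using obt[OF that] by force
  then have "eff_resistance F E {x} {y} \<le> ennreal (K / 2)"
    using assms(2) by (intro eff_resistance_le) (auto simp: less_imp_le)
  then have "ennreal K \<le> ennreal (K / 2)" using assms(1) by order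
  then show False using assms(2) by simp
qed

end

section \<open>Slow volume growth\<close>

text \<open>The hypotheses on the space with their constants made explicit. The diameter is a parameter because it
  depends on nothing but the type of points.\<close>

locale slow_volume = p_energy_measure m p F E \<Gamma>
  for m :: "'a::polish_space measure" and p F E \<Gamma> +
  fixes \<Phi> \<Psi> \<Theta> :: "real \<Rightarrow> real" and C\<^sub>\<Phi> C\<^sub>\<Psi> C\<^sub>V :: real and D :: ennreal
  assumes D: "D = ediam (UNIV :: 'a set)"
    and \<Phi>_pos: "0 < r \<Longrightarrow> 0 < \<Phi> r" and \<Phi>_mono: "0 < r \<Longrightarrow> r \<le> s \<Longrightarrow> \<Phi> r \<le> \<Phi> s"
    and \<Phi>_double: "0 < r \<Longrightarrow> \<Phi> (2 * r) \<le> C\<^sub>\<Phi> * \<Phi> r" and C\<Phi>: "1 \<le> C\<^sub>\<Phi>"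
    and \<Psi>_pos: "0 < r \<Longrightarrow> 0 < \<Psi> r" and \<Psi>_mono: "0 < r \<Longrightarrow> r \<le> s \<Longrightarrow> \<Psi> r \<le> \<Psi> s"
    and \<Psi>_double: "0 < r \<Longrightarrow> \<Psi> (2 * r) \<le> C\<^sub>\<Psi> * \<Psi> r" and C\<Psi>: "1 \<le> C\<^sub>\<Psi>"
    and CV: "0 < C\<^sub>V"
    and volume: "0 < r \<Longrightarrow> ennreal r < D \<Longrightarrow>
          \<Phi> r / C\<^sub>V \<le> measure m (ball x r) \<and> measure m (ball x r) \<le> C\<^sub>V * \<Phi> r"
    and \<Theta>_nonneg: "0 \<le> t \<Longrightarrow> t \<le> 1 \<Longrightarrow> 0 \<le> \<Theta> t"
    and \<Theta>_mono: "0 \<le> s \<Longrightarrow> s \<le> t \<Longrightarrow> t \<le> 1 \<Longrightarrow> \<Theta> s \<le> \<Theta> t"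
    and \<Theta>_small: "0 < \<epsilon> \<Longrightarrow> \<exists>\<delta>>0. \<delta> < 1 \<and> \<Theta> \<delta> < \<epsilon>"
    and \<Theta>_summable: "summable (\<lambda>n. \<Theta> (1 / 2 ^ n) powr (1 / p))"
    and slow: "0 < r \<Longrightarrow> r \<le> R \<Longrightarrow> ennreal R < D \<Longrightarrow>
          \<Psi> r / \<Phi> r \<le> \<Theta> (r / R) * (\<Psi> R / \<Phi> R)"
begin

text \<open>The resistance, up to constants, between two points at distance \<open>r\<close>.\<close>

definition res :: "real \<Rightarrow> real" where
  "res r = \<Psi> r / \<Phi> r"

lemma res_pos: "0 < r \<Longrightarrow> 0 < res r"
  by (simp add: \<Phi>_pos \<Psi>_pos res_def)

lemma slow_res: "0 < r \<Longrightarrow> r \<le> R \<Longrightarrow> ennreal R < D \<Longrightarrow> res r \<le> \<Theta> (r / R) * res R"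
  unfolding res_def by (rule slow)

lemma below_diam_mono: "r \<le> s \<Longrightarrow> ennreal s < D \<Longrightarrow> ennreal r < D"
  by (meson ennreal_leI order_le_less_trans)

lemma below_diam_dist: "0 < r \<Longrightarrow> r < dist x y \<Longrightarrow> ennreal r < D" for x y :: 'a
  unfolding D by (subst less_ediam_iff) auto

lemma \<Phi>_dilate:
  assumes "0 < K" obtains C where "1 \<le> C" "\<And>r. 0 < r \<Longrightarrow> \<Phi> (K * r) \<le> C * \<Phi> r"
  using assms doubling_dilate[of C\<^sub>\<Phi> \<Phi> K] C\<Phi> \<Phi>_pos \<Phi>_mono \<Phi>_double by metis

lemma \<Psi>_dilate:
  assumes "0 < K" obtains C where "1 \<le> C" "\<And>r. 0 < r \<Longrightarrow> \<Psi> (K * r) \<le> C * \<Psi> r"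
  using assms doubling_dilate[of C\<^sub>\<Psi> \<Psi> K] C\<Psi> \<Psi>_pos \<Psi>_mono \<Psi>_double by metis

text \<open>Above the diameter the volume no longer grows, while \<open>\<Phi>\<close> does.\<close>

lemma volume_upper:
  obtains C where "0 < C" "\<And>x r r'. 0 < r \<Longrightarrow> 0 < r' \<Longrightarrow> ennreal r' < D \<Longrightarrow> measure m (ball x r) \<le> C * \<Phi> r"
proof (cases "\<forall>r>0. ennreal r < D")
  case True
  then show ?thesis using that[of "C\<^sub>V"] CV volume by blast
next
  case False
  then obtain r\<^sub>0 where r0: "0 < r\<^sub>0" "\<not> ennreal r\<^sub>0 < D" by blast
  then have bd: "dist a b \<le> r\<^sub>0" for a b :: 'a by (meson below_diam_dist linorder_not_less)
  have fin: "UNIV \<in> fmeasurable m"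
    using emeasure_bounded[of UNIV] bd by (auto simp: fmeasurable_def bounded_def)
  show ?thesis
  proof (cases "\<exists>s>0. ennreal s < D")
    case True
    then obtain s where s: "0 < s" "ennreal s < D" by blast
    then obtain a b :: 'a where ab: "s < dist a b" using less_ediam_iff[of s] unfolding D by auto
    let ?D = "max C\<^sub>V (measure m UNIV / \<Phi> s)"
    show ?thesis
    proof (rule that[of ?D])
      show "0 < ?D" using CV by auto
      fix x :: 'a and r r' :: real assume r: "0 < r" 
      show "measure m (ball x r) \<le> ?D * \<Phi> r"
      proof (cases "ennreal r < D")
        case True
        then have "measure m (ball x r) \<le> C\<^sub>V * \<Phi> r" using volume r by blast
        also have "\<dots> \<le> ?D * \<Phi> r" using \<Phi>_pos[OF r] by (intro mult_right_mono) auto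
        finally show ?thesis .
      next
        case False
        have "s \<le> r" using s(2) False below_diam_mono[of r s] by linarith
        have "measure m (ball x r) \<le> measure m UNIV" by (rule measure_mono_fmeasurable) (use fin in auto)
        also have "\<dots> = measure m UNIV / \<Phi> s * \<Phi> s" using \<Phi>_pos[OF s(1)] by simp
        also have "\<dots> \<le> ?D * \<Phi> r"
          using \<Phi>_pos[OF s(1)] \<Phi>_mono[OF s(1) \<open>s \<le> r\<close>] CV by (intro mult_mono) (auto simp: max_def divide_nonneg_pos)
        finally show ?thesis .
      qed
    qed
  qed (use that[of 1] in auto)
qed

lemma volume_lower_dilate:
  assumes True: "0 < K"
  obtains C where "0 < C" "\<And>x r. 0 < r \<Longrightarrow> ennreal (K * r) < D \<Longrightarrow> \<Phi> r \<le> C * measure m (ball x (K * r))"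
proof -
  obtain C where C: "1 \<le> C" "\<And>r. 0 < r \<Longrightarrow> \<Phi> (inverse K * r) \<le> C * \<Phi> r" using \<Phi>_dilate[of "inverse K"] True by auto
  show ?thesis
  proof (rule that[of "C * C\<^sub>V"])
    fix x :: 'a and r assume r: "0 < r" "ennreal (K * r) < D"
    have "\<Phi> r \<le> C * \<Phi> (K * r)" using C(2)[of "K * r"] r True by (simp flip: mult.assoc)
    also have "\<dots> \<le> C * (C\<^sub>V * measure m (ball x (K * r)))"
      using volume[of "K * r" x] r True C(1) CV by (intro mult_left_mono) (auto simp: field_simps)
    finally show "\<Phi> r \<le> C * C\<^sub>V * measure m (ball x (K * r))" by (simp add: mult.assoc)
  qed (use C CV in auto)
qed

lemma not_below_diamD:
  fixes x y :: 'a
  assumes "0 < r" "\<not> ennreal r < D" shows "dist x y \<le> r"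
  using assms below_diam_dist by (meson linorder_not_less)

lemma not_below_diam_bounded:
  assumes "0 < r" "\<not> ennreal r < D" shows "bounded (UNIV :: 'a set)"
  using not_below_diamD[OF assms] by (auto simp: bounded_def)

lemma trivial_space: "\<not> (\<exists>s>0. ennreal s < D) \<Longrightarrow> x = y" for x y :: 'a
  using below_diam_dist[of "dist x y / 2" x y] by (metis half_gt_zero field_less_half_sum dist_pos_lt field_sum_of_halves less_add_same_cancel1)

lemma res_dilate:
  assumes "0 < K"
  obtains C where "1 \<le> C" "\<And>r s. 0 < r \<Longrightarrow> r \<le> s \<Longrightarrow> s \<le> K * r \<Longrightarrow> res r \<le> C * res s"
    "\<And>r s. 0 < r \<Longrightarrow> r \<le> s \<Longrightarrow> s \<le> K * r \<Longrightarrow> res s \<le> C * res r"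
proof -
  obtain C1 C2 where C: "1 \<le> C1" "\<And>r. 0 < r \<Longrightarrow> \<Phi> (K * r) \<le> C1 * \<Phi> r" "1 \<le> C2" "\<And>r. 0 < r \<Longrightarrow> \<Psi> (K * r) \<le> C2 * \<Psi> r"
    using \<Phi>_dilate[OF assms] \<Psi>_dilate[OF assms] by metis
  show ?thesis
  proof (rule that[of "max C1 C2"])
    fix r s assume rs: "0 < r" "r \<le> s" "s \<le> K * r"
    have pos: "0 < \<Phi> r" "0 < \<Phi> s" "0 < \<Psi> r" "0 < \<Psi> s" using rs \<Phi>_pos \<Psi>_pos by auto
    have "\<Phi> s \<le> C1 * \<Phi> r" using C(2)[OF rs(1)] \<Phi>_mono[of s "K * r"] rs by simp
    also have "\<dots> \<le> max C1 C2 * \<Phi> r" using pos by (intro mult_right_mono) auto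
    finally have "\<Phi> s \<le> max C1 C2 * \<Phi> r" .
    then have "\<Psi> r * \<Phi> s \<le> \<Psi> s * (max C1 C2 * \<Phi> r)"
      using \<Psi>_mono[OF rs(1,2)] pos by (intro mult_mono) auto
    then show "res r \<le> max C1 C2 * res s" using pos by (simp add: res_def field_simps)
    have "\<Psi> s \<le> C2 * \<Psi> r" using C(4)[OF rs(1)] \<Psi>_mono[of s "K * r"] rs by simp
    also have "\<dots> \<le> max C1 C2 * \<Psi> r" using pos by (intro mult_right_mono) auto
    finally have "\<Psi> s \<le> max C1 C2 * \<Psi> r" .
    then have "\<Psi> s * \<Phi> r \<le> (max C1 C2 * \<Psi> r) * \<Phi> s"
      using \<Phi>_mono[OF rs(1,2)] pos by (intro mult_mono) auto
    then show "res s \<le> max C1 C2 * res r" using pos by (simp add: res_def field_simps)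
  qed (use C in auto)
qed

lemma capacity_above_diam:
  assumes "0 < r" "\<not> ennreal r < D" "1 < A"
  shows "capacity m F E B (UNIV - ball x (A * r)) = 0"
proof (rule capacity_bounded_space)
  show "bounded (UNIV :: 'a set)" by (rule not_below_diam_bounded[OF assms(1,2)])
  have "r < A * r" using assms by simp
  then show "ball x (A * r) = UNIV" using le_less_trans[OF not_below_diamD[OF assms(1,2)]] by auto
qed

text \<open>Balls of radius \<open>\<delta>r/2\<close> around \<open>\<delta>r\<close>-separated points are disjoint and each carries a fixed
  proportion of the volume of a ball of radius \<open>6r\<close>; so a separated set of largest size is bounded, and
  it covers.\<close>

lemma bounded_cover:
  assumes "0 < \<delta>" "\<delta> < 1"
  obtains N :: nat where "\<And>(x::'a) r T. 0 < r \<Longrightarrow> ennreal r < D \<Longrightarrow> T \<subseteq> ball x (5 * r) \<Longrightarrow>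
    \<exists>Y\<subseteq>T. finite Y \<and> card Y \<le> N \<and> (\<forall>t\<in>T. \<exists>y\<in>Y. dist y t < \<delta> * r)"
proof -
  obtain C\<^sub>U where CU: "0 < C\<^sub>U" "\<And>x r r'. 0 < r \<Longrightarrow> 0 < r' \<Longrightarrow> ennreal r' < D \<Longrightarrow> measure m (ball x r) \<le> C\<^sub>U * \<Phi> r"
    by (rule volume_upper) blast
  obtain C\<^sub>L where CL: "0 < C\<^sub>L" "\<And>x r. 0 < r \<Longrightarrow> ennreal (\<delta> / 2 * r) < D \<Longrightarrow> \<Phi> r \<le> C\<^sub>L * measure m (ball x (\<delta> / 2 * r))"
    by (rule volume_lower_dilate[of "\<delta> / 2"]) (use assms in auto)
  obtain C\<^sub>6 where C6: "1 \<le> C\<^sub>6" "\<And>r. 0 < r \<Longrightarrow> \<Phi> (6 * r) \<le> C\<^sub>6 * \<Phi> r"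
    by (rule \<Phi>_dilate[of 6]) auto
  define N where "N = nat \<lceil>C\<^sub>L * (C\<^sub>U * C\<^sub>6)\<rceil>"
  have N: "C\<^sub>L * (C\<^sub>U * C\<^sub>6) \<le> real N" unfolding N_def by (rule real_nat_ceiling_ge)
  show ?thesis
  proof (rule that[of N])
    fix x :: 'a and r T assume r: "0 < r" "ennreal r < D" and T: "T \<subseteq> ball x (5 * r)"
    define sep where "sep Y \<longleftrightarrow> Y \<subseteq> T \<and> finite Y \<and> (\<forall>y\<in>Y. \<forall>z\<in>Y. y \<noteq> z \<longrightarrow> \<delta> * r \<le> dist y z)" for Y
    have card_le: "card Y \<le> N" if "sep Y" for Y
    proof -
      let ?b = "\<lambda>y. ball y (\<delta> / 2 * r)"
      have "ennreal (\<delta> / 2 * r) < D" by (rule below_diam_mono[OF _ r(2)]) (use assms r in simp)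
      then have "real (card Y) * \<Phi> r \<le> (\<Sum>y\<in>Y. C\<^sub>L * measure m (?b y))"
        using CL(2)[OF r(1)] by (intro sum_bounded_below) auto
      also have "\<dots> = C\<^sub>L * (\<Sum>y\<in>Y. measure m (?b y))" by (simp add: sum_distrib_left)
      also have "(\<Sum>y\<in>Y. measure m (?b y)) = measure m (\<Union>y\<in>Y. ?b y)"
      proof (rule measure_finite_Union[symmetric])
        show "disjoint_family_on ?b Y"
        proof (unfold disjoint_family_on_def, intro ballI impI)
          fix y z assume yz: "y \<in> Y" "z \<in> Y" "y \<noteq> z"
          then have "\<delta> * r \<le> dist y z" using that by (auto simp: sep_def)
          then have "\<not> (dist y t < \<delta> / 2 * r \<and> dist z t < \<delta> / 2 * r)" for t using dist_triangle2[of y z t] by linarith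
          then show "?b y \<inter> ?b z = {}" by auto
        qed
      qed (use that emeasure_bounded[OF bounded_ball] in \<open>auto simp: sep_def less_top\<close>)
      also have "\<dots> \<le> measure m (ball x (6 * r))"
      proof (rule measure_mono_fmeasurable)
        have "?b y \<subseteq> ball x (6 * r)" if "y \<in> Y" for y
        proof
          fix z assume "z \<in> ?b y"
          then have "dist y z < \<delta> / 2 * r" by simp
          moreover have "\<delta> / 2 * r \<le> r" using assms r by (intro mult_left_le_one_le) auto
          moreover have "dist x y < 5 * r" using that \<open>sep Y\<close> T by (auto simp: sep_def)
          ultimately show "z \<in> ball x (6 * r)" using dist_triangle[of x z y] by simp
        qed
        then show "(\<Union>y\<in>Y. ?b y) \<subseteq> ball x (6 * r)" by blast
        show "(\<Union>y\<in>Y. ?b y) \<in> sets m" unfolding sets_m by (intro borel_open open_UN ballI open_ball)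
      qed auto
      also have "\<dots> \<le> C\<^sub>U * (C\<^sub>6 * \<Phi> r)"
        using CU(2)[of "6 * r" r x] C6(2)[OF r(1)] CU(1) r by (smt (verit) mult_left_mono)
      finally have "real (card Y) * \<Phi> r \<le> (C\<^sub>L * (C\<^sub>U * C\<^sub>6)) * \<Phi> r" using CL(1) by (simp add: mult.assoc)
      then have "real (card Y) \<le> C\<^sub>L * (C\<^sub>U * C\<^sub>6)" using \<Phi>_pos[OF r(1)] by simp
      then show ?thesis using N by linarith
    qed
    have "sep {}" by (simp add: sep_def)
    then have "\<exists>Y. sep Y \<and> (\<forall>Z. sep Z \<longrightarrow> card Z \<le> card Y)"
      by (rule ex_has_greatest_nat[of sep "{}" card "Suc N"]) (auto intro: le_imp_less_Suc card_le)
    then obtain Y where Y: "sep Y" "\<And>Z. sep Z \<Longrightarrow> card Z \<le> card Y" by blast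
    have "\<exists>y\<in>Y. dist y t < \<delta> * r" if "t \<in> T" for t
    proof (rule ccontr)
      assume far: "\<not> (\<exists>y\<in>Y. dist y t < \<delta> * r)"
      have t: "t \<notin> Y" using far assms r by force
      have "sep (insert t Y)" using Y(1) far that by (auto simp: sep_def not_less dist_commute)
      then have "card (insert t Y) \<le> card Y" by (rule Y(2))
      then show False using t Y(1) by (simp add: sep_def)
    qed
    then show "\<exists>Y\<subseteq>T. finite Y \<and> card Y \<le> N \<and> (\<forall>t\<in>T. \<exists>y\<in>Y. dist y t < \<delta> * r)"
      using Y(1) card_le[OF Y(1)] by (auto simp: sep_def)
  qed
qed

end

section \<open>Continuity from the Poincare inequality\<close>

locale slow_volume_Poincare = slow_volume m p F E \<Gamma> \<Phi> \<Psi> \<Theta> C\<^sub>\<Phi> C\<^sub>\<Psi> C\<^sub>V D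
  for m :: "'a::polish_space measure" and p F E \<Gamma> \<Phi> \<Psi> \<Theta> C\<^sub>\<Phi> C\<^sub>\<Psi> C\<^sub>V D +
  fixes C\<^sub>P A :: real
  assumes CP: "0 < C\<^sub>P" and A: "1 \<le> A"
    and PI: "0 < r \<Longrightarrow> ennreal (A * r) < D \<Longrightarrow> f \<in> F \<Longrightarrow>
          (\<integral>\<^sup>+y\<in>ball x r. ennreal (\<bar>f y - mean_value m (ball x r) f\<bar> powr p) \<partial>m)
             \<le> ennreal (C\<^sub>P * \<Psi> r) * emeasure (\<Gamma> f) (ball x (A * r))"
begin

lemma below_A: "0 < r \<Longrightarrow> ennreal (A * r) < D \<Longrightarrow> ennreal r < D"
  by (erule below_diam_mono[rotated]) (use A mult_right_mono[of 1 A r] in simp)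

lemma Poincare_real:
  assumes "0 < r" "ennreal (A * r) < D" "f \<in> F"
  shows "(LINT y:ball x r|m. \<bar>f y - mean (ball x r) f\<bar> powr p) \<le> C\<^sub>P * \<Psi> r * En f (ball x (A * r))"
proof -
  have nn: "0 \<le> C\<^sub>P * \<Psi> r" using CP \<Psi>_pos[OF assms(1)] by simp
  have "ennreal (LINT y:ball x r|m. \<bar>f y - mean (ball x r) f\<bar> powr p) \<le> ennreal (C\<^sub>P * \<Psi> r * En f (ball x (A * r)))"
    using PI[OF assms, of x] nn
    unfolding nn_integral_powr_diff[OF assms(3)] emeasure_\<Gamma>[OF assms(3)] by (simp add: ennreal_mult)
  then show ?thesis using nn by (simp add: ennreal_le_iff)
qed

text \<open>The constant in the comparison of the averages over a ball and over a smaller ball of comparable radius.\<close>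

definition C\<^sub>M :: real where
  "C\<^sub>M = 2 powr p * (C\<^sub>P * (C\<^sub>\<Phi> * C\<^sub>V))"

lemma CM_pos: "0 < C\<^sub>M"
  using CP C\<Phi> CV by (simp add: C\<^sub>M_def)

text \<open>The Poincare inequality on the larger ball, restricted to the smaller one; by doubling the smaller ball
  carries a fixed proportion of the volume.\<close>

lemma mean_step:
  assumes r: "0 < r" "ennreal (A * r) < D" and f: "f \<in> F" and s: "r \<le> 2 * s" and sub: "ball y s \<subseteq> ball x r" "s \<le> r"
  shows "\<bar>mean (ball y s) f - mean (ball x r) f\<bar> powr p \<le> C\<^sub>M * res r * En f (ball x (A * r))"
proof -
  let ?c = "mean (ball x r) f" and ?V = "measure m (ball y s)" and ?G = "En f (ball x (A * r))"
  have s0: "0 < s" using r s by simp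
  have V: "0 < ?V" by (rule measure_ball_pos[OF s0])
  have "\<Phi> r \<le> \<Phi> (2 * s)" by (rule \<Phi>_mono[OF r(1) s])
  also have "\<dots> \<le> C\<^sub>\<Phi> * \<Phi> s" by (rule \<Phi>_double[OF s0])
  also have "\<dots> \<le> C\<^sub>\<Phi> * (C\<^sub>V * ?V)"
    using volume[OF s0 below_diam_mono[OF sub(2) below_A[OF r]], of y] C\<Phi> CV
    by (intro mult_left_mono) (auto simp: field_simps)
  finally have lower: "\<Phi> r \<le> C\<^sub>\<Phi> * C\<^sub>V * ?V" by simp
  have "(LINT z:ball y s|m. \<bar>f z - ?c\<bar> powr p) \<le> (LINT z:ball x r|m. \<bar>f z - ?c\<bar> powr p)"
    unfolding set_lebesgue_integral_def
    by (rule integral_mono)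
      (use sub set_integrable_powr_diff[OF f] in \<open>auto simp: set_integrable_def indicator_def\<close>)
  also have "\<dots> \<le> C\<^sub>P * \<Psi> r * ?G" by (rule Poincare_real[OF r f])
  also have "\<dots> = C\<^sub>P * res r * ?G * \<Phi> r" using \<Phi>_pos[OF r(1)] by (simp add: res_def)
  also have "\<dots> \<le> C\<^sub>P * res r * ?G * (C\<^sub>\<Phi> * C\<^sub>V * ?V)"
    using lower CP res_pos[OF r(1)] by (intro mult_left_mono) auto
  finally have "(LINT z:ball y s|m. \<bar>f z - ?c\<bar> powr p) \<le> (C\<^sub>P * (C\<^sub>\<Phi> * C\<^sub>V) * res r * ?G) * ?V"
    by (simp only: mult_ac)
  from mean_powr_le[OF f s0 this] show ?thesis by (simp add: C\<^sub>M_def mult.assoc)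
qed

lemma mean_step_root:
  assumes "0 < r" "ennreal (A * r) < D" "f \<in> F" "r \<le> 2 * s" "ball y s \<subseteq> ball x r" "s \<le> r"
  shows "\<bar>mean (ball y s) f - mean (ball x r) f\<bar> \<le> (C\<^sub>M * res r * En f (ball x (A * r))) powr (1 / p)"
  using mean_step[OF assms] CM_pos res_pos[OF assms(1)] by (subst powr_inverse_le_iff) auto

definition S\<^sub>\<Theta> :: real where
  "S\<^sub>\<Theta> = (\<Sum>n. \<Theta> (1 / 2 ^ n) powr (1 / p))"

lemma S_nonneg: "0 \<le> S\<^sub>\<Theta>"
  unfolding S\<^sub>\<Theta>_def using \<Theta>_summable by (intro suminf_nonneg) auto

text \<open>The \<open>n\<close>-th step compares the radii \<open>r / 2\<^bsup>n\<^esup>\<close> and \<open>r / 2\<^bsup>n+1\<^esup>\<close>, and slow volume growth bounds it by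
  \<open>\<Theta> (2\<^bsup>-n\<^esup>)\<^bsup>1/p\<^esup>\<close> times a quantity at scale \<open>r\<close>. The bounds form a convergent series.\<close>

lemma mean_telescope:
  assumes r: "0 < r" "ennreal (A * r) < D" and f: "f \<in> F"
  shows "\<bar>mean (ball x (r / 2 ^ n)) f - mean (ball x r) f\<bar>
         \<le> S\<^sub>\<Theta> * (C\<^sub>M * res r * En f (ball x (A * r))) powr (1 / p)"
proof -
  let ?a = "\<lambda>k. mean (ball x (r / 2 ^ k)) f" and ?Q = "C\<^sub>M * res r * En f (ball x (A * r))"
  have step: "\<bar>?a (Suc k) - ?a k\<bar> \<le> \<Theta> (1 / 2 ^ k) powr (1 / p) * ?Q powr (1 / p)" for k
  proof -
    let ?s = "r / 2 ^ k"
    have s: "0 < ?s" "?s \<le> r" using r(1) by (simp_all add: divide_le_eq mult_left_le_one_le)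
    have half: "r / (2 * 2 ^ k) \<le> ?s" using r(1) by (intro divide_left_mono) auto
    have As: "A * ?s \<le> A * r" using s(2) A by (intro mult_left_mono) auto
    have "\<bar>?a (Suc k) - ?a k\<bar> \<le> (C\<^sub>M * res ?s * En f (ball x (A * ?s))) powr (1 / p)"
      by (rule mean_step_root) (use s half f As r below_diam_mono[OF As r(2)] in \<open>auto intro!: subset_ball\<close>)
    also have "\<dots> \<le> (C\<^sub>M * (\<Theta> (?s / r) * res r) * En f (ball x (A * r))) powr (1 / p)"
      using CM_pos slow_res[OF s below_A[OF r]] res_pos[OF s(1)] As f
      by (intro powr_mono2 mult_mono) (auto intro!: En_mono subset_ball mult_nonneg_nonneg simp del: times_divide_eq_right times_divide_eq_left)
    also have "C\<^sub>M * (\<Theta> (?s / r) * res r) * En f (ball x (A * r)) = \<Theta> (1 / 2 ^ k) * ?Q"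
      using r(1) by simp
    finally show ?thesis using CM_pos res_pos[OF r(1)] by (simp add: powr_mult \<Theta>_nonneg)
  qed
  have "?a n - ?a 0 = (\<Sum>k<n. ?a (Suc k) - ?a k)" by (rule sum_lessThan_telescope[symmetric])
  then have "\<bar>?a n - ?a 0\<bar> \<le> (\<Sum>k<n. \<bar>?a (Suc k) - ?a k\<bar>)" by (simp add: sum_abs)
  also have "\<dots> \<le> (\<Sum>k<n. \<Theta> (1 / 2 ^ k) powr (1 / p) * ?Q powr (1 / p))" by (intro sum_mono step)
  also have "\<dots> = (\<Sum>k<n. \<Theta> (1 / 2 ^ k) powr (1 / p)) * ?Q powr (1 / p)" by (simp add: sum_distrib_right)
  also have "\<dots> \<le> S\<^sub>\<Theta> * ?Q powr (1 / p)"
    unfolding S\<^sub>\<Theta>_def using \<Theta>_summable by (intro mult_right_mono sum_le_suminf) auto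
  finally show ?thesis by simp
qed

lemma point_mean:
  assumes r: "0 < r" "ennreal (A * r) < D" and f: "f \<in> F" "continuous_on UNIV f"
  shows "\<bar>f x - mean (ball x r) f\<bar> \<le> S\<^sub>\<Theta> * (C\<^sub>M * res r * En f (ball x (A * r))) powr (1 / p)"
proof (rule LIMSEQ_le_const2)
  show "(\<lambda>n. \<bar>mean (ball x (r / 2 ^ n)) f - mean (ball x r) f\<bar>) \<longlonglongrightarrow> \<bar>f x - mean (ball x r) f\<bar>"
    by (intro tendsto_intros mean_tendsto_of_continuous f r)
qed (use mean_telescope[OF r f(1)] in blast)

text \<open>The same bound for the values of \<open>f\<close> on an open set, where only a lower bound almost everywhere is
  known.\<close>

lemma lower_bound_mean:
  assumes r: "0 < r" "ennreal (A * r) < D" and f: "f \<in> F"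
    and G: "open G" "x \<in> G" "AE y in m. y \<in> G \<longrightarrow> c \<le> f y"
  shows "c \<le> mean (ball x r) f + S\<^sub>\<Theta> * (C\<^sub>M * res r * En f (ball x (A * r))) powr (1 / p)"
proof -
  obtain e where e: "0 < e" "ball x e \<subseteq> G" using G(1,2) by (meson open_contains_ball)
  have "(\<lambda>n. r / 2 ^ n) \<longlonglongrightarrow> 0" by real_asymp
  then have "eventually (\<lambda>n. r / 2 ^ n < e) sequentially" using e(1) by (rule order_tendstoD)
  then obtain n where n: "r / 2 ^ n < e" by (auto simp: eventually_sequentially)
  have "c \<le> mean (ball x (r / 2 ^ n)) f"
  proof (rule mean_ge[OF f])
    have "ball x (r / 2 ^ n) \<subseteq> G" using e(2) n subset_ball[of "r / 2 ^ n" e x] by force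
    then show "AE y in m. y \<in> ball x (r / 2 ^ n) \<longrightarrow> c \<le> f y" using G(3) by (auto elim!: eventually_mono)
  qed (use r(1) in simp)
  then show ?thesis using mean_telescope[OF r f, of x n] by linarith
qed

lemma mean_plus_powr_le:
  assumes r: "0 < r" "ennreal (A * r) < D" and f: "f \<in> F"
    and le: "0 \<le> t" "t \<le> \<bar>mean (ball x r) f\<bar> + S\<^sub>\<Theta> * (C\<^sub>M * res r * En f (ball x (A * r))) powr (1 / p)"
  shows "t powr p \<le> 2 powr p * (2 powr p * C\<^sub>V * ((LINT y:ball x r|m. \<bar>f y\<bar> powr p) / \<Phi> r)
           + S\<^sub>\<Theta> powr p * C\<^sub>M * (res r * En f (ball x (A * r))))"
proof -
  let ?Q = "C\<^sub>M * res r * En f (ball x (A * r))" and ?L = "LINT y:ball x r|m. \<bar>f y\<bar> powr p"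
  have Q: "0 \<le> ?Q" using CM_pos res_pos[OF r(1)] by simp
  have L: "0 \<le> ?L" using LINT_powr_diff_nonneg[of x r f 0] by simp
  have "t powr p \<le> (\<bar>mean (ball x r) f\<bar> + S\<^sub>\<Theta> * ?Q powr (1 / p)) powr p"
    using le by (intro powr_mono2) auto
  also have "\<dots> \<le> 2 powr p * (\<bar>mean (ball x r) f\<bar> powr p + (S\<^sub>\<Theta> * ?Q powr (1 / p)) powr p)"
    using S_nonneg by (intro powr_add_le) auto
  also have "(S\<^sub>\<Theta> * ?Q powr (1 / p)) powr p = S\<^sub>\<Theta> powr p * ?Q"
    using S_nonneg Q by (simp add: powr_mult[of S\<^sub>\<Theta> "?Q powr (1 / p)"] powr_powr)
  also have "\<bar>mean (ball x r) f\<bar> powr p \<le> 2 powr p * C\<^sub>V * (?L / \<Phi> r)"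
  proof -
    have "?L / measure m (ball x r) \<le> ?L / (\<Phi> r / C\<^sub>V)"
      using volume[OF r(1) below_A[OF r], of x] L \<Phi>_pos[OF r(1)] CV
      by (intro divide_left_mono) (auto simp: measure_ball_pos[OF r(1)])
    then show ?thesis using mean_abs_powr_le[OF f r(1), of x]
      by (smt (verit, best) divide_divide_eq_right mult.commute mult.left_commute mult_left_mono powr_ge_zero times_divide_eq_right)
  qed
  finally show ?thesis by (simp add: mult.assoc)
qed

lemma point_powr_le:
  assumes r: "0 < r" "ennreal (A * r) < D" and f: "f \<in> F" "continuous_on UNIV f"
  shows "\<bar>f x\<bar> powr p \<le> 2 powr p * (2 powr p * C\<^sub>V * ((LINT y:ball x r|m. \<bar>f y\<bar> powr p) / \<Phi> r)
           + S\<^sub>\<Theta> powr p * C\<^sub>M * (res r * En f (ball x (A * r))))"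
  by (rule mean_plus_powr_le[OF r f(1)]) (use point_mean[OF r f, of x] in linarith)+

text \<open>Points have positive capacity, uniformly.\<close>

lemma energy1_lower:
  assumes "0 < s" "ennreal s < D"
  obtains K where "0 < K"
    "\<And>f G x c. f \<in> F \<Longrightarrow> open G \<Longrightarrow> x \<in> G \<Longrightarrow> AE y in m. y \<in> G \<longrightarrow> c \<le> f y \<Longrightarrow> 0 \<le> c \<Longrightarrow>
       c powr p \<le> K * energy1 p m E f"
    "\<And>f x. f \<in> F \<Longrightarrow> continuous_on UNIV f \<Longrightarrow> \<bar>f x\<bar> powr p \<le> K * energy1 p m E f"
proof -
  define r where "r = s / A"
  have r: "0 < r" "ennreal (A * r) < D" using assms A by (auto simp: r_def)
  define K where "K = 2 powr p * (2 powr p * C\<^sub>V / \<Phi> r + S\<^sub>\<Theta> powr p * C\<^sub>M * res r)"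
  have pos: "0 < 2 powr p * C\<^sub>V / \<Phi> r" "0 \<le> S\<^sub>\<Theta> powr p * C\<^sub>M * res r"
    using CV \<Phi>_pos[OF r(1)] CM_pos res_pos[OF r(1)] by (auto simp: less_imp_le)
  have bound: "2 powr p * (2 powr p * C\<^sub>V * ((LINT y:ball x r|m. \<bar>f y\<bar> powr p) / \<Phi> r)
           + S\<^sub>\<Theta> powr p * C\<^sub>M * (res r * En f (ball x (A * r)))) \<le> K * energy1 p m E f" if f: "f \<in> F" for f x
  proof -
    let ?I = "\<integral>y. \<bar>f y\<bar> powr p \<partial>m"
    have I: "0 \<le> ?I" by (rule integral_nonneg_AE) auto
    have "2 powr p * C\<^sub>V / \<Phi> r * (LINT y:ball x r|m. \<bar>f y\<bar> powr p) \<le> 2 powr p * C\<^sub>V / \<Phi> r * ?I"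
      by (intro mult_left_mono LINT_powr_le_total f) (use pos in auto)
    also have "\<dots> \<le> 2 powr p * C\<^sub>V / \<Phi> r * energy1 p m E f"
      using E_nonneg[OF f] pos by (intro mult_left_mono) (auto simp: energy1_eq)
    finally have 1: "2 powr p * C\<^sub>V / \<Phi> r * (LINT y:ball x r|m. \<bar>f y\<bar> powr p) \<le> 2 powr p * C\<^sub>V / \<Phi> r * energy1 p m E f" .
    have "S\<^sub>\<Theta> powr p * C\<^sub>M * res r * En f (ball x (A * r)) \<le> S\<^sub>\<Theta> powr p * C\<^sub>M * res r * energy1 p m E f"
      unfolding energy1_eq by (intro mult_left_mono add_increasing2 En_le_E I f pos)
    with 1 have "2 powr p * C\<^sub>V / \<Phi> r * (LINT y:ball x r|m. \<bar>f y\<bar> powr p) + S\<^sub>\<Theta> powr p * C\<^sub>M * res r * En f (ball x (A * r))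
        \<le> (2 powr p * C\<^sub>V / \<Phi> r + S\<^sub>\<Theta> powr p * C\<^sub>M * res r) * energy1 p m E f" by (simp add: ring_distribs)
    from mult_left_mono[OF this, of "2 powr p"] show ?thesis by (simp add: K_def mult.assoc)
  qed
  show ?thesis
  proof (rule that[of K])
    show "0 < K" using pos by (simp add: K_def add_pos_nonneg)
    fix f :: "'a \<Rightarrow> real" and G x and c :: real
    assume f: "f \<in> F"
    { assume G: "open G" "x \<in> G" "AE y in m. y \<in> G \<longrightarrow> c \<le> f y" and "0 \<le> c"
      have "c \<le> \<bar>mean (ball x r) f\<bar> + S\<^sub>\<Theta> * (C\<^sub>M * res r * En f (ball x (A * r))) powr (1 / p)"
        using lower_bound_mean[OF r f G] by linarith
      then show "c powr p \<le> K * energy1 p m E f"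
        using mean_plus_powr_le[OF r f \<open>0 \<le> c\<close>] bound[OF f, of x] by (meson order_trans) }
    { assume "continuous_on UNIV f"
      then show "\<bar>f x\<bar> powr p \<le> K * energy1 p m E f"
        using point_powr_le[OF r f, of x] bound[OF f, of x] by (meson order_trans) }
  qed
qed

text \<open>A nonempty open set has capacity bounded away from zero, so the exceptional open sets in the
  definition of quasi-continuity are empty.\<close>

lemma quasi_continuous_imp_continuous:
  assumes "quasi_continuous p m F E u" shows "continuous_on UNIV u"
proof (cases "\<exists>s>0. ennreal s < D")
  case True
  then obtain s where "0 < s" "ennreal s < D" by blast
  then obtain K where K: "0 < K"
    "\<And>f G x c. f \<in> F \<Longrightarrow> open G \<Longrightarrow> x \<in> G \<Longrightarrow> AE y in m. y \<in> G \<longrightarrow> c \<le> f y \<Longrightarrow> 0 \<le> c \<Longrightarrow>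
       c powr p \<le> K * energy1 p m E f" by (rule energy1_lower) auto
  obtain G where G: "open G" "cap1 p m F E G < ennreal (1 / K)" "continuous_on (- G) u"
    using assms K(1) unfolding quasi_continuous_def by (meson divide_pos_pos zero_less_one)
  have "G = {}"
  proof (rule ccontr)
    assume "G \<noteq> {}"
    then obtain x where x: "x \<in> G" by blast
    have "ennreal (1 / K) \<le> cap1 p m F E G"
      unfolding cap1_def cap1_open_def
    proof (intro INF_greatest)
      fix U \<phi> assume U: "U \<in> {U. open U \<and> G \<subseteq> U}" and \<phi>: "\<phi> \<in> {\<phi> \<in> F. AE x in m. x \<in> U \<longrightarrow> 1 \<le> \<phi> x}"
      have "1 powr p \<le> K * energy1 p m E \<phi>" by (rule K(2)[of \<phi> U x]) (use U \<phi> x in auto)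
      then show "ennreal (1 / K) \<le> ennreal (energy1 p m E \<phi>)"
        using K(1) by (intro ennreal_leI) (simp add: field_simps)
    qed
    then show False using G(2) by simp
  qed
  then show ?thesis using G(3) by simp
next
  case False
  then have "u = (\<lambda>_. u undefined)" using trivial_space by (metis (full_types))
  then show ?thesis by (metis continuous_on_const)
qed

text \<open>Core functions that approximate \<open>f\<close> in energy form a uniform Cauchy sequence by \<open>energy1_lower\<close>, and their
  uniform limit agrees almost everywhere with their \<open>L\<^sup>p\<close> limit.\<close>

lemma continuous_version:
  assumes f: "f \<in> F"
  obtains u where "u \<in> F" "continuous_on UNIV u" "AE x in m. u x = f x"
proof (cases "\<exists>s>0. ennreal s < D")
  case False
  then have "f = (\<lambda>_. f undefined)" using trivial_space by (metis (full_types))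
  then have "continuous_on UNIV f" by (metis continuous_on_const)
  then show ?thesis using that[of f] f by auto
next
  case True
  then obtain s where "0 < s" "ennreal s < D" by blast
  then obtain K where K: "0 < K"
    "\<And>f x. f \<in> F \<Longrightarrow> continuous_on UNIV f \<Longrightarrow> \<bar>f x\<bar> powr p \<le> K * energy1 p m E f"
    by (rule energy1_lower) auto
  have "\<exists>g. g \<in> core \<and> energy1 p m E (\<lambda>x. f x - g x) < 1 / (Suc n)" for n
    by (rule regular_energy1[OF f, of "1 / Suc n"]) auto
  then obtain g where g: "\<And>n. g n \<in> core" "\<And>n. energy1 p m E (\<lambda>x. f x - g n x) < 1 / (Suc n)" by metis
  have [measurable]: "f \<in> borel_measurable m" "g n \<in> borel_measurable m" for n
    using borel_measurable_F[OF f] borel_measurable_F[OF core_F[OF g(1)]] by (simp_all add: measurable_cong_sets[OF sets_m refl])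
  have cauchy: "uniformly_Cauchy_on UNIV g"
  proof (rule uniformly_Cauchy_onI')
    fix e :: real assume e: "0 < e"
    define M where "M = K * (2 powr p * 2)"
    have M: "0 < M" using K by (simp add: M_def)
    obtain N where N: "1 / real (Suc N) < e powr p / M"
      using reals_Archimedean[of "e powr p / M"] e M by (auto simp: inverse_eq_divide)
    have "dist (g i x) (g j x) < e" if "i \<ge> N" "j > i" for i j x
    proof -
      have F: "(\<lambda>x. f x - g j x) \<in> F" "(\<lambda>x. g i x - f x) \<in> F" using F_diff core_F g(1) f by auto
      have small: "energy1 p m E (\<lambda>x. f x - g k x) < 1 / real (Suc N)" if "k \<ge> N" for k
        by (rule less_le_trans[OF g(2)]) (use that in \<open>auto intro!: divide_left_mono\<close>)
      have "\<bar>g i x - g j x\<bar> powr p \<le> K * energy1 p m E (\<lambda>x. g i x - g j x)"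
        using K(2)[of "\<lambda>x. g i x - g j x" x] core_diff[OF g(1) g(1)] core_F core_cont by blast
      also have "K * energy1 p m E (\<lambda>x. g i x - g j x) \<le> K * (2 powr p * (energy1 p m E (\<lambda>x. g i x - f x) + energy1 p m E (\<lambda>x. f x - g j x)))"
        using energy1_add_le[OF F(2,1)] K(1) by simp
      also have "\<dots> \<le> K * (2 powr p * (1 / real (Suc N) + 1 / real (Suc N)))"
        using small[of i] small[of j] that K(1) energy1_minus_commute[OF f core_F[OF g(1)], of i]
        by (intro mult_left_mono add_mono) auto
      also have "\<dots> = M * (1 / real (Suc N))" by (simp add: M_def)
      also have "\<dots> < e powr p" using N M by (simp add: field_simps)
      finally have "\<bar>g i x - g j x\<bar> powr p < e powr p" .
      then have "\<bar>g i x - g j x\<bar> < e" using e powr_mono2[of p e "\<bar>g i x - g j x\<bar>"] by (meson p_pos(4) less_eq_real_def linorder_not_less)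
      then show ?thesis by (simp add: dist_real_def)
    qed
    then show "\<exists>N. \<forall>x\<in>UNIV. \<forall>m\<ge>N. \<forall>n>m. dist (g m x) (g n x) < e" by blast
  qed
  then obtain u where u: "uniform_limit UNIV g u sequentially"
    using Cauchy_uniformly_convergent unfolding uniformly_convergent_on_def by blast
  have cont: "continuous_on UNIV u"
    by (rule uniform_limit_theorem[OF _ u]) (use core_cont[OF g(1)] in auto)
  have lim: "(\<lambda>n. \<integral>x. norm (\<bar>f x - g n x\<bar> powr p) \<partial>m) \<longlonglongrightarrow> 0"
  proof (rule tendsto_sandwich[of "\<lambda>_. 0" _ _ "\<lambda>n. 1 / real (Suc n)"])
    show "\<forall>\<^sub>F n in sequentially. (\<integral>x. norm (\<bar>f x - g n x\<bar> powr p) \<partial>m) \<le> 1 / real (Suc n)"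
      using g(2) E_nonneg[OF F_diff[OF f core_F[OF g(1)]]]
      by (intro always_eventually allI) (simp add: energy1_eq, smt (verit))
    show "(\<lambda>n. 1 / real (Suc n)) \<longlonglongrightarrow> 0" using LIMSEQ_inverse_real_of_nat by (simp add: inverse_eq_divide)
  qed auto
  obtain k where k: "strict_mono k" "AE x in m. (\<lambda>n. \<bar>f x - g (k n) x\<bar> powr p) \<longlonglongrightarrow> 0"
    using tendsto_L1_AE_subseq[OF _ lim] integrable_powr[OF F_diff[OF f core_F[OF g(1)]]] by auto
  have ae: "AE x in m. u x = f x"
    using k(2)
  proof eventually_elim
    case (elim x)
    have "(\<lambda>n. (\<bar>f x - g (k n) x\<bar> powr p) powr (1 / p)) \<longlonglongrightarrow> 0 powr (1 / p)"
      by (rule tendsto_powr'[OF elim tendsto_const]) auto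
    then have "(\<lambda>n. \<bar>f x - g (k n) x\<bar>) \<longlonglongrightarrow> 0" by (simp add: powr_powr)
    moreover have "(\<lambda>n. \<bar>f x - g (k n) x\<bar>) \<longlonglongrightarrow> \<bar>f x - u x\<bar>"
      using LIMSEQ_subseq_LIMSEQ[OF tendsto_uniform_limitI[OF u, of x] k(1)] by (intro tendsto_intros) (auto simp: o_def)
    ultimately have "\<bar>f x - u x\<bar> = 0" by (rule LIMSEQ_unique[rotated])
    then show ?case by simp
  qed
  have "u \<in> borel_measurable m"
    using borel_measurable_continuous_onI[OF cont] by (simp add: measurable_cong_sets[OF sets_m refl])
  then have "u \<in> F" using F_ae_closed[OF f, of u] ae by (auto elim: AE_mp simp: eq_commute)
  then show ?thesis using that cont ae by blast
qed

text \<open>The values are compared with the averages over the nested balls \<open>B(y, r)\<close> and \<open>B(x, 2 r)\<close>.\<close>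

lemma osc_small:
  assumes r: "0 < r" "ennreal (A * (2 * r)) < D" and f: "f \<in> F" "continuous_on UNIV f" and xy: "dist x y \<le> r"
  shows "\<bar>f x - f y\<bar> \<le> (2 * S\<^sub>\<Theta> + 1) * (C\<^sub>\<Phi> * C\<^sub>M * res (2 * r) * E f) powr (1 / p)"
proof -
  let ?Q = "(C\<^sub>\<Phi> * C\<^sub>M * res (2 * r) * E f) powr (1 / p)"
  have E0: "0 \<le> E f" by (rule E_nonneg[OF f(1)])
  have R: "0 < 2 * r" using r by simp
  have Ar: "ennreal (A * r) < D" by (rule below_diam_mono[OF _ r(2)]) (use r(1) A in simp)
  have pos: "0 < C\<^sub>M" "0 < res r" "0 < res (2 * r)" "1 \<le> C\<^sub>\<Phi>" using CM_pos res_pos R r(1) C\<Phi> by auto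
  have Q2: "(C\<^sub>M * res (2 * r) * En f B) powr (1 / p) \<le> ?Q" for B
  proof (intro powr_mono2)
    have "C\<^sub>M * res (2 * r) * En f B \<le> C\<^sub>M * res (2 * r) * E f"
      using pos En_le_E[OF f(1)] by (intro mult_left_mono) auto
    also have "\<dots> \<le> C\<^sub>\<Phi> * (C\<^sub>M * res (2 * r) * E f)"
      using pos E0 mult_right_mono[of 1 C\<^sub>\<Phi> "C\<^sub>M * res (2 * r) * E f"] by simp
    finally show "C\<^sub>M * res (2 * r) * En f B \<le> C\<^sub>\<Phi> * C\<^sub>M * res (2 * r) * E f" by (simp add: mult.assoc)
  qed (use pos in auto)
  have res: "res r \<le> C\<^sub>\<Phi> * res (2 * r)"
  proof -
    have "\<Psi> r * \<Phi> (2 * r) \<le> \<Psi> (2 * r) * (C\<^sub>\<Phi> * \<Phi> r)"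
      using \<Psi>_mono[of r "2 * r"] \<Phi>_double[of r] r(1) \<Psi>_pos[of r] \<Phi>_pos[OF R] by (intro mult_mono) auto
    then show ?thesis using \<Phi>_pos r(1) R by (simp add: res_def field_simps)
  qed
  have Q1: "(C\<^sub>M * res r * En f B) powr (1 / p) \<le> ?Q" for B
  proof (intro powr_mono2)
    have "C\<^sub>M * res r * En f B \<le> C\<^sub>M * (C\<^sub>\<Phi> * res (2 * r)) * E f"
      using pos En_le_E[OF f(1)] res by (intro mult_mono) auto
    then show "C\<^sub>M * res r * En f B \<le> C\<^sub>\<Phi> * C\<^sub>M * res (2 * r) * E f" by (simp add: mult_ac)
  qed (use pos in auto)
  have "\<bar>f x - mean (ball x (2 * r)) f\<bar> \<le> S\<^sub>\<Theta> * ?Q"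
    using point_mean[OF R r(2) f, of x] mult_left_mono[OF Q2 S_nonneg] by (meson order_trans)
  moreover have "\<bar>f y - mean (ball y r) f\<bar> \<le> S\<^sub>\<Theta> * ?Q"
    using point_mean[OF r(1) Ar f, of y] mult_left_mono[OF Q1 S_nonneg] by (meson order_trans)
  moreover have "\<bar>mean (ball y r) f - mean (ball x (2 * r)) f\<bar> \<le> ?Q"
  proof (rule order_trans[OF mean_step_root[OF R r(2) f(1)] Q2])
    show "ball y r \<subseteq> ball x (2 * r)"
    proof
      fix z assume "z \<in> ball y r"
      then show "z \<in> ball x (2 * r)" using dist_triangle[of x z y] xy by simp
    qed
  qed (use r(1) in auto)
  ultimately show ?thesis by (simp add: ring_distribs)
qed

text \<open>When the diameter is finite, two points may be too far apart for the Poincare inequality to apply at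
  their distance. The chain condition joins them by a bounded number of short steps.\<close>

lemma osc_global:
  obtains K where "0 < K"
    "\<And>f x y. f \<in> F \<Longrightarrow> continuous_on UNIV f \<Longrightarrow> x \<noteq> y \<Longrightarrow> \<bar>f x - f y\<bar> powr p \<le> K * res (dist x y) * E f"
proof -
  obtain Cc where Cc: "0 < Cc" "\<And>(x::'a) y n. n \<ge> 1 \<Longrightarrow> \<exists>z :: nat \<Rightarrow> 'a. z 0 = x \<and> z n = y \<and>
        (\<forall>k\<in>{1..n}. dist (z k) (z (k - 1)) \<le> Cc * dist x y / real n)"
    using chain unfolding chain_condition_def by meson
  \<comment> \<open>So many steps that each has length at most \<open>d(x,y) / (4 A)\<close>, half of the radius \<open>d(x,y) / (2 A)\<close> at which
     the Poincare inequality applies.\<close>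
  define n where "n = nat \<lceil>4 * A * Cc\<rceil> + 1"
  have n: "1 \<le> n" "4 * A * Cc \<le> real n" by (auto simp: n_def) linarith
  obtain C where C: "1 \<le> C" "\<And>r s. 0 < r \<Longrightarrow> r \<le> s \<Longrightarrow> s \<le> 2 * A * r \<Longrightarrow> res r \<le> C * res s"
    by (rule res_dilate[of "2 * A"]) (use A in auto)
  define L where "L = real n * (2 * S\<^sub>\<Theta> + 1)"
  have L: "0 < L" using n S_nonneg by (simp add: L_def)
  show ?thesis
  proof (rule that[of "L powr p * (C\<^sub>\<Phi> * C\<^sub>M * C)"])
    show "0 < L powr p * (C\<^sub>\<Phi> * C\<^sub>M * C)" using L C\<Phi> CM_pos C by simp
    fix f and x y :: 'a assume f: "f \<in> F" "continuous_on UNIV f" and "x \<noteq> y"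
    let ?d = "dist x y"
    define r where "r = ?d / (4 * A)"
    have d: "0 < ?d" using \<open>x \<noteq> y\<close> by simp
    have r: "0 < r" "A * (2 * r) = ?d / 2" using d A by (auto simp: r_def)
    have rD: "ennreal (A * (2 * r)) < D" unfolding r(2) by (rule below_diam_dist[of _ x y]) (use d in auto)
    let ?Q = "(C\<^sub>\<Phi> * C\<^sub>M * res (2 * r) * E f) powr (1 / p)"
    obtain z where z: "z 0 = x" "z n = y" "\<And>k. k \<in> {1..n} \<Longrightarrow> dist (z k) (z (k - 1)) \<le> Cc * ?d / real n"
      using Cc(2)[OF n(1), of x y] by blast
    have "Cc * ?d / real n \<le> r"
    proof -
      have "(4 * A * Cc) * ?d \<le> real n * ?d" using n(2) d by (intro mult_right_mono) auto
      then show ?thesis using n(1) A by (simp add: r_def field_simps)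
    qed
    then have step: "\<bar>f (z (Suc k)) - f (z k)\<bar> \<le> (2 * S\<^sub>\<Theta> + 1) * ?Q" if "k < n" for k
      using osc_small[OF r(1) rD f, of "z (Suc k)" "z k"] z(3)[of "Suc k"] that by auto
    have "f y - f x = (\<Sum>k<n. f (z (Suc k)) - f (z k))"
      using sum_lessThan_telescope[of "\<lambda>k. f (z k)" n] z by simp
    then have "\<bar>f x - f y\<bar> \<le> (\<Sum>k<n. \<bar>f (z (Suc k)) - f (z k)\<bar>)"
      using sum_abs[of "\<lambda>k. f (z (Suc k)) - f (z k)" "{..<n}"] by (simp add: abs_minus_commute)
    also have "\<dots> \<le> (\<Sum>k<n. (2 * S\<^sub>\<Theta> + 1) * ?Q)" by (intro sum_mono step) auto
    also have "\<dots> = L * ?Q" by (simp add: L_def)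
    finally have "\<bar>f x - f y\<bar> powr p \<le> (L * ?Q) powr p" by (intro powr_mono2) auto
    also have nn: "0 \<le> C\<^sub>\<Phi> * C\<^sub>M * res (2 * r) * E f"
      using C\<Phi> CM_pos res_pos[of "2 * r"] r(1) E_nonneg[OF f(1)] by simp
    have "(L * ?Q) powr p = L powr p * (C\<^sub>\<Phi> * C\<^sub>M * res (2 * r) * E f)"
      using L nn by (simp add: powr_mult[of L ?Q] powr_powr)
    also have "\<dots> \<le> L powr p * (C\<^sub>\<Phi> * C\<^sub>M * (C * res ?d) * E f)"
      using C(2)[of "2 * r" ?d] r d A C\<Phi> CM_pos E_nonneg[OF f(1)]
      by (intro mult_left_mono mult_right_mono) (auto simp: r_def field_simps)
    finally show "\<bar>f x - f y\<bar> powr p \<le> L powr p * (C\<^sub>\<Phi> * C\<^sub>M * C) * res ?d * E f"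
      by (simp only: mult_ac)
  qed
qed

end

section \<open>From capacities to resistances and cutoff Sobolev inequalities\<close>

context slow_volume_Poincare
begin

text \<open>The values of a competitor for the capacity are prescribed almost everywhere on open sets; its continuous
  version takes them everywhere.\<close>

lemma capacity_potential:
  assumes "capacity_upper m F E \<Psi>"
  obtains K A\<^sub>c where "0 < K" "1 < A\<^sub>c"
    "\<And>x r s. 0 < r \<Longrightarrow> 0 < s \<Longrightarrow> ennreal s < D \<Longrightarrow> \<exists>u\<in>core. (\<forall>y. 0 \<le> u y \<and> u y \<le> 1) \<and> (\<forall>y\<in>ball x r. u y = 1) \<and>
        closure {y. u y \<noteq> 0} \<subseteq> ball x (A\<^sub>c * r) \<and> res r * E u \<le> K"
proof -
  obtain C A\<^sub>c where C: "0 < C" "1 < A\<^sub>c" "\<And>x r. 0 < r \<Longrightarrow>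
        capacity m F E (ball x r) (UNIV - ball x (A\<^sub>c * r)) \<le> ennreal (C * (measure m (ball x r) / \<Psi> r))"
    using assms unfolding capacity_upper_def by blast
  obtain C\<^sub>U where CU: "0 < C\<^sub>U" "\<And>x r r'. 0 < r \<Longrightarrow> 0 < r' \<Longrightarrow> ennreal r' < D \<Longrightarrow> measure m (ball x r) \<le> C\<^sub>U * \<Phi> r"
    using volume_upper by blast
  show ?thesis
  proof (rule that[of "2 * C * C\<^sub>U" "A\<^sub>c"])
    fix x :: 'a and r s :: real assume r: "0 < r" and s: "0 < s" "ennreal s < D"
    let ?c = "C * (measure m (ball x r) / \<Psi> r)"
    have c: "0 < ?c" using C(1) measure_ball_pos[OF r] \<Psi>_pos[OF r] by simp
    have "capacity m F E (ball x r) (UNIV - ball x (A\<^sub>c * r)) < ennreal (2 * ?c)"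
      by (rule le_less_trans[OF C(3)[OF r]]) (use c in \<open>auto intro!: ennreal_lessI\<close>)
    then obtain \<phi> U\<^sub>1 U\<^sub>2 where \<phi>: "\<phi> \<in> F" "ennreal (E \<phi>) < ennreal (2 * ?c)"
      and U1: "open U\<^sub>1" "ball x r \<subseteq> U\<^sub>1" "ae_eq_on m U\<^sub>1 \<phi> 1"
      and U2: "open U\<^sub>2" "UNIV - ball x (A\<^sub>c * r) \<subseteq> U\<^sub>2" "ae_eq_on m U\<^sub>2 \<phi> 0"
      unfolding capacity_def INF_less_iff by blast
    obtain v where v: "v \<in> F" "continuous_on UNIV v" "AE y in m. v y = \<phi> y" by (rule continuous_version[OF \<phi>(1)])
    have v1: "v y = 1" if "y \<in> U\<^sub>1" for y
      by (rule AE_eq_imp_eq_on_open[OF v(2) U1(1) _ that]) (use v(3) U1(3) in \<open>auto simp: ae_eq_on_def elim: AE_mp\<close>)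
    have v0: "v y = 0" if "y \<in> U\<^sub>2" for y
      by (rule AE_eq_imp_eq_on_open[OF v(2) U2(1) _ that]) (use v(3) U2(3) in \<open>auto simp: ae_eq_on_def elim: AE_mp\<close>)
    let ?u = "\<lambda>y. min 1 (max 0 (v y)) - 0"
    have u: "?u \<in> F" "E ?u \<le> E v" using Markov[OF clip_lip[of 0 1], of v] v(1) by auto
    have "E v = E \<phi>" by (rule E_ae_cong[OF v(1) \<phi>(1) v(3)])
    have supp: "closure {y. ?u y \<noteq> 0} \<subseteq> - U\<^sub>2"
      by (rule closure_minimal) (use U2(1) v0 in auto)
    also have "- U\<^sub>2 \<subseteq> ball x (A\<^sub>c * r)" using U2(2) by auto
    finally have supp: "closure {y. ?u y \<noteq> 0} \<subseteq> ball x (A\<^sub>c * r)" .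
    have "bounded {y. ?u y \<noteq> 0}" by (rule bounded_subset[OF bounded_ball order_trans[OF closure_subset supp]])
    then have "?u \<in> core" using u v(2) by (intro core_I continuous_intros)
    moreover have "res r * E ?u \<le> 2 * C * C\<^sub>U"
    proof -
      have "E ?u \<le> 2 * ?c" using u(2) \<phi>(2) c \<open>E v = E \<phi>\<close> by (auto simp: ennreal_less_iff E_nonneg[OF \<phi>(1)])
      also have "\<dots> \<le> 2 * (C * (C\<^sub>U * \<Phi> r / \<Psi> r))"
        using CU(2)[OF r s, of x] C(1) \<Psi>_pos[OF r] by (intro mult_left_mono divide_right_mono) auto
      finally have "res r * E ?u \<le> res r * (2 * (C * (C\<^sub>U * \<Phi> r / \<Psi> r)))" using res_pos[OF r] by (intro mult_left_mono) auto
      also have "\<dots> = 2 * C * C\<^sub>U" using \<Psi>_pos[OF r] \<Phi>_pos[OF r] by (simp add: res_def)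
      finally show ?thesis .
    qed
    ultimately show "\<exists>u\<in>core. (\<forall>y. 0 \<le> u y \<and> u y \<le> 1) \<and> (\<forall>y\<in>ball x r. u y = 1) \<and>
        closure {y. u y \<noteq> 0} \<subseteq> ball x (A\<^sub>c * r) \<and> res r * E u \<le> 2 * C * C\<^sub>U"
      using supp v1 U1(2) by (intro bexI[of _ ?u]) auto
  qed (use C CU in auto)
qed

text \<open>The potential of \<open>B(y, d(x,y) / A\<^sub>c)\<close> is \<open>1\<close> at \<open>y\<close> and \<open>0\<close> at \<open>x\<close>.\<close>

lemma capacity_imp_resistance:
  assumes "capacity_upper m F E \<Psi>" shows "resistance_estimate F E \<Phi> \<Psi>"
proof -
  obtain K\<^sub>1 where K1: "0 < K\<^sub>1"
    "\<And>f x y. f \<in> F \<Longrightarrow> continuous_on UNIV f \<Longrightarrow> x \<noteq> y \<Longrightarrow> \<bar>f x - f y\<bar> powr p \<le> K\<^sub>1 * res (dist x y) * E f"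
    using osc_global by blast
  obtain K A\<^sub>c where K: "0 < K" "1 < A\<^sub>c"
    "\<And>x r s. 0 < r \<Longrightarrow> 0 < s \<Longrightarrow> ennreal s < D \<Longrightarrow> \<exists>u\<in>core. (\<forall>y. 0 \<le> u y \<and> u y \<le> 1) \<and> (\<forall>y\<in>ball x r. u y = 1) \<and>
        closure {y. u y \<noteq> 0} \<subseteq> ball x (A\<^sub>c * r) \<and> res r * E u \<le> K"
    by (rule capacity_potential[OF assms]) blast
  obtain C where C: "1 \<le> C" "\<And>r s. 0 < r \<Longrightarrow> r \<le> s \<Longrightarrow> s \<le> A\<^sub>c * r \<Longrightarrow> res s \<le> C * res r"
    by (rule res_dilate[of A\<^sub>c]) (use K(2) in auto)
  have up: "eff_resistance F E {x} {y} \<le> ennreal (K\<^sub>1 * res (dist x y))" if "x \<noteq> y" for x y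
  proof (rule eff_resistance_le)
    show "0 < K\<^sub>1 * res (dist x y)" using K1(1) res_pos that by simp
    show "1 \<le> K\<^sub>1 * res (dist x y) * E u" if "u \<in> F" "continuous_on UNIV u" "u x = 0" "u y = 1" for u
      using K1(2)[OF that(1,2) \<open>x \<noteq> y\<close>] that(3,4) by simp
  qed
  have low: "ennreal (res (dist x y) / (K * C)) \<le> eff_resistance F E {x} {y}" if "x \<noteq> y" for x y
  proof -
    let ?d = "dist x y" and ?r = "dist x y / A\<^sub>c"
    have d: "0 < ?d" "0 < ?r" "?r < ?d" using that K(2) by (auto simp: divide_less_eq)
    then have "ennreal ?r < D" by (intro below_diam_dist[of _ x y])
    then obtain u where u: "u \<in> core" "\<And>z. z \<in> ball y ?r \<Longrightarrow> u z = 1" "closure {z. u z \<noteq> 0} \<subseteq> ball y (A\<^sub>c * ?r)" "res ?r * E u \<le> K"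
      using K(3)[OF d(2) d(2), of y] by blast
    have "x \<notin> ball y (A\<^sub>c * ?r)" using K(2) by (simp add: dist_commute)
    then have ux: "u x = 0" using u(3) closure_subset[of "{z. u z \<noteq> 0}"] by blast
    have "res ?d * E u \<le> C * res ?r * E u"
      using C(2)[of ?r ?d] d K(2) E_nonneg[OF core_F[OF u(1)]] by (intro mult_right_mono) auto
    also have "\<dots> \<le> C * K" using mult_left_mono[OF u(4), of C] C(1) by (simp add: mult.assoc)
    finally have le: "res ?d / (K * C) * E u \<le> 1" using K(1) C(1) by (simp add: field_simps)
    show ?thesis
      by (rule eff_resistance_ge[of _ u]) (use u ux le d(1,2) K(1) C(1) res_pos[OF d(1)] in \<open>auto intro: core_F core_cont\<close>)
  qed
  define M where "M = max K\<^sub>1 (K * C)"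
  have M: "0 < M" "K\<^sub>1 \<le> M" "K * C \<le> M" using K1(1) by (auto simp: M_def)
  show ?thesis
    unfolding resistance_estimate_def res_def[symmetric]
  proof (intro exI[of _ M] conjI M allI impI)
    fix x y :: 'a assume "x \<noteq> y"
    then have R: "0 < res (dist x y)" by (intro res_pos) simp
    have "1 / M * res (dist x y) \<le> res (dist x y) / (K * C)"
      using M R K(1) C(1) by (simp add: frac_le)
    then show "ennreal (1 / M * res (dist x y)) \<le> eff_resistance F E {x} {y}"
      using low[OF \<open>x \<noteq> y\<close>] by (meson ennreal_leI order_trans)
    have "K\<^sub>1 * res (dist x y) \<le> M * res (dist x y)" using R M by (intro mult_right_mono) auto
    then show "eff_resistance F E {x} {y} \<le> ennreal (M * res (dist x y))"
      using up[OF \<open>x \<noteq> y\<close>] by (meson ennreal_leI order_trans)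
  qed
qed

lemma AE_\<Gamma>_support:
  assumes "u \<in> core" "B \<in> sets borel" "\<And>y. y \<notin> B \<Longrightarrow> u y = 0"
  shows "AE y in \<Gamma> u. y \<in> B" "E u = En u B"
proof -
  have "En u (- B) = 0" by (rule En_constant[OF assms(1), of _ 0]) (use assms in auto)
  then show "AE y in \<Gamma> u. y \<in> B"
    using assms(1,2) by (intro AE_I[of _ _ "- B"]) (auto simp: emeasure_\<Gamma> core_F sets_\<Gamma>)
  have "B \<union> - B = UNIV" by auto
  then show "E u = En u B"
    using En_Un[OF core_F[OF assms(1)] assms(2), of "- B"] \<open>En u (- B) = 0\<close> assms by (simp add: E_eq core_F)
qed

text \<open>The potential \<open>\<phi>\<close> of \<open>B(x, 2 r)\<close> serves as cutoff function for \<open>B(x, r)\<close>: it is \<open>1\<close> in a neighbourhood of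
  the closed ball. The energy measure of \<open>\<phi>\<close> lives on \<open>B(x, 2 A\<^sub>c r)\<close>, and there \<open>\<bar>f\<bar>\<^sup>p\<close> is bounded through
  \<open>point_powr_le\<close> by quantities in balls of radius \<open>r\<close> around the points; these balls are contained in
  \<open>B(x, (2 A\<^sub>c + 1) r)\<close>. It remains to multiply by \<open>\<E>(\<phi>)\<close>.\<close>

lemma capacity_imp_cutoff_Sobolev:
  assumes "capacity_upper m F E \<Psi>" shows "cutoff_Sobolev p m F E \<Gamma> \<Psi>"
proof -
  obtain K A\<^sub>c where K: "0 < K" "1 < A\<^sub>c"
    "\<And>x r s. 0 < r \<Longrightarrow> 0 < s \<Longrightarrow> ennreal s < D \<Longrightarrow> \<exists>u\<in>core. (\<forall>y. 0 \<le> u y \<and> u y \<le> 1) \<and> (\<forall>y\<in>ball x r. u y = 1) \<and>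
        closure {y. u y \<noteq> 0} \<subseteq> ball x (A\<^sub>c * r) \<and> res r * E u \<le> K"
    by (rule capacity_potential[OF assms]) blast
  define A\<^sub>S where "A\<^sub>S = 2 * A\<^sub>c + 1"
  have AS: "1 < A\<^sub>S" using K(2) by (simp add: A\<^sub>S_def)
  obtain C where C: "1 \<le> C" "\<And>r s. 0 < r \<Longrightarrow> r \<le> s \<Longrightarrow> s \<le> 2 * A * r \<Longrightarrow> res r \<le> C * res s"
    by (rule res_dilate[of "2 * A"]) (use A in auto)
  obtain C\<^sub>2 where C2: "1 \<le> C\<^sub>2" "\<And>r. 0 < r \<Longrightarrow> \<Phi> (2 * A * r) \<le> C\<^sub>2 * \<Phi> r"
    by (rule \<Phi>_dilate[of "2 * A"]) (use A in auto)
  define D\<^sub>1 where "D\<^sub>1 = 2 powr p * (S\<^sub>\<Theta> powr p * C\<^sub>M * (C * K))"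
  define D\<^sub>2 where "D\<^sub>2 = 2 powr p * (2 powr p * C\<^sub>V * (C\<^sub>2 * K))"
  have D12: "0 \<le> D\<^sub>1" "0 < D\<^sub>2" "0 < D\<^sub>1 + 1" using CM_pos C C2 K CV by (auto simp: D\<^sub>1_def D\<^sub>2_def add_nonneg_pos)
  show ?thesis
    unfolding cutoff_Sobolev_def
  proof (rule exI[of _ "D\<^sub>1 + 1"], rule conjI[OF D12(3)], rule exI[of _ D\<^sub>2], rule conjI[OF D12(2)],
      rule exI[of _ A\<^sub>S], rule conjI[OF AS], intro allI impI)
    fix x :: 'a and r :: real assume r: "0 < r"
    let ?B = "ball x (A\<^sub>S * r)"
    show "\<exists>\<phi>. cutoff_function m F (ball x r) ?B \<phi> \<and>
          (\<forall>f\<in>F. \<forall>u. quasi_continuous_version p m F E f u \<longrightarrow>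
             (\<integral>\<^sup>+y\<in>?B. ennreal (\<bar>u y\<bar> powr p) \<partial>\<Gamma> \<phi>)
               \<le> ennreal (D\<^sub>1 + 1) * emeasure (\<Gamma> f) ?B
                  + ennreal (D\<^sub>2 / \<Psi> r) * (\<integral>\<^sup>+y\<in>?B. ennreal (\<bar>f y\<bar> powr p) \<partial>m))"
    proof (cases "ennreal r < D")
      case False
      have bd: "bounded (UNIV :: 'a set)" by (rule not_below_diam_bounded[OF r False])
      have "r < A\<^sub>S * r" using AS r by simp
      then have B: "?B = UNIV" using le_less_trans[OF not_below_diamD[OF r False]] by auto
      have one: "(\<lambda>_. 1) \<in> F" using core_F[OF one_core[OF bd]] .
      have "emeasure (\<Gamma> (\<lambda>_. 1)) UNIV = 0" using \<Gamma>_total[OF one] E_one[OF bd] by simp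
      then have null: "AE y in \<Gamma> (\<lambda>_. 1). g y = 0" for g :: "'a \<Rightarrow> ennreal"
        by (intro AE_I[of _ _ UNIV]) (auto simp: sets_\<Gamma>[OF one])
      show ?thesis
      proof (intro exI conjI ballI allI impI)
        show "cutoff_function m F (ball x r) ?B (\<lambda>_. 1)"
          unfolding cutoff_function_def B using one by (auto simp: ae_eq_on_def intro!: exI[of _ UNIV])
        fix f u
        have "(\<integral>\<^sup>+y\<in>?B. ennreal (\<bar>u y\<bar> powr p) \<partial>\<Gamma> (\<lambda>_. 1)) = (\<integral>\<^sup>+y. 0 \<partial>\<Gamma> (\<lambda>_. 1))"
          by (rule nn_integral_cong_AE, rule null)
        then show "(\<integral>\<^sup>+y\<in>?B. ennreal (\<bar>u y\<bar> powr p) \<partial>\<Gamma> (\<lambda>_. 1))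
               \<le> ennreal (D\<^sub>1 + 1) * emeasure (\<Gamma> f) ?B
                  + ennreal (D\<^sub>2 / \<Psi> r) * (\<integral>\<^sup>+y\<in>?B. ennreal (\<bar>f y\<bar> powr p) \<partial>m)" by simp
      qed
    next
      case True
      obtain \<phi> where \<phi>: "\<phi> \<in> core" "\<And>y. 0 \<le> \<phi> y \<and> \<phi> y \<le> 1" "\<And>y. y \<in> ball x (2 * r) \<Longrightarrow> \<phi> y = 1"
        "closure {y. \<phi> y \<noteq> 0} \<subseteq> ball x (A\<^sub>c * (2 * r))" "res (2 * r) * E \<phi> \<le> K"
        using K(3)[of "2 * r" r x] r True by (metis mult_pos_pos zero_less_numeral)
      have sub: "ball x (A\<^sub>c * (2 * r)) \<subseteq> ?B" using r K(2) by (intro subset_ball) (simp add: A\<^sub>S_def algebra_simps)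
      show ?thesis
      proof (intro exI conjI ballI allI impI)
        show "cutoff_function m F (ball x r) ?B \<phi>"
          unfolding cutoff_function_def
        proof (intro conjI exI[of _ "ball x (2 * r)"])
          show "closure (ball x r) \<subseteq> ball x (2 * r)"
            using closure_mono[OF ball_subset_cball[of x r]] r by (auto intro: le_less_trans simp: subset_iff)
          show "fun_support m \<phi> \<subseteq> ?B"
            using fun_support_continuous[OF core_F[OF \<phi>(1)] core_cont[OF \<phi>(1)]] \<phi>(4) sub by auto
        qed (use \<phi> core_F in \<open>auto simp: ae_eq_on_def\<close>)
        fix f u assume f: "f \<in> F" and qc: "quasi_continuous_version p m F E f u"
        have u: "u \<in> borel_measurable borel" "AE y in m. u y = f y" "continuous_on UNIV u"
          using qc quasi_continuous_imp_continuous by (auto simp: quasi_continuous_version_def)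
        have uF: "u \<in> F" using F_ae_closed[OF f, of u] u(1,2) by (simp add: measurable_cong_sets[OF sets_m refl] eq_commute)
        have \<Gamma>u: "\<Gamma> u = \<Gamma> f" by (rule \<Gamma>_ae_cong[OF uF f u(2)])
        let ?L = "LINT y:?B|m. \<bar>u y\<bar> powr p"
        have L: "0 \<le> ?L" using LINT_powr_diff_nonneg[of x "A\<^sub>S * r" u 0] by simp
        define s where "s = r / A"
        have s: "0 < s" "A * s = r" "s \<le> r" using r A by (auto simp: s_def divide_le_eq)
        define M where "M = 2 powr p * (2 powr p * C\<^sub>V * (?L / \<Phi> s) + S\<^sub>\<Theta> powr p * C\<^sub>M * (res s * En u ?B))"
        have M: "0 \<le> M" using CV L \<Phi>_pos[OF s(1)] res_pos[OF s(1)] CM_pos by (simp add: M_def)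
        have pt: "\<bar>u y\<bar> powr p \<le> M" if "y \<in> ball x (A\<^sub>c * (2 * r))" for y
        proof -
          have sub1: "ball y r \<subseteq> ?B"
          proof
            fix z assume "z \<in> ball y r"
            then show "z \<in> ?B" using that dist_triangle[of x z y] by (simp add: A\<^sub>S_def algebra_simps)
          qed
          have sub2: "ball y s \<subseteq> ?B" using subset_ball[OF s(3), of y] sub1 by blast
          have "(LINT z:ball y s|m. \<bar>u z\<bar> powr p) \<le> ?L"
            unfolding set_lebesgue_integral_def
            by (rule integral_mono)
              (use sub2 set_integrable_powr_diff[OF uF, where c = 0] in \<open>auto simp: set_integrable_def indicator_def\<close>)
          moreover have "En u (ball y r) \<le> En u ?B" by (rule En_mono[OF uF _ sub1]) simp
          ultimately have "2 powr p * (2 powr p * C\<^sub>V * ((LINT z:ball y s|m. \<bar>u z\<bar> powr p) / \<Phi> s)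
              + S\<^sub>\<Theta> powr p * C\<^sub>M * (res s * En u (ball y r))) \<le> M"
            unfolding M_def using CV \<Phi>_pos[OF s(1)] res_pos[OF s(1)] CM_pos
            by (intro mult_left_mono add_mono divide_right_mono) auto
          then show ?thesis using point_powr_le[of s u y] s True uF u(3) by auto
        qed
        have E\<phi>: "0 \<le> E \<phi>" by (rule E_nonneg[OF core_F[OF \<phi>(1)]])
        have "(\<integral>\<^sup>+y\<in>?B. ennreal (\<bar>u y\<bar> powr p) \<partial>\<Gamma> \<phi>) \<le> (\<integral>\<^sup>+y. ennreal M \<partial>\<Gamma> \<phi>)"
        proof (rule nn_integral_mono_AE)
          have "AE y in \<Gamma> \<phi>. y \<in> ball x (A\<^sub>c * (2 * r))"
          proof (rule AE_\<Gamma>_support(1)[OF \<phi>(1)])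
            show "\<phi> y = 0" if "y \<notin> ball x (A\<^sub>c * (2 * r))" for y
              using that \<phi>(4) closure_subset[of "{y. \<phi> y \<noteq> 0}"] by blast
          qed simp
          then show "AE y in \<Gamma> \<phi>. ennreal (\<bar>u y\<bar> powr p) * indicator ?B y \<le> ennreal M"
            by eventually_elim (auto simp: indicator_def pt intro!: ennreal_leI)
        qed
        also have "\<dots> = ennreal M * ennreal (E \<phi>)"
          using \<Gamma>_total[OF core_F[OF \<phi>(1)]] sets_eq_imp_space_eq[OF sets_\<Gamma>[OF core_F[OF \<phi>(1)]]] by simp
        also have "\<dots> = ennreal (M * E \<phi>)" using M E\<phi> by (simp add: ennreal_mult)
        also have "M * E \<phi> \<le> (D\<^sub>1 + 1) * En u ?B + D\<^sub>2 / \<Psi> r * ?L"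
        proof -
          have "res s * E \<phi> \<le> C * res (2 * r) * E \<phi>"
            using C(2)[of s "2 * r"] s r E\<phi> by (intro mult_right_mono) auto
          also have "\<dots> \<le> C * K" using mult_left_mono[OF \<phi>(5), of C] C(1) by (simp add: mult.assoc)
          finally have 1: "res s * E \<phi> \<le> C * K" .
          have "E \<phi> \<le> K / res (2 * r)" using \<phi>(5) res_pos[of "2 * r"] r by (simp add: field_simps)
          also have "\<dots> = K * \<Phi> (2 * r) / \<Psi> (2 * r)" by (simp add: res_def)
          also have "\<dots> \<le> K * (C\<^sub>2 * \<Phi> s) / \<Psi> r"
          proof (intro frac_le mult_left_mono)
            have "2 * A * s = 2 * r" using s by simp
            then show "\<Phi> (2 * r) \<le> C\<^sub>2 * \<Phi> s" using C2(2)[OF s(1)] by metis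
          qed (use K(1) C2 \<Phi>_pos[OF s(1)] \<Psi>_pos[OF r] \<Psi>_mono[of r "2 * r"] r in auto)
          finally have 2: "E \<phi> / \<Phi> s \<le> C\<^sub>2 * K / \<Psi> r" using \<Phi>_pos[OF s(1)] \<Psi>_pos[OF r] by (simp add: field_simps)
          have "M * E \<phi> = 2 powr p * (2 powr p * C\<^sub>V * (?L * (E \<phi> / \<Phi> s)) + S\<^sub>\<Theta> powr p * C\<^sub>M * ((res s * E \<phi>) * En u ?B))"
            by (simp add: M_def algebra_simps)
          also have "\<dots> \<le> 2 powr p * (2 powr p * C\<^sub>V * (?L * (C\<^sub>2 * K / \<Psi> r)) + S\<^sub>\<Theta> powr p * C\<^sub>M * ((C * K) * En u ?B))"
            using 1 2 L CV CM_pos by (intro mult_left_mono add_mono mult_right_mono) auto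
          also have "\<dots> = D\<^sub>1 * En u ?B + D\<^sub>2 / \<Psi> r * ?L" by (simp add: D\<^sub>1_def D\<^sub>2_def algebra_simps)
          also have "\<dots> \<le> (D\<^sub>1 + 1) * En u ?B + D\<^sub>2 / \<Psi> r * ?L" by (simp add: algebra_simps)
          finally show ?thesis .
        qed
        also have "ennreal ((D\<^sub>1 + 1) * En u ?B + D\<^sub>2 / \<Psi> r * ?L) = ennreal (D\<^sub>1 + 1) * ennreal (En u ?B) + ennreal (D\<^sub>2 / \<Psi> r) * ennreal ?L"
        proof -
          have "0 \<le> D\<^sub>1 + 1" "0 \<le> D\<^sub>2 / \<Psi> r" using D12 \<Psi>_pos[OF r] by auto
          then show ?thesis using L by (simp only: ennreal_plus ennreal_mult mult_nonneg_nonneg measure_nonneg)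
        qed
        also have "ennreal (En u ?B) = emeasure (\<Gamma> f) ?B" using emeasure_\<Gamma>[OF uF] \<Gamma>u by simp
        also have "ennreal ?L = (\<integral>\<^sup>+y\<in>?B. ennreal (\<bar>u y\<bar> powr p) \<partial>m)"
          using nn_integral_powr_diff[OF uF, where c = 0] by simp
        also have "\<dots> = (\<integral>\<^sup>+y\<in>?B. ennreal (\<bar>f y\<bar> powr p) \<partial>m)"
          by (rule nn_integral_cong_AE) (use u(2) in auto)
        finally show "(\<integral>\<^sup>+y\<in>?B. ennreal (\<bar>u y\<bar> powr p) \<partial>\<Gamma> \<phi>)
               \<le> ennreal (D\<^sub>1 + 1) * emeasure (\<Gamma> f) ?B
                  + ennreal (D\<^sub>2 / \<Psi> r) * (\<integral>\<^sup>+y\<in>?B. ennreal (\<bar>f y\<bar> powr p) \<partial>m)"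
          by (simp add: ennreal_leI)
      qed
    qed
  qed
qed

text \<open>The inequality for a core function that is \<open>1\<close> on \<open>B(x, A\<^sub>S r)\<close> has no energy term on the right, and its
  left-hand side is the energy of the cutoff function.\<close>

lemma cutoff_Sobolev_imp_capacity:
  assumes "cutoff_Sobolev p m F E \<Gamma> \<Psi>" shows "capacity_upper m F E \<Psi>"
proof -
  obtain C\<^sub>1 C\<^sub>2 A\<^sub>S where C: "0 < C\<^sub>1" "0 < C\<^sub>2" "1 < A\<^sub>S"
    "\<And>x r. 0 < r \<Longrightarrow> \<exists>\<phi>. cutoff_function m F (ball x r) (ball x (A\<^sub>S * r)) \<phi> \<and>
          (\<forall>f\<in>F. \<forall>u. quasi_continuous_version p m F E f u \<longrightarrow>
             (\<integral>\<^sup>+y\<in>ball x (A\<^sub>S * r). ennreal (\<bar>u y\<bar> powr p) \<partial>\<Gamma> \<phi>)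
               \<le> ennreal C\<^sub>1 * emeasure (\<Gamma> f) (ball x (A\<^sub>S * r))
                  + ennreal (C\<^sub>2 / \<Psi> r) * (\<integral>\<^sup>+y\<in>ball x (A\<^sub>S * r). ennreal (\<bar>f y\<bar> powr p) \<partial>m))"
    using assms unfolding cutoff_Sobolev_def by blast
  obtain C\<^sub>U where CU: "0 < C\<^sub>U" "\<And>x r r'. 0 < r \<Longrightarrow> 0 < r' \<Longrightarrow> ennreal r' < D \<Longrightarrow> measure m (ball x r) \<le> C\<^sub>U * \<Phi> r"
    using volume_upper by blast
  obtain C\<^sub>3 where C3: "1 \<le> C\<^sub>3" "\<And>r. 0 < r \<Longrightarrow> \<Phi> (A\<^sub>S * r) \<le> C\<^sub>3 * \<Phi> r"
    by (rule \<Phi>_dilate[of A\<^sub>S]) (use C(3) in auto)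
  let ?K = "C\<^sub>2 * (C\<^sub>U * (C\<^sub>3 * C\<^sub>V))"
  have K: "0 < ?K" using C CU C3 CV by simp
  show ?thesis
    unfolding capacity_upper_def
  proof (rule exI[of _ ?K], rule conjI[OF K], rule exI[of _ A\<^sub>S], rule conjI[OF C(3)], intro allI impI)
    fix x :: 'a and r :: real assume r: "0 < r"
    let ?B = "ball x (A\<^sub>S * r)"
    have AS: "0 < A\<^sub>S * r" using C(3) r by simp
    show "capacity m F E (ball x r) (UNIV - ?B) \<le> ennreal (?K * (measure m (ball x r) / \<Psi> r))"
    proof (cases "ennreal r < D")
      case False
      then show ?thesis using capacity_above_diam[OF r False C(3)] by simp
    next
      case True
      obtain \<phi> where cut: "cutoff_function m F (ball x r) ?B \<phi>"
        and CS: "\<And>f u. f \<in> F \<Longrightarrow> quasi_continuous_version p m F E f u \<Longrightarrow>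
             (\<integral>\<^sup>+y\<in>?B. ennreal (\<bar>u y\<bar> powr p) \<partial>\<Gamma> \<phi>)
               \<le> ennreal C\<^sub>1 * emeasure (\<Gamma> f) ?B + ennreal (C\<^sub>2 / \<Psi> r) * (\<integral>\<^sup>+y\<in>?B. ennreal (\<bar>f y\<bar> powr p) \<partial>m)"
        using C(4)[OF r, of x] by blast
      from cut obtain W where \<phi>: "\<phi> \<in> F" "fun_support m \<phi> \<subseteq> ?B" and W: "open W" "closure (ball x r) \<subseteq> W" "ae_eq_on m W \<phi> 1"
        unfolding cutoff_function_def by blast
      obtain v where v: "v \<in> F" "continuous_on UNIV v" "AE y in m. v y = \<phi> y" by (rule continuous_version[OF \<phi>(1)])
      have supp: "closure {y. v y \<noteq> 0} = fun_support m \<phi>" by (rule fun_support_continuous[OF \<phi>(1) v(2,3), symmetric])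
      then have v0: "v y = 0" if "y \<notin> fun_support m \<phi>" for y using that closure_subset[of "{y. v y \<noteq> 0}"] by blast
      have "bounded {y. v y \<noteq> 0}"
        by (rule bounded_subset[OF bounded_ball order_trans[OF closure_subset]]) (use supp \<phi>(2) in auto)
      then have v_core: "v \<in> core" using v by (intro core_I)
      have \<Gamma>v: "\<Gamma> v = \<Gamma> \<phi>" by (rule \<Gamma>_ae_cong[OF v(1) \<phi>(1) v(3)])
      have E\<phi>: "E \<phi> = En \<phi> ?B"
      proof -
        have "v y = 0" if "y \<notin> ?B" for y using v0 \<phi>(2) that by blast
        then show ?thesis
          using AE_\<Gamma>_support(2)[OF v_core, of ?B] E_ae_cong[OF v(1) \<phi>(1) v(3)] \<Gamma>v by simp
      qed
      obtain \<psi> where \<psi>: "\<psi> \<in> core" "\<And>y. dist x y \<le> A\<^sub>S * r \<Longrightarrow> \<psi> y = 1"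
        using plateau_exists[of "A\<^sub>S * r" "A\<^sub>S * r + 1" x] by (metis less_add_one)
      have \<psi>B: "\<psi> y = 1" if "y \<in> ?B" for y using \<psi>(2) that by simp
      have "quasi_continuous_version p m F E \<psi> \<psi>"
        using continuous_imp_quasi_continuous[OF core_cont[OF \<psi>(1)]] borel_measurable_core[OF \<psi>(1)]
        by (simp add: quasi_continuous_version_def)
      from CS[OF core_F[OF \<psi>(1)] this]
      have "(\<integral>\<^sup>+y\<in>?B. ennreal (\<bar>\<psi> y\<bar> powr p) \<partial>\<Gamma> \<phi>)
               \<le> ennreal C\<^sub>1 * emeasure (\<Gamma> \<psi>) ?B + ennreal (C\<^sub>2 / \<Psi> r) * (\<integral>\<^sup>+y\<in>?B. ennreal (\<bar>\<psi> y\<bar> powr p) \<partial>m)" .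
      also have "emeasure (\<Gamma> \<psi>) ?B = 0"
        using En_constant[OF \<psi>(1), of ?B 1] \<psi>B by (simp add: emeasure_\<Gamma>[OF core_F[OF \<psi>(1)]])
      also have "(\<integral>\<^sup>+y\<in>?B. ennreal (\<bar>\<psi> y\<bar> powr p) \<partial>m) = (\<integral>\<^sup>+y. indicator ?B y \<partial>m)"
        by (intro nn_integral_cong) (auto simp: indicator_def \<psi>B)
      also have "\<dots> = ennreal (measure m ?B)" by (simp add: emeasure_ball)
      also have "(\<integral>\<^sup>+y\<in>?B. ennreal (\<bar>\<psi> y\<bar> powr p) \<partial>\<Gamma> \<phi>) = (\<integral>\<^sup>+y. indicator ?B y \<partial>\<Gamma> \<phi>)"
        by (intro nn_integral_cong) (auto simp: indicator_def \<psi>B)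
      also have "\<dots> = ennreal (E \<phi>)" by (simp add: sets_\<Gamma>[OF \<phi>(1)] emeasure_\<Gamma>[OF \<phi>(1)] E\<phi>)
      finally have "ennreal (E \<phi>) \<le> ennreal (C\<^sub>2 / \<Psi> r * measure m ?B)"
        using C(2) \<Psi>_pos[OF r] by (simp add: ennreal_mult del: times_divide_eq_left)
      also have "C\<^sub>2 / \<Psi> r * measure m ?B \<le> C\<^sub>2 / \<Psi> r * (C\<^sub>U * (C\<^sub>3 * (C\<^sub>V * measure m (ball x r))))"
      proof (intro mult_left_mono)
        have "measure m ?B \<le> C\<^sub>U * \<Phi> (A\<^sub>S * r)" by (rule CU(2)[OF AS r True])
        also have "\<dots> \<le> C\<^sub>U * (C\<^sub>3 * \<Phi> r)" using C3(2)[OF r] CU(1) by simp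
        also have "\<dots> \<le> C\<^sub>U * (C\<^sub>3 * (C\<^sub>V * measure m (ball x r)))"
          using volume[OF r True, of x] CV C3(1) CU(1) by (intro mult_left_mono) (auto simp: field_simps)
        finally show "measure m ?B \<le> C\<^sub>U * (C\<^sub>3 * (C\<^sub>V * measure m (ball x r)))" .
      qed (use C(2) \<Psi>_pos[OF r] in auto)
      also have "\<dots> = ?K * (measure m (ball x r) / \<Psi> r)" by simp
      finally have "ennreal (E \<phi>) \<le> ennreal (?K * (measure m (ball x r) / \<Psi> r))" by (simp add: ennreal_leI)
      moreover have "capacity m F E (ball x r) (UNIV - ?B) \<le> ennreal (E \<phi>)"
      proof (rule capacity_le[where V = "- fun_support m \<phi>", OF \<phi>(1) W(1) _ W(3)])
        show "ball x r \<subseteq> W" using W(2) closure_subset by blast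
        show "open (- fun_support m \<phi>)" using supp by (metis closed_closure open_Compl)
        show "UNIV - ?B \<subseteq> - fun_support m \<phi>" using \<phi>(2) by auto
        show "ae_eq_on m (- fun_support m \<phi>) \<phi> 0"
          unfolding ae_eq_on_def using v(3) by eventually_elim (metis v0 ComplD)
      qed
      ultimately show ?thesis by (rule order_trans[rotated])
    qed
  qed
qed

end

section \<open>From resistances to capacities and the Poincare inequality\<close>

locale slow_volume_resistance = slow_volume m p F E \<Gamma> \<Phi> \<Psi> \<Theta> C\<^sub>\<Phi> C\<^sub>\<Psi> C\<^sub>V D
  for m :: "'a::polish_space measure" and p F E \<Gamma> \<Phi> \<Psi> \<Theta> C\<^sub>\<Phi> C\<^sub>\<Psi> C\<^sub>V D +
  fixes C\<^sub>R :: real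
  assumes CR: "0 < C\<^sub>R"
    and resistance_ge: "x \<noteq> y \<Longrightarrow> ennreal (1 / C\<^sub>R * res (dist x y)) \<le> eff_resistance F E {x} {y}"
    and resistance_le: "x \<noteq> y \<Longrightarrow> eff_resistance F E {x} {y} \<le> ennreal (C\<^sub>R * res (dist x y))"
begin

text \<open>The upper bound for the resistance is a statement about functions that vanish at one of the points;
  \<open>threshold_map\<close> turns \<open>f\<close> into one at the price of the factor \<open>2\<^sup>p\<close>.\<close>

lemma osc_resistance_aux:
  assumes f: "f \<in> F" "continuous_on UNIV f" and "x \<noteq> y" and le: "\<bar>f x\<bar> \<le> \<bar>f y\<bar>"
  shows "\<bar>f x - f y\<bar> powr p \<le> 2 powr p * C\<^sub>R * res (dist x y) * E f"
proof (cases "f x = f y")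
  case True
  then show ?thesis
    using CR res_pos[of "dist x y"] E_nonneg[OF f(1)] \<open>x \<noteq> y\<close> by (auto intro!: mult_nonneg_nonneg simp: less_imp_le)
next
  case False
  have R: "0 < C\<^sub>R * res (dist x y)" using CR res_pos[of "dist x y"] \<open>x \<noteq> y\<close> by simp
  obtain \<phi> where \<phi>: "\<And>s t. \<bar>\<phi> t - \<phi> s\<bar> \<le> \<bar>t - s\<bar>" "\<phi> 0 = 0" "\<phi> (f x) = 0" "\<bar>f x - f y\<bar> \<le> 2 * \<bar>\<phi> (f y)\<bar>"
    by (rule threshold_map[OF le]) blast
  have g: "(\<lambda>z. \<phi> (f z)) \<in> F" "E (\<lambda>z. \<phi> (f z)) \<le> E f" using Markov[OF \<phi>(1,2) f(1)] by auto
  have "1-lipschitz_on UNIV \<phi>" using \<phi>(1) by (intro lipschitz_onI) (auto simp: dist_real_def)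
  then have "continuous_on UNIV (\<lambda>z. \<phi> (f z))"
    using continuous_on_compose2[OF lipschitz_on_continuous_on f(2)] by auto
  then have "continuous_on UNIV (\<lambda>z. 1 / \<phi> (f y) * \<phi> (f z))" by (intro continuous_intros)
  moreover have ne: "\<phi> (f y) \<noteq> 0" using \<phi>(4) False by auto
  ultimately have "1 \<le> C\<^sub>R * res (dist x y) * E (\<lambda>z. 1 / \<phi> (f y) * \<phi> (f z))"
    by (intro eff_resistance_leD[OF resistance_le[OF \<open>x \<noteq> y\<close>] R]) (use F_scale[OF g(1), of "1 / \<phi> (f y)"] \<phi>(3) in auto)
  also have "\<dots> = C\<^sub>R * res (dist x y) * (\<bar>1 / \<phi> (f y)\<bar> powr p * E (\<lambda>z. \<phi> (f z)))" by (subst E_scale[OF g(1)]) simp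
  also have "\<dots> \<le> C\<^sub>R * res (dist x y) * (\<bar>1 / \<phi> (f y)\<bar> powr p * E f)"
    using R g(2) by (intro mult_left_mono) auto
  finally have "\<bar>\<phi> (f y)\<bar> powr p * 1 \<le> \<bar>\<phi> (f y)\<bar> powr p * (C\<^sub>R * res (dist x y) * (\<bar>1 / \<phi> (f y)\<bar> powr p * E f))"
    by (intro mult_left_mono) auto
  also have "\<dots> = C\<^sub>R * res (dist x y) * E f" using ne by (simp add: powr_divide)
  finally have le1: "\<bar>\<phi> (f y)\<bar> powr p \<le> C\<^sub>R * res (dist x y) * E f" by simp
  have "\<bar>f x - f y\<bar> powr p \<le> (2 * \<bar>\<phi> (f y)\<bar>) powr p" using \<phi>(4) by (intro powr_mono2) auto
  also have "\<dots> = 2 powr p * \<bar>\<phi> (f y)\<bar> powr p" by (simp add: powr_mult)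
  also have "\<dots> \<le> 2 powr p * (C\<^sub>R * res (dist x y) * E f)" using le1 by (intro mult_left_mono) auto
  finally show ?thesis by (simp add: mult.assoc)
qed

lemma osc_resistance:
  assumes "f \<in> F" "continuous_on UNIV f" "x \<noteq> y"
  shows "\<bar>f x - f y\<bar> powr p \<le> 2 powr p * C\<^sub>R * res (dist x y) * E f"
  using osc_resistance_aux[OF assms] osc_resistance_aux[OF assms(1,2) assms(3)[symmetric]]
  by (cases "\<bar>f x\<bar> \<le> \<bar>f y\<bar>") (simp_all add: dist_commute abs_minus_commute)

text \<open>An almost optimal function for the resistance is continuous but may lack compact support. A core function
  close to it in energy has almost the same difference of values, by \<open>osc_resistance\<close> applied to the error.\<close>

lemma core_separating:
  assumes "x \<noteq> y"
  obtains v where "v \<in> core" "v y - v x = 1" "res (dist x y) * E v \<le> 2 powr p * 2 powr p * (3 * C\<^sub>R)"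
proof -
  let ?\<rho> = "res (dist x y)"
  have \<rho>: "0 < ?\<rho>" using assms by (intro res_pos) simp
  obtain u where u: "u \<in> F" "continuous_on UNIV u" "u x = 0" "u y = 1" "1 / C\<^sub>R * ?\<rho> * E u \<le> 2"
    by (rule eff_resistance_geD[OF resistance_ge[OF assms]]) (use CR \<rho> in auto)
  have Eu: "?\<rho> * E u \<le> 2 * C\<^sub>R" using u(5) CR by (simp add: field_simps)
  \<comment> \<open>The first bound keeps the energy comparable to that of \<open>u\<close>, the second one keeps the difference of
     the values at \<open>x\<close> and \<open>y\<close> above \<open>1/2\<close>.\<close>
  define \<epsilon> where "\<epsilon> = min (C\<^sub>R / ?\<rho>) ((1/2) powr p / (2 powr p * C\<^sub>R * ?\<rho>))"
  have \<epsilon>: "0 < \<epsilon>" using CR \<rho> by (simp add: \<epsilon>_def)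
  obtain g where g: "g \<in> core" "energy1 p m E (\<lambda>x. u x - g x) < \<epsilon>" by (rule regular_energy1[OF u(1) \<epsilon>])
  have gF: "g \<in> F" "continuous_on UNIV g" using g(1) core_F core_cont by auto
  have h: "(\<lambda>x. u x - g x) \<in> F" "continuous_on UNIV (\<lambda>x. u x - g x)" "(\<lambda>x. g x - u x) \<in> F"
    using F_diff u(1) gF u(2) by (auto intro!: continuous_intros)
  have Eh: "E (\<lambda>x. u x - g x) < \<epsilon>"
  proof -
    have "0 \<le> (\<integral>z. \<bar>u z - g z\<bar> powr p \<partial>m)" by (rule integral_nonneg_AE) auto
    then show ?thesis using g(2) unfolding energy1_eq by linarith
  qed
  have "\<bar>(u x - g x) - (u y - g y)\<bar> powr p \<le> 2 powr p * C\<^sub>R * ?\<rho> * E (\<lambda>x. u x - g x)"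
    using osc_resistance[OF h(1,2) assms] by simp
  also have "\<dots> < 2 powr p * C\<^sub>R * ?\<rho> * \<epsilon>" using Eh CR \<rho> by (intro mult_strict_left_mono) auto
  also have "\<dots> \<le> 2 powr p * C\<^sub>R * ?\<rho> * ((1/2) powr p / (2 powr p * C\<^sub>R * ?\<rho>))"
    using CR \<rho> by (intro mult_left_mono) (auto simp: \<epsilon>_def)
  also have "\<dots> = (1/2) powr p" using CR \<rho> by simp
  finally have "\<bar>(u x - g x) - (u y - g y)\<bar> < 1/2"
    using powr_mono2[of p "1/2" "\<bar>(u x - g x) - (u y - g y)\<bar>"] by force
  then have gap: "1/2 \<le> g y - g x" using u(3,4) by linarith
  define a where "a = 1 / (g y - g x)"
  have a: "0 < a" "a \<le> 2" using gap by (auto simp: a_def field_simps)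
  have Eg: "?\<rho> * E g \<le> 2 powr p * (3 * C\<^sub>R)"
  proof -
    have "E (\<lambda>x. g x - u x) = E (\<lambda>x. u x - g x)" using E_scale[OF h(1), of "-1"] by simp
    then have "E g \<le> 2 powr p * (E u + E (\<lambda>x. u x - g x))" using E_add_le[OF u(1) h(3)] by simp
    also have "\<dots> \<le> 2 powr p * (E u + C\<^sub>R / ?\<rho>)"
      using Eh by (intro mult_left_mono add_left_mono) (auto simp: \<epsilon>_def)
    finally have "?\<rho> * E g \<le> ?\<rho> * (2 powr p * (E u + C\<^sub>R / ?\<rho>))" using \<rho> by (intro mult_left_mono) auto
    also have "\<dots> = 2 powr p * (?\<rho> * E u + C\<^sub>R)" using \<rho> by (simp add: field_simps)
    also have "\<dots> \<le> 2 powr p * (3 * C\<^sub>R)" using Eu by (intro mult_left_mono) auto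
    finally show ?thesis .
  qed
  show ?thesis
  proof (rule that[of "\<lambda>z. a * g z"])
    show "(\<lambda>z. a * g z) \<in> core" by (rule core_scale[OF g(1)])
    have "a * (g y - g x) = 1" using gap by (simp add: a_def)
    then show "a * g y - a * g x = 1" by (simp add: right_diff_distrib)
    have "?\<rho> * E (\<lambda>z. a * g z) = \<bar>a\<bar> powr p * (?\<rho> * E g)" by (simp add: E_scale[OF gF(1)])
    also have "\<dots> \<le> 2 powr p * (2 powr p * (3 * C\<^sub>R))"
      by (rule mult_mono[OF powr_mono2 Eg]) (use a \<rho> E_nonneg[OF gF(1)] in auto)
    finally show "?\<rho> * E (\<lambda>z. a * g z) \<le> 2 powr p * 2 powr p * (3 * C\<^sub>R)" by (simp only: mult.assoc)
  qed
qed

lemma osc_slow: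
  assumes \<delta>: "0 < \<delta>" "\<delta> < 1" and r: "0 < r" "ennreal r < D" and f: "f \<in> F" "continuous_on UNIV f"
    and xy: "dist x y \<le> \<delta> * r"
  shows "\<bar>f x - f y\<bar> powr p \<le> 2 powr p * C\<^sub>R * \<Theta> \<delta> * res r * E f"
proof (cases "x = y")
  case True
  then show ?thesis using CR \<Theta>_nonneg[of \<delta>] \<delta> res_pos[OF r(1)] E_nonneg[OF f(1)]
    by (auto intro!: mult_nonneg_nonneg simp: less_imp_le)
next
  case False
  let ?d = "dist x y"
  have d: "0 < ?d" "?d \<le> r" using False xy \<delta> r(1) mult_left_le_one_le[of r \<delta>] by (auto intro: order_trans)
  have "res ?d \<le> \<Theta> (?d / r) * res r" by (rule slow_res[OF d r(2)])
  also have "\<dots> \<le> \<Theta> \<delta> * res r"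
    using xy r(1) \<delta> res_pos[OF r(1)] by (intro mult_right_mono \<Theta>_mono) (auto simp: divide_le_eq)
  finally have "2 powr p * C\<^sub>R * res ?d * E f \<le> 2 powr p * C\<^sub>R * (\<Theta> \<delta> * res r) * E f"
    using CR E_nonneg[OF f(1)] by (intro mult_right_mono mult_left_mono) auto
  then show ?thesis using order_trans[OF osc_resistance[OF f False]] by (simp only: mult.assoc)
qed

text \<open>A function that separates \<open>z\<close> from \<open>y\<close> with the energy allowed by the resistance hardly varies on
  small balls, so clipping makes it constant near \<open>z\<close> and near \<open>y\<close>.\<close>

lemma ball_separating:
  obtains \<delta> K where "0 < \<delta>" "\<delta> < 1" "0 < K"
    "\<And>x y z r. 0 < r \<Longrightarrow> ennreal r < D \<Longrightarrow> dist x z < r \<Longrightarrow> 2 * r \<le> dist x y \<Longrightarrow> dist x y \<le> 3 * r \<Longrightarrow>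
      \<exists>w\<in>core. (\<forall>t. 0 \<le> w t \<and> w t \<le> 1) \<and> (\<forall>t. dist z t < \<delta> * r \<longrightarrow> w t = 1) \<and> (\<forall>t. dist y t < \<delta> * r \<longrightarrow> w t = 0) \<and>
        res r * En w (cball x (3 * r)) \<le> K"
proof -
  define K\<^sub>1 where "K\<^sub>1 = 2 powr p * 2 powr p * (3 * C\<^sub>R)"
  have K1: "0 < K\<^sub>1" using CR by (simp add: K\<^sub>1_def)
  obtain C where C: "1 \<le> C" "\<And>r s. 0 < r \<Longrightarrow> r \<le> s \<Longrightarrow> s \<le> 4 * r \<Longrightarrow> res r \<le> C * res s"
    by (rule res_dilate[of 4]) auto
  \<comment> \<open>With this choice \<open>v\<close> varies by at most \<open>1/4\<close> on balls of radius \<open>\<delta> r\<close>.\<close>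
  define \<epsilon> where "\<epsilon> = (1/4) powr p / (2 powr p * C\<^sub>R * C * K\<^sub>1)"
  have \<epsilon>: "0 < \<epsilon>" using CR C K1 by (simp add: \<epsilon>_def)
  then obtain \<delta> where \<delta>: "0 < \<delta>" "\<delta> < 1" "\<Theta> \<delta> < \<epsilon>" using \<Theta>_small by blast
  show ?thesis
  proof (rule that[of \<delta> "2 powr p * (C * K\<^sub>1)"])
    show "0 < 2 powr p * (C * K\<^sub>1)" using C K1 by simp
    fix x y z :: 'a and r :: real
    assume r: "0 < r" "ennreal r < D" and z: "dist x z < r" and y: "2 * r \<le> dist x y" "dist x y \<le> 3 * r"
    have zy: "r \<le> dist z y" "dist z y \<le> 4 * r" "y \<noteq> z" "dist y z = dist z y"
      using dist_triangle[of x y z] dist_triangle[of z y x] z y r by (auto simp: dist_commute)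
    have zy: "r \<le> dist y z" "dist y z \<le> 4 * r" "y \<noteq> z" using zy by auto
    obtain v where v: "v \<in> core" "v z - v y = 1" "res (dist y z) * E v \<le> K\<^sub>1"
      unfolding K\<^sub>1_def by (rule core_separating[OF zy(3)])
    have vF: "v \<in> F" "continuous_on UNIV v" using v(1) core_F core_cont by auto
    have Ev: "res r * E v \<le> C * K\<^sub>1"
    proof -
      have "res r * E v \<le> C * res (dist y z) * E v"
        using C(2)[OF r(1) zy(1,2)] E_nonneg[OF vF(1)] by (intro mult_right_mono)
      also have "\<dots> \<le> C * K\<^sub>1" using mult_left_mono[OF v(3), of C] C(1) by (simp add: mult.assoc)
      finally show ?thesis .
    qed
    have osc: "\<bar>v s - v t\<bar> \<le> 1/4" if "dist s t < \<delta> * r" for s t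
    proof (rule ccontr)
      assume "\<not> \<bar>v s - v t\<bar> \<le> 1/4"
      then have "(1/4) powr p < \<bar>v s - v t\<bar> powr p" by (intro powr_less_mono2) auto
      also have "\<dots> \<le> 2 powr p * C\<^sub>R * \<Theta> \<delta> * res r * E v"
        by (rule osc_slow[OF \<delta>(1,2) r vF]) (use that in simp)
      also have "\<dots> = 2 powr p * C\<^sub>R * \<Theta> \<delta> * (res r * E v)" by simp
      also have "\<dots> \<le> 2 powr p * C\<^sub>R * \<epsilon> * (res r * E v)"
        using \<delta>(3) CR E_nonneg[OF vF(1)] res_pos[OF r(1)] by (intro mult_right_mono mult_left_mono) auto
      also have "\<dots> \<le> 2 powr p * C\<^sub>R * \<epsilon> * (C * K\<^sub>1)"
        using CR \<epsilon> by (intro mult_left_mono Ev) auto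
      also have "\<dots> = (1/4) powr p" using CR C K1 by (simp add: \<epsilon>_def)
      finally show False by simp
    qed
    obtain \<psi> where \<psi>: "\<psi> \<in> core" "\<And>t. dist x t \<le> 4 * r \<Longrightarrow> \<psi> t = 1"
      by (rule plateau_exists[of "4 * r" "5 * r" x]) (use r(1) in auto)
    define v' where "v' t = v t - v y * \<psi> t" for t
    have v': "v' \<in> core" unfolding v'_def by (intro core_diff core_scale v(1) \<psi>(1))
    define w where "w t = 2 * (min (3/4) (max (1/4) (v' t)) - 1/4)" for t
    have clip: "(\<lambda>t. min (3/4) (max (1/4) (v' t)) - 1/4) \<in> core" by (rule core_clip[OF v']) auto
    have \<delta>r: "\<delta> * r \<le> r" using \<delta>(1,2) r(1) by (simp add: mult_left_le_one_le)
    have B: "cball x (3 * r) \<in> sets borel" by simp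
    have "En w (cball x (3 * r)) = 2 powr p * En (\<lambda>t. min (3/4) (max (1/4) (v' t)) - 1/4) (cball x (3 * r))"
      unfolding w_def by (subst En_scale[OF core_F[OF clip] B]) simp
    also have "\<dots> \<le> 2 powr p * En v' (cball x (3 * r))" by (intro mult_left_mono En_clip[OF v' B]) auto
    also have "En v' (cball x (3 * r)) = En v (cball x (3 * r))"
      by (rule En_const[OF v' v(1) B, of "- v y"]) (use \<psi>(2) r(1) in \<open>auto simp: v'_def\<close>)
    also have "\<dots> \<le> E v" by (rule En_le_E[OF vF(1)])
    finally have "res r * En w (cball x (3 * r)) \<le> res r * (2 powr p * E v)"
      using res_pos[OF r(1)] by (intro mult_left_mono) auto
    also have "\<dots> \<le> 2 powr p * (C * K\<^sub>1)" using Ev by simp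
    finally have Ew: "res r * En w (cball x (3 * r)) \<le> 2 powr p * (C * K\<^sub>1)" .
    have w1: "w t = 1" if "dist z t < \<delta> * r" for t
    proof -
      have "dist x t \<le> 4 * r" using that z \<delta>r dist_triangle[of x t z] r(1) by linarith
      then have "v' t = v t - v y" using \<psi>(2) by (simp add: v'_def)
      then have "3/4 \<le> v' t" using osc[OF that] v(2) by linarith
      then show ?thesis by (simp add: w_def)
    qed
    have w0: "w t = 0" if "dist y t < \<delta> * r" for t
    proof -
      have "dist x t \<le> 4 * r" using that y \<delta>r dist_triangle[of x t y] r(1) by linarith
      then have "v' t = v t - v y" using \<psi>(2) by (simp add: v'_def)
      then have "v' t \<le> 1/4" using osc[OF that] by linarith
      then show ?thesis by (simp add: w_def)
    qed
    have "0 \<le> w t \<and> w t \<le> 1" for t by (auto simp: w_def min_def max_def)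
    moreover have "w \<in> core" unfolding w_def by (rule core_scale[OF clip])
    ultimately show "\<exists>w\<in>core. (\<forall>t. 0 \<le> w t \<and> w t \<le> 1) \<and> (\<forall>t. dist z t < \<delta> * r \<longrightarrow> w t = 1) \<and>
        (\<forall>t. dist y t < \<delta> * r \<longrightarrow> w t = 0) \<and> res r * En w (cball x (3 * r)) \<le> 2 powr p * (C * K\<^sub>1)"
      using w0 w1 Ew by blast
  qed (use \<delta> in auto)
qed

text \<open>For \<open>z\<close> in \<open>B(x, r)\<close> and \<open>y\<close> in the annulus \<open>2 r \<le> d(x, y) \<le> 3 r\<close>, \<open>ball_separating\<close> provides a function that is
  \<open>1\<close> near \<open>z\<close> and \<open>0\<close> near \<open>y\<close>. The minimum over finitely many \<open>y\<close> vanishes on the annulus, and the maximum of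
  these minima over finitely many \<open>z\<close> is \<open>1\<close> on the ball. Beyond the annulus the result is set to \<open>0\<close>, which
  costs no energy since it vanishes on the annulus.\<close>

lemma cutoff_exists:
  obtains K where "0 < K"
    "\<And>x r. 0 < r \<Longrightarrow> \<exists>\<phi>\<in>core. (\<forall>y. 0 \<le> \<phi> y \<and> \<phi> y \<le> 1) \<and> (\<forall>y. dist x y < r \<longrightarrow> \<phi> y = 1) \<and>
       (\<forall>y. 3 * r \<le> dist x y \<longrightarrow> \<phi> y = 0) \<and> res r * E \<phi> \<le> K"
proof -
  obtain \<delta> K\<^sub>1 where \<delta>: "0 < \<delta>" "\<delta> < 1" "0 < K\<^sub>1" and sep:
    "\<And>x y z r. 0 < r \<Longrightarrow> ennreal r < D \<Longrightarrow> dist x z < r \<Longrightarrow> 2 * r \<le> dist x y \<Longrightarrow> dist x y \<le> 3 * r \<Longrightarrow>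
      \<exists>w\<in>core. (\<forall>t. 0 \<le> w t \<and> w t \<le> 1) \<and> (\<forall>t. dist z t < \<delta> * r \<longrightarrow> w t = 1) \<and> (\<forall>t. dist y t < \<delta> * r \<longrightarrow> w t = 0) \<and>
        res r * En w (cball x (3 * r)) \<le> K\<^sub>1"
    by (rule ball_separating) blast
  obtain N where N: "\<And>(x::'a) r T. 0 < r \<Longrightarrow> ennreal r < D \<Longrightarrow> T \<subseteq> ball x (5 * r) \<Longrightarrow>
    \<exists>Y\<subseteq>T. finite Y \<and> card Y \<le> N \<and> (\<forall>t\<in>T. \<exists>y\<in>Y. dist y t < \<delta> * r)"
    by (rule bounded_cover[OF \<delta>(1,2)]) blast
  show ?thesis
  proof (rule that[of "real N * (real N * K\<^sub>1) + 1"])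
    show "0 < real N * (real N * K\<^sub>1) + 1" using \<delta>(3) by (simp add: add_nonneg_pos)
    fix x :: 'a and r :: real assume r: "0 < r"
    let ?B = "cball x (3 * r)" and ?S = "{y. 2 * r \<le> dist x y \<and> dist x y \<le> 3 * r}"
    have B: "?B \<in> sets borel" by simp
    obtain \<eta> where \<eta>: "\<eta> \<in> core" "\<And>y. 0 \<le> \<eta> y \<and> \<eta> y \<le> 1" "\<And>y. dist x y \<le> 2 * r \<Longrightarrow> \<eta> y = 1" "\<And>y. 3 * r \<le> dist x y \<Longrightarrow> \<eta> y = 0"
      by (rule plateau_exists[of "2 * r" "3 * r" x]) (use r in auto)
    show "\<exists>\<phi>\<in>core. (\<forall>y. 0 \<le> \<phi> y \<and> \<phi> y \<le> 1) \<and> (\<forall>y. dist x y < r \<longrightarrow> \<phi> y = 1) \<and>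
       (\<forall>y. 3 * r \<le> dist x y \<longrightarrow> \<phi> y = 0) \<and> res r * E \<phi> \<le> real N * (real N * K\<^sub>1) + 1"
    proof (cases "?S = {}")
      case True
      \<comment> \<open>The ball is open and closed, and its indicator function has no energy.\<close>
      have "En \<eta> (ball x (2 * r)) = 0" by (rule En_constant[OF \<eta>(1), of _ 1]) (use \<eta>(3) in auto)
      moreover have "En \<eta> (- ball x (2 * r)) = 0"
      proof (rule En_constant[OF \<eta>(1), of _ 0])
        fix y assume "y \<in> - ball x (2 * r)"
        then have "2 * r \<le> dist x y" by simp
        then have "\<not> dist x y \<le> 3 * r" using True by blast
        then have "3 * r \<le> dist x y" by simp
        then show "\<eta> y = 0" by (rule \<eta>(4))
      qed simp
      ultimately have "E \<eta> = 0"
        using En_Un[OF core_F[OF \<eta>(1)], of "ball x (2 * r)" "- ball x (2 * r)"]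
        by (simp add: E_eq[OF core_F[OF \<eta>(1)]] Compl_partition)
      then show ?thesis using \<eta> r \<delta>(3) by (intro bexI[of _ \<eta>]) auto
    next
      case False
      then obtain s\<^sub>0 where s0: "s\<^sub>0 \<in> ?S" by blast
      have rD: "ennreal r < D" by (rule below_diam_dist[OF r, of x s\<^sub>0]) (use s0 r in auto)
      have res: "0 < res r" by (rule res_pos[OF r])
      have subs: "ball x r \<subseteq> ball x (5 * r)" "?S \<subseteq> ball x (5 * r)" using r by auto
      obtain Z where Z: "Z \<subseteq> ball x r" "finite Z" "card Z \<le> N" "\<And>t. t \<in> ball x r \<Longrightarrow> \<exists>y\<in>Z. dist y t < \<delta> * r"
        using N[OF r rD subs(1)] by blast
      obtain Y where Y: "Y \<subseteq> ?S" "finite Y" "card Y \<le> N" "\<And>t. t \<in> ?S \<Longrightarrow> \<exists>y\<in>Y. dist y t < \<delta> * r"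
        using N[OF r rD subs(2)] by blast
      have ne: "Z \<noteq> {}" "Y \<noteq> {}" using Z(4)[of x] Y(4)[OF s0] r by auto
      have "\<forall>z\<in>Z. \<exists>W. W \<in> core \<and> (\<forall>t. 0 \<le> W t \<and> W t \<le> 1) \<and> En W ?B \<le> real N * (K\<^sub>1 / res r) \<and>
          (\<forall>t\<in>?S. W t = 0) \<and> (\<forall>t. dist z t < \<delta> * r \<longrightarrow> W t = 1)"
      proof
        fix z assume z: "z \<in> Z"
        have "\<forall>y\<in>Y. \<exists>w. w \<in> core \<and> (\<forall>t. 0 \<le> w t \<and> w t \<le> 1) \<and> (\<forall>t. dist z t < \<delta> * r \<longrightarrow> w t = 1) \<and>
            (\<forall>t. dist y t < \<delta> * r \<longrightarrow> w t = 0) \<and> res r * En w ?B \<le> K\<^sub>1"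
        proof
          fix y assume "y \<in> Y"
          then have "dist x z < r" "2 * r \<le> dist x y" "dist x y \<le> 3 * r" using z Z(1) Y(1) by auto
          from sep[OF r rD this]
          show "\<exists>w. w \<in> core \<and> (\<forall>t. 0 \<le> w t \<and> w t \<le> 1) \<and> (\<forall>t. dist z t < \<delta> * r \<longrightarrow> w t = 1) \<and>
            (\<forall>t. dist y t < \<delta> * r \<longrightarrow> w t = 0) \<and> res r * En w ?B \<le> K\<^sub>1" by blast
        qed
        from bchoice[OF this] obtain w where "\<forall>y\<in>Y. w y \<in> core \<and> (\<forall>t. 0 \<le> w y t \<and> w y t \<le> 1) \<and>
            (\<forall>t. dist z t < \<delta> * r \<longrightarrow> w y t = 1) \<and> (\<forall>t. dist y t < \<delta> * r \<longrightarrow> w y t = 0) \<and> res r * En (w y) ?B \<le> K\<^sub>1"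
          by blast
        then have w: "\<And>y. y \<in> Y \<Longrightarrow> w y \<in> core" "\<And>y t. y \<in> Y \<Longrightarrow> 0 \<le> w y t \<and> w y t \<le> 1"
          "\<And>y t. y \<in> Y \<Longrightarrow> dist z t < \<delta> * r \<Longrightarrow> w y t = 1" "\<And>y t. y \<in> Y \<Longrightarrow> dist y t < \<delta> * r \<Longrightarrow> w y t = 0"
          "\<And>y. y \<in> Y \<Longrightarrow> res r * En (w y) ?B \<le> K\<^sub>1" by blast+
        have en: "En (w y) ?B \<le> K\<^sub>1 / res r" if "y \<in> Y" for y using w(5)[OF that] res by (simp add: field_simps)
        obtain W where W: "W \<in> core" "\<And>t. 0 \<le> W t \<and> W t \<le> 1" "En W ?B \<le> real (card Y) * (K\<^sub>1 / res r)"
          "\<And>t. \<exists>y\<in>Y. w y t = 0 \<Longrightarrow> W t = 0" "\<And>t. \<forall>y\<in>Y. w y t = 1 \<Longrightarrow> W t = 1"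
          using finite_min[where w = w, OF Y(2) ne(2) B w(1,2) en] by blast
        have "En W ?B \<le> real N * (K\<^sub>1 / res r)"
          using W(3) Y(3) \<delta>(3) res by (intro order_trans[OF W(3)] mult_right_mono) auto
        moreover have "W t = 0" if "t \<in> ?S" for t using Y(4)[OF that] w(4) W(4) by blast
        moreover have "W t = 1" if "dist z t < \<delta> * r" for t using w(3) W(5) that by blast
        ultimately show "\<exists>W. W \<in> core \<and> (\<forall>t. 0 \<le> W t \<and> W t \<le> 1) \<and> En W ?B \<le> real N * (K\<^sub>1 / res r) \<and>
          (\<forall>t\<in>?S. W t = 0) \<and> (\<forall>t. dist z t < \<delta> * r \<longrightarrow> W t = 1)" using W(1,2) by blast
      qed
      from bchoice[OF this] obtain W where "\<forall>z\<in>Z. W z \<in> core \<and> (\<forall>t. 0 \<le> W z t \<and> W z t \<le> 1) \<and>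
          En (W z) ?B \<le> real N * (K\<^sub>1 / res r) \<and> (\<forall>t\<in>?S. W z t = 0) \<and> (\<forall>t. dist z t < \<delta> * r \<longrightarrow> W z t = 1)"
        by blast
      then have W: "\<And>z. z \<in> Z \<Longrightarrow> W z \<in> core" "\<And>z t. z \<in> Z \<Longrightarrow> 0 \<le> W z t \<and> W z t \<le> 1"
        "\<And>z. z \<in> Z \<Longrightarrow> En (W z) ?B \<le> real N * (K\<^sub>1 / res r)" "\<And>z t. z \<in> Z \<Longrightarrow> t \<in> ?S \<Longrightarrow> W z t = 0"
        "\<And>z t. z \<in> Z \<Longrightarrow> dist z t < \<delta> * r \<Longrightarrow> W z t = 1" by blast+
      obtain M where M: "M \<in> core" "\<And>t. 0 \<le> M t \<and> M t \<le> 1" "En M ?B \<le> real (card Z) * (real N * (K\<^sub>1 / res r))"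
        "\<And>t. \<exists>z\<in>Z. W z t = 1 \<Longrightarrow> M t = 1" "\<And>t. \<forall>z\<in>Z. W z t = 0 \<Longrightarrow> M t = 0"
        using finite_max[where w = W, OF Z(2) ne(1) B W(1,2,3)] by blast
      have M0: "M t = 0" if "t \<in> ?S" for t using M(5) W(4) that by blast
      have M1: "M t = 1" if "dist x t < r" for t using M(4) W(5) Z(4)[of t] that by auto
      let ?\<phi> = "\<lambda>t. min (M t) (\<eta> t)"
      have \<phi>: "?\<phi> \<in> core" by (rule core_min[OF M(1) \<eta>(1)])
      have "En ?\<phi> (- ?B) = 0"
      proof (rule En_constant[OF \<phi>, of _ 0])
        fix t assume "t \<in> - ?B"
        then show "min (M t) (\<eta> t) = 0" using \<eta>(4)[of t] M(2)[of t] by simp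
      qed simp
      moreover have "En ?\<phi> ?B = En M ?B"
      proof (rule En_const[OF \<phi> M(1) B])
        fix t assume t: "t \<in> ?B"
        show "min (M t) (\<eta> t) - M t = 0"
        proof (cases "dist x t \<le> 2 * r")
          case True
          then show ?thesis using \<eta>(3)[OF True] M(2)[of t] by simp
        next
          case False
          then show ?thesis using M0[of t] t \<eta>(2)[of t] by simp
        qed
      qed
      ultimately have "E ?\<phi> = En M ?B"
        using En_Un[OF core_F[OF \<phi>] B, of "- ?B"] by (simp add: E_eq[OF core_F[OF \<phi>]] Compl_partition)
      also have "\<dots> \<le> real N * (real N * (K\<^sub>1 / res r))"
        using Z(3) \<delta>(3) res by (intro order_trans[OF M(3)] mult_right_mono) auto
      finally have "res r * E ?\<phi> \<le> res r * (real N * (real N * (K\<^sub>1 / res r)))" using res by (intro mult_left_mono) auto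
      also have "\<dots> = real N * (real N * K\<^sub>1)" using res by simp
      finally have E\<phi>: "res r * E ?\<phi> \<le> real N * (real N * K\<^sub>1) + 1" by simp
      show ?thesis
      proof (intro bexI[OF _ \<phi>] conjI allI impI E\<phi>)
        show "min (M y) (\<eta> y) = 1" if "dist x y < r" for y using M1[OF that] \<eta>(3)[of y] that r by simp
        show "min (M y) (\<eta> y) = 0" if "3 * r \<le> dist x y" for y using \<eta>(4)[OF that] M(2)[of y] by simp
      qed (use M(2) \<eta>(2) in \<open>auto simp: min_def\<close>)
    qed
  qed
qed

lemma resistance_imp_capacity: "capacity_upper m F E \<Psi>"
proof -
  obtain K where K: "0 < K"
    "\<And>x r. 0 < r \<Longrightarrow> \<exists>\<phi>\<in>core. (\<forall>y. 0 \<le> \<phi> y \<and> \<phi> y \<le> 1) \<and> (\<forall>y. dist x y < r \<longrightarrow> \<phi> y = 1) \<and>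
       (\<forall>y. 3 * r \<le> dist x y \<longrightarrow> \<phi> y = 0) \<and> res r * E \<phi> \<le> K"
    by (rule cutoff_exists) blast
  have KV: "0 < K * C\<^sub>V" and four: "1 < (4::real)" using K CV by auto
  show ?thesis
    unfolding capacity_upper_def
  proof (rule exI[of _ "K * C\<^sub>V"], rule conjI[OF KV], rule exI[of _ 4], rule conjI[OF four], intro allI impI)
    fix x :: 'a and r :: real assume r: "0 < r"
    show "capacity m F E (ball x r) (UNIV - ball x (4 * r)) \<le> ennreal (K * C\<^sub>V * (measure m (ball x r) / \<Psi> r))"
    proof (cases "ennreal r < D")
      case False
      then show ?thesis using capacity_above_diam[OF r False four] by simp
    next
      case True
      obtain \<phi> where \<phi>: "\<phi> \<in> core" "\<And>y. dist x y < r \<Longrightarrow> \<phi> y = 1" "\<And>y. 3 * r \<le> dist x y \<Longrightarrow> \<phi> y = 0" "res r * E \<phi> \<le> K"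
        using K(2)[OF r, of x] by blast
      have "capacity m F E (ball x r) (UNIV - ball x (4 * r)) \<le> ennreal (E \<phi>)"
        by (rule capacity_le[of _ "ball x r" _ "- cball x (3 * r)"])
          (use \<phi> r core_F in \<open>auto simp: ae_eq_on_def open_Compl\<close>)
      also have "E \<phi> \<le> K * C\<^sub>V * (measure m (ball x r) / \<Psi> r)"
      proof -
        have "E \<phi> \<le> K * \<Phi> r / \<Psi> r"
          using \<phi>(4) \<Phi>_pos[OF r] \<Psi>_pos[OF r] by (simp add: res_def field_simps)
        also have "\<dots> \<le> K * (C\<^sub>V * measure m (ball x r)) / \<Psi> r"
          using volume[OF r True, of x] K(1) CV \<Psi>_pos[OF r]
          by (intro divide_right_mono mult_left_mono) (auto simp: field_simps)
        finally show ?thesis by simp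
      qed
      finally show ?thesis by (simp add: ennreal_leI)
    qed
  qed
qed

text \<open>Localization of \<open>osc_resistance\<close>: normalized to \<open>f x = 0\<close> and \<open>f y = 1\<close>, and clipped, \<open>f\<close> is replaced by its
  minimum with a cutoff function \<open>\<phi>\<close> at scale \<open>r\<close>. Where \<open>\<phi>\<close> is the smaller one the energy is that of \<open>\<phi>\<close>, and
  the other set is contained in \<open>B(x, 4 r)\<close>. Choosing \<open>\<delta>\<close> small makes the contribution of \<open>\<phi>\<close> at most half of
  what the resistance estimate at distance \<open>\<delta> r\<close> requires.\<close>

lemma osc_local:
  obtains \<delta> K where "0 < \<delta>" "\<delta> < 1" "0 < K"
    "\<And>f x y r. f \<in> core \<Longrightarrow> 0 < r \<Longrightarrow> ennreal r < D \<Longrightarrow> dist x y \<le> \<delta> * r \<Longrightarrow>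
      \<bar>f x - f y\<bar> powr p \<le> K * res r * En f (ball x (4 * r))"
proof -
  obtain K where K: "0 < K"
    "\<And>x r. 0 < r \<Longrightarrow> \<exists>\<phi>\<in>core. (\<forall>y. 0 \<le> \<phi> y \<and> \<phi> y \<le> 1) \<and> (\<forall>y. dist x y < r \<longrightarrow> \<phi> y = 1) \<and>
       (\<forall>y. 3 * r \<le> dist x y \<longrightarrow> \<phi> y = 0) \<and> res r * E \<phi> \<le> K"
    by (rule cutoff_exists) blast
  define L where "L = 2 powr p * C\<^sub>R"
  have L: "0 < L" using CR by (simp add: L_def)
  obtain \<delta> where \<delta>: "0 < \<delta>" "\<delta> < 1" "\<Theta> \<delta> < 1 / (2 * (L * K))"
    using \<Theta>_small[of "1 / (2 * (L * K))"] L K(1) by auto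
  have \<Theta>: "0 \<le> \<Theta> \<delta>" using \<Theta>_nonneg \<delta> by simp
  have half: "L * \<Theta> \<delta> * K \<le> 1 / 2" using \<delta>(3) L K(1) by (simp add: field_simps)
  show ?thesis
  proof (rule that[of \<delta> "2 * L * \<Theta> \<delta> + 1"])
    show "0 < 2 * L * \<Theta> \<delta> + 1" using L \<Theta> by (simp add: add_nonneg_pos)
    fix f and x y :: 'a and r :: real
    assume f: "f \<in> core" and r: "0 < r" "ennreal r < D" and xy: "dist x y \<le> \<delta> * r"
    let ?B = "ball x (4 * r)"
    have res: "0 < res r" by (rule res_pos[OF r(1)])
    show "\<bar>f x - f y\<bar> powr p \<le> (2 * L * \<Theta> \<delta> + 1) * res r * En f ?B"
    proof (cases "f x = f y")
      case True
      then show ?thesis using L \<Theta> res by (auto intro!: mult_nonneg_nonneg add_nonneg_nonneg)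
    next
      case False
      define b where "b = f y - f x"
      have b: "b \<noteq> 0" using False by (simp add: b_def)
      obtain \<phi> where \<phi>: "\<phi> \<in> core" "\<And>y. 0 \<le> \<phi> y \<and> \<phi> y \<le> 1" "\<And>y. dist x y < r \<Longrightarrow> \<phi> y = 1" "\<And>y. 3 * r \<le> dist x y \<Longrightarrow> \<phi> y = 0" "res r * E \<phi> \<le> K"
        using K(2)[OF r(1), of x] by blast
      obtain \<psi> where \<psi>: "\<psi> \<in> core" "\<And>t. dist x t \<le> 4 * r \<Longrightarrow> \<psi> t = 1"
        by (rule plateau_exists[of "4 * r" "5 * r" x]) (use r(1) in auto)
      have lt: "dist x y < r" using xy mult_strict_right_mono[OF \<delta>(2) r(1)] by simp
      define f\<^sub>1 where "f\<^sub>1 t = 1 / b * (f t - f x * \<psi> t)" for t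
      have f1: "f\<^sub>1 \<in> core" unfolding f\<^sub>1_def by (intro core_scale core_diff f \<psi>(1))
      define f\<^sub>2 where "f\<^sub>2 t = min 1 (max 0 (f\<^sub>1 t)) - 0" for t
      have f2: "f\<^sub>2 \<in> core" unfolding f\<^sub>2_def by (rule core_clip[OF f1]) auto
      have B: "?B \<in> sets borel" by simp
      have d: "(\<lambda>t. f t - f x * \<psi> t) \<in> core" by (intro core_scale core_diff f \<psi>(1))
      have "En f\<^sub>2 ?B \<le> En f\<^sub>1 ?B" unfolding f\<^sub>2_def by (rule En_clip[OF f1 B]) auto
      also have "\<dots> = \<bar>1 / b\<bar> powr p * En (\<lambda>t. f t - f x * \<psi> t) ?B"
        unfolding f\<^sub>1_def by (rule En_scale[OF core_F[OF d] B])
      also have "En (\<lambda>t. f t - f x * \<psi> t) ?B = En f ?B"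
        by (rule En_const[OF d f B, of "- f x"]) (use \<psi>(2) in auto)
      finally have en2: "En f\<^sub>2 ?B \<le> \<bar>1 / b\<bar> powr p * En f ?B" .
      define g where "g t = min (f\<^sub>2 t) (\<phi> t)" for t
      have g: "g \<in> core" unfolding g_def by (rule core_min[OF f2 \<phi>(1)])
      have gx: "g x = 0" using \<psi>(2)[of x] r(1) \<phi>(2)[of x] by (simp add: g_def f\<^sub>2_def f\<^sub>1_def)
      have gy: "g y = 1" using \<psi>(2)[of y] lt r(1) \<phi>(3)[OF lt] b by (simp add: g_def f\<^sub>2_def f\<^sub>1_def b_def)
      have "E g = En f\<^sub>2 (UNIV \<inter> {t. f\<^sub>2 t < \<phi> t}) + En \<phi> (UNIV \<inter> {t. \<phi> t \<le> f\<^sub>2 t})"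
        using En_min_eq[OF f2 \<phi>(1), of UNIV] unfolding E_eq[OF core_F[OF g]] g_def by simp
      also have "\<dots> \<le> En f\<^sub>2 ?B + E \<phi>"
      proof (intro add_mono En_mono En_le_E core_F f2 \<phi>(1) B)
        show "UNIV \<inter> {t. f\<^sub>2 t < \<phi> t} \<subseteq> ?B"
        proof
          fix t assume "t \<in> UNIV \<inter> {t. f\<^sub>2 t < \<phi> t}"
          then have "\<phi> t \<noteq> 0" by (auto simp: f\<^sub>2_def)
          then show "t \<in> ?B" using \<phi>(4)[of t] r(1) by fastforce
        qed
      qed
      also have "\<dots> \<le> \<bar>1 / b\<bar> powr p * En f ?B + E \<phi>" using en2 by simp
      finally have Eg: "E g \<le> \<bar>1 / b\<bar> powr p * En f ?B + E \<phi>" .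
      have "1 \<le> L * \<Theta> \<delta> * res r * E g"
        using osc_slow[OF \<delta>(1,2) r core_F[OF g] core_cont[OF g] xy] unfolding gx gy L_def by simp
      also have "\<dots> \<le> L * \<Theta> \<delta> * res r * (\<bar>1 / b\<bar> powr p * En f ?B + E \<phi>)"
        using Eg L \<Theta> res by (intro mult_left_mono) auto
      also have "\<dots> = L * \<Theta> \<delta> * res r * (\<bar>1 / b\<bar> powr p * En f ?B) + L * \<Theta> \<delta> * (res r * E \<phi>)"
        by (simp add: algebra_simps)
      also have "L * \<Theta> \<delta> * (res r * E \<phi>) \<le> L * \<Theta> \<delta> * K" using \<phi>(5) L \<Theta> by (intro mult_left_mono) auto
      finally have "1 \<le> 2 * (L * \<Theta> \<delta> * res r * (\<bar>1 / b\<bar> powr p * En f ?B))" using half by linarith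
      then have "\<bar>b\<bar> powr p * 1 \<le> \<bar>b\<bar> powr p * (2 * (L * \<Theta> \<delta> * res r * (\<bar>1 / b\<bar> powr p * En f ?B)))"
        by (intro mult_left_mono) auto
      also have "\<dots> = 2 * L * \<Theta> \<delta> * res r * En f ?B" using b by (simp add: powr_divide)
      also have "\<dots> \<le> (2 * L * \<Theta> \<delta> + 1) * res r * En f ?B" using res by (intro mult_right_mono) auto
      finally show ?thesis by (simp add: b_def abs_minus_commute)
    qed
  qed (use \<delta> in auto)
qed

lemma mean_add:
  assumes "f \<in> F" "g \<in> F" shows "mean (ball x r) (\<lambda>y. f y + g y) = mean (ball x r) f + mean (ball x r) g"
  using set_integral_add(2)[OF set_integrable_F[OF assms(1), of x r] set_integrable_F[OF assms(2), of x r]]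
  by (simp add: mean_value_def algebra_simps)

text \<open>A Poincare inequality for continuous functions of compact support extends to the domain of the
  energy: the oscillation of a small perturbation is small in \<open>L\<^sup>p\<close>.\<close>

lemma Poincare_extend:
  assumes K: "0 \<le> K" and s: "0 < s" and f: "f \<in> F" and B: "B \<in> sets borel"
    and core: "\<And>g. g \<in> core \<Longrightarrow> (LINT y:ball x s|m. \<bar>g y - mean (ball x s) g\<bar> powr p) \<le> K * En g B"
  shows "(LINT y:ball x s|m. \<bar>f y - mean (ball x s) f\<bar> powr p) \<le> 2 powr p * (K * (2 powr p * En f B))"
proof (rule field_le_epsilon)
  fix e :: real assume e: "0 < e"
  define c where "c = 2 powr p * (K * 2 powr p) + 2 powr p * (2 powr p * (1 + 2 powr p))"
  have c: "0 < c" using K by (simp add: c_def add_nonneg_pos add_pos_pos)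
  obtain g where g: "g \<in> core" "energy1 p m E (\<lambda>x. f x - g x) < e / c"
    by (rule regular_energy1[OF f, of "e / c"]) (use e c in auto)
  let ?h = "\<lambda>x. f x - g x" and ?V = "measure m (ball x s)"
  have gF: "g \<in> F" by (rule core_F[OF g(1)])
  have h: "?h \<in> F" "(\<lambda>x. g x - f x) \<in> F" using F_diff f gF by auto
  have V: "0 < ?V" by (rule measure_ball_pos[OF s])
  let ?I = "\<integral>y. \<bar>?h y\<bar> powr p \<partial>m"
  have I: "0 \<le> ?I" by (rule integral_nonneg_AE) auto
  have small: "E ?h + ?I \<le> e / c" using g(2) by (simp add: energy1_eq)
  have split: "mean (ball x s) f = mean (ball x s) g + mean (ball x s) ?h"
    using mean_add[OF gF h(1), of x s] by simp
  let ?a = "\<lambda>y. \<bar>g y - mean (ball x s) g\<bar> powr p" and ?b = "\<lambda>y. \<bar>?h y - mean (ball x s) ?h\<bar> powr p"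
  have int: "set_integrable m (ball x s) ?a" "set_integrable m (ball x s) ?b"
    using set_integrable_powr_diff gF h(1) by auto
  have "(LINT y:ball x s|m. \<bar>f y - mean (ball x s) f\<bar> powr p) \<le> (LINT y:ball x s|m. 2 powr p * (?a y + ?b y))"
  proof (rule set_integral_mono)
    show "set_integrable m (ball x s) (\<lambda>y. \<bar>f y - mean (ball x s) f\<bar> powr p)" by (rule set_integrable_powr_diff[OF f])
    show "set_integrable m (ball x s) (\<lambda>y. 2 powr p * (?a y + ?b y))"
      by (intro set_integrable_mult_right set_integral_add int)
    fix y
    have "\<bar>f y - mean (ball x s) f\<bar> powr p \<le> (\<bar>g y - mean (ball x s) g\<bar> + \<bar>?h y - mean (ball x s) ?h\<bar>) powr p"
      unfolding split by (intro powr_mono2) auto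
    also have "\<dots> \<le> 2 powr p * (?a y + ?b y)" by (intro powr_add_le) auto
    finally show "\<bar>f y - mean (ball x s) f\<bar> powr p \<le> 2 powr p * (?a y + ?b y)" .
  qed
  also have "\<dots> = 2 powr p * ((LINT y:ball x s|m. ?a y) + (LINT y:ball x s|m. ?b y))"
    by (simp add: set_integral_add(2)[OF int])
  also have "\<dots> \<le> 2 powr p * (K * (2 powr p * (En f B + e' )) + 2 powr p * (1 + 2 powr p) * ?I)" if "e' = E ?h" for e'
  proof (intro mult_left_mono add_mono)
    have "En g B \<le> 2 powr p * (En f B + En (\<lambda>x. g x - f x) B)" using En_add_le[OF f h(2) B] by simp
    also have "En (\<lambda>x. g x - f x) B \<le> E ?h"
      using En_le_E[OF h(2), of B] E_scale[OF h(1), of "-1"] by simp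
    finally have "En g B \<le> 2 powr p * (En f B + E ?h)" by simp
    then show "(LINT y:ball x s|m. ?a y) \<le> K * (2 powr p * (En f B + e'))"
      unfolding that using core[OF g(1)] K by (meson mult_left_mono order_trans)
    have mh: "\<bar>mean (ball x s) ?h\<bar> powr p * ?V \<le> 2 powr p * ?I"
    proof -
      have "\<bar>mean (ball x s) ?h\<bar> powr p \<le> 2 powr p * ((LINT y:ball x s|m. \<bar>?h y\<bar> powr p) / ?V)"
        by (rule mean_abs_powr_le[OF h(1) s])
      also have "\<dots> \<le> 2 powr p * (?I / ?V)"
        using LINT_powr_le_total[OF h(1), of x s] V by (intro mult_left_mono divide_right_mono) auto
      finally show ?thesis using V by (simp add: field_simps)
    qed
    have i0: "set_integrable m (ball x s) (\<lambda>y. \<bar>?h y\<bar> powr p)" using set_integrable_powr_diff[OF h(1), of x s 0] by simp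
    have "(LINT y:ball x s|m. ?b y) \<le> (LINT y:ball x s|m. 2 powr p * (\<bar>?h y\<bar> powr p + \<bar>mean (ball x s) ?h\<bar> powr p))"
    proof (rule set_integral_mono[OF int(2)])
      show "set_integrable m (ball x s) (\<lambda>y. 2 powr p * (\<bar>?h y\<bar> powr p + \<bar>mean (ball x s) ?h\<bar> powr p))"
        by (intro set_integrable_mult_right set_integral_add i0 set_integrable_const)
      fix y
      have "?b y \<le> (\<bar>?h y\<bar> + \<bar>mean (ball x s) ?h\<bar>) powr p" by (intro powr_mono2) auto
      also have "\<dots> \<le> 2 powr p * (\<bar>?h y\<bar> powr p + \<bar>mean (ball x s) ?h\<bar> powr p)" by (intro powr_add_le) auto
      finally show "?b y \<le> 2 powr p * (\<bar>?h y\<bar> powr p + \<bar>mean (ball x s) ?h\<bar> powr p)" .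
    qed
    also have "\<dots> = 2 powr p * ((LINT y:ball x s|m. \<bar>?h y\<bar> powr p) + \<bar>mean (ball x s) ?h\<bar> powr p * ?V)"
      by (simp add: set_integral_add(2)[OF i0 set_integrable_const] LINT_const)
    also have "\<dots> \<le> 2 powr p * (?I + 2 powr p * ?I)"
      using LINT_powr_le_total[OF h(1), of x s] mh by (intro mult_left_mono add_mono) auto
    also have "\<dots> = 2 powr p * (1 + 2 powr p) * ?I" by (simp add: algebra_simps)
    finally show "(LINT y:ball x s|m. ?b y) \<le> 2 powr p * (1 + 2 powr p) * ?I" .
  qed auto
  also have "2 powr p * (K * (2 powr p * (En f B + E ?h)) + 2 powr p * (1 + 2 powr p) * ?I)
      \<le> 2 powr p * (K * (2 powr p * En f B)) + c * (E ?h + ?I)"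
  proof -
    have "0 \<le> (2 powr p * (2 powr p * (1 + 2 powr p))) * E ?h" using E_nonneg[OF h(1)] by simp
    moreover have "0 \<le> (2 powr p * (K * 2 powr p)) * ?I" using K I by simp
    ultimately show ?thesis by (simp add: c_def algebra_simps)
  qed
  also have "c * (E ?h + ?I) \<le> e" using small c by (simp add: field_simps)
  finally show "(LINT y:ball x s|m. \<bar>f y - mean (ball x s) f\<bar> powr p) \<le> 2 powr p * (K * (2 powr p * En f B)) + e"
    by simp
qed

text \<open>The oscillation on \<open>B(x, s)\<close> is controlled by \<open>osc_local\<close> at the scale \<open>r = 2 s / \<delta>\<close>, at which any two points
  of the ball have distance at most \<open>\<delta> r\<close>. The volume of the ball cancels the factor \<open>\<Phi> r\<close> in \<open>res r\<close>.\<close>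

lemma resistance_imp_Poincare: "Poincare p m F \<Gamma> \<Psi>"
proof -
  obtain \<delta> K where \<delta>: "0 < \<delta>" "\<delta> < 1" and K: "0 < K"
    "\<And>f x y r. f \<in> core \<Longrightarrow> 0 < r \<Longrightarrow> ennreal r < D \<Longrightarrow> dist x y \<le> \<delta> * r \<Longrightarrow>
      \<bar>f x - f y\<bar> powr p \<le> K * res r * En f (ball x (4 * r))"
    by (rule osc_local) blast
  obtain C where C: "1 \<le> C" "\<And>r. 0 < r \<Longrightarrow> \<Psi> (2 / \<delta> * r) \<le> C * \<Psi> r"
    by (rule \<Psi>_dilate[of "2 / \<delta>"]) (use \<delta> in auto)
  \<comment> \<open>A ball of radius \<open>4 r = 8 s / \<delta>\<close> around a point of \<open>B(x, s)\<close> lies in \<open>B(x, A s)\<close>.\<close>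
  define A where "A = 8 / \<delta> + 1"
  have A: "1 \<le> A" using \<delta> by (simp add: A_def)
  define C\<^sub>P where "C\<^sub>P = 2 powr p * (K * C\<^sub>V * C * 2 powr p)"
  have CP: "0 < C\<^sub>P" using K C CV by (simp add: C\<^sub>P_def)
  show ?thesis
    unfolding Poincare_def
  proof (rule exI[of _ C\<^sub>P], rule conjI[OF CP], rule exI[of _ A], rule conjI[OF A], intro allI impI ballI)
    fix x :: 'a and s :: real and f
    assume s: "0 < s" and sD: "ennreal s < ediam (UNIV :: 'a set) / ennreal A" and f: "f \<in> F"
    have As: "ennreal (A * s) < D" using sD s A by (simp add: less_ediam_divide_iff D)
    define r where "r = 2 / \<delta> * s"
    have r: "0 < r" "\<delta> * r = 2 * s" using \<delta> s by (auto simp: r_def)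
    have "r \<le> A * s" using s \<delta> by (simp add: r_def A_def field_simps)
    then have rD: "ennreal r < D" using As below_diam_mono by blast
    have sr: "s \<le> r" using \<delta> s by (simp add: r_def field_simps)
    have sD': "ennreal s < D" by (rule below_diam_mono[OF sr rD])
    let ?B = "ball x (A * s)" and ?b = "ball x s"
    have core_case: "(LINT y:?b|m. \<bar>g y - mean ?b g\<bar> powr p) \<le> K * C\<^sub>V * C * \<Psi> s * En g ?B" if g: "g \<in> core" for g
    proof -
      have gF: "g \<in> F" by (rule core_F[OF g])
      define M where "M = K * res r * En g ?B"
      have M: "0 \<le> M" using K(1) res_pos[OF r(1)] by (simp add: M_def)
      have osc: "\<bar>g y - g z\<bar> \<le> M powr (1 / p)" if yz: "y \<in> ?b" "z \<in> ?b" for y z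
      proof -
        have "dist y z \<le> \<delta> * r" using yz dist_triangle3[of y z x] r(2) by simp
        then have "\<bar>g y - g z\<bar> powr p \<le> K * res r * En g (ball y (4 * r))" by (rule K(2)[OF g r(1) rD])
        also have "\<dots> \<le> M"
          unfolding M_def
        proof (intro mult_left_mono En_mono gF)
          show "ball y (4 * r) \<subseteq> ?B"
          proof
            fix t assume "t \<in> ball y (4 * r)"
            then have "dist x t < s + 4 * r" using yz dist_triangle[of x t y] by simp
            also have "s + 4 * r = A * s" by (simp add: r_def A_def algebra_simps)
            finally show "t \<in> ?B" by simp
          qed
        qed (use K(1) res_pos[OF r(1)] in auto)
        finally show ?thesis using M by (simp add: powr_inverse_le_iff)
      qed
      have pt: "\<bar>g y - mean ?b g\<bar> powr p \<le> M" if y: "y \<in> ?b" for y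
      proof -
        have "g y - M powr (1 / p) \<le> mean ?b g"
          by (rule mean_ge[OF gF s]) (use osc[OF y] in \<open>auto intro!: AE_I2 simp: abs_le_iff diff_le_eq le_diff_eq add.commute\<close>)
        moreover have "mean ?b g \<le> g y + M powr (1 / p)"
          by (rule mean_le[OF gF s]) (use osc[OF y] in \<open>auto intro!: AE_I2 simp: abs_le_iff diff_le_eq le_diff_eq add.commute\<close>)
        ultimately have "\<bar>g y - mean ?b g\<bar> \<le> M powr (1 / p)" by linarith
        then show ?thesis using M by (subst (asm) powr_inverse_le_iff) auto
      qed
      have "(LINT y:?b|m. \<bar>g y - mean ?b g\<bar> powr p) \<le> (LINT y:?b|m. M)"
        unfolding set_lebesgue_integral_def
        by (rule integral_mono)
          (use pt set_integrable_powr_diff[OF gF] set_integrable_const in \<open>auto simp: set_integrable_def indicator_def\<close>)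
      also have "\<dots> = M * measure m ?b" by (rule LINT_const)
      also have "\<dots> \<le> M * (C\<^sub>V * \<Phi> r)"
        using volume[OF s sD', of x] \<Phi>_mono[OF s sr] CV M by (intro mult_left_mono) (auto intro: order_trans)
      also have "\<dots> = K * C\<^sub>V * \<Psi> r * En g ?B" using \<Phi>_pos[OF r(1)] by (simp add: M_def res_def)
      also have "\<dots> \<le> K * C\<^sub>V * (C * \<Psi> s) * En g ?B"
        using C(2)[OF s] K(1) CV by (intro mult_right_mono mult_left_mono) (auto simp: r_def)
      finally show ?thesis by (simp add: mult.assoc)
    qed
    have "(LINT y:?b|m. \<bar>f y - mean ?b f\<bar> powr p) \<le> 2 powr p * (K * C\<^sub>V * C * \<Psi> s * (2 powr p * En f ?B))"
      by (rule Poincare_extend[OF _ s f]) (use core_case K C CV \<Psi>_pos[OF s] in auto)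
    also have "\<dots> = C\<^sub>P * \<Psi> s * En f ?B" by (simp add: C\<^sub>P_def)
    finally have le: "(LINT y:?b|m. \<bar>f y - mean ?b f\<bar> powr p) \<le> C\<^sub>P * \<Psi> s * En f ?B" .
    have "0 \<le> C\<^sub>P * \<Psi> s" using CP \<Psi>_pos[OF s] by simp
    then show "(\<integral>\<^sup>+y\<in>?b. ennreal (\<bar>f y - mean_value m ?b f\<bar> powr p) \<partial>m) \<le> ennreal (C\<^sub>P * \<Psi> s) * emeasure (\<Gamma> f) ?B"
      using le unfolding nn_integral_powr_diff[OF f] emeasure_\<Gamma>[OF f]
      by (simp add: ennreal_mult[symmetric] ennreal_leI)
  qed
qed

end

section \<open>Equivalence of the three conditions\<close>

theorem theorem2p3:
  fixes m :: "'a::polish_space measure"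
    and p :: real
    and F :: "('a \<Rightarrow> real) set"
    and E :: "('a \<Rightarrow> real) \<Rightarrow> real"
    and \<Gamma> :: "('a \<Rightarrow> real) \<Rightarrow> 'a measure"
    and \<Phi> \<Psi> :: "real \<Rightarrow> real"
  assumes "p_energy_measure m p F E \<Gamma>"
    and "doubling_function \<Phi>" and "doubling_function \<Psi>"
    and "slow_volume_regular p m \<Phi> \<Psi>"
  shows "(resistance_estimate F E \<Phi> \<Psi> \<longleftrightarrow> Poincare p m F \<Gamma> \<Psi> \<and> capacity_upper m F E \<Psi>) \<and>
         (Poincare p m F \<Gamma> \<Psi> \<and> capacity_upper m F E \<Psi> \<longleftrightarrow>
          Poincare p m F \<Gamma> \<Psi> \<and> cutoff_Sobolev p m F E \<Gamma> \<Psi>)"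
proof -
  interpret p_energy_measure m p F E \<Gamma> by (rule assms(1))
  obtain C\<^sub>\<Phi> where \<Phi>: "C\<^sub>\<Phi> \<ge> 1" "\<And>r. 0 < r \<Longrightarrow> 0 < \<Phi> r" "\<And>r s. 0 < r \<Longrightarrow> r \<le> s \<Longrightarrow> \<Phi> r \<le> \<Phi> s"
    "\<And>r. 0 < r \<Longrightarrow> \<Phi> (2 * r) \<le> C\<^sub>\<Phi> * \<Phi> r" by (rule doubling_functionE[OF assms(2)]) blast
  obtain C\<^sub>\<Psi> where \<Psi>: "C\<^sub>\<Psi> \<ge> 1" "\<And>r. 0 < r \<Longrightarrow> 0 < \<Psi> r" "\<And>r s. 0 < r \<Longrightarrow> r \<le> s \<Longrightarrow> \<Psi> r \<le> \<Psi> s"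
    "\<And>r. 0 < r \<Longrightarrow> \<Psi> (2 * r) \<le> C\<^sub>\<Psi> * \<Psi> r" by (rule doubling_functionE[OF assms(3)]) blast
  define D where "D = ediam (UNIV :: 'a set)"
  obtain C\<^sub>V where V: "0 < C\<^sub>V" "\<And>(x::'a) r. 0 < r \<Longrightarrow> ennreal r < D \<Longrightarrow> 1 / C\<^sub>V * \<Phi> r \<le> measure m (ball x r) \<and> measure m (ball x r) \<le> C\<^sub>V * \<Phi> r"
    using assms(4) unfolding slow_volume_regular_def volume_regular_def D_def by blast
  obtain \<Theta> :: "real \<Rightarrow> real" where \<Theta>: "mono_on {0..1} \<Theta>" "continuous_on {0..1} \<Theta>" "\<Theta> ` {0..1} \<subseteq> {0..}"
    "\<Theta> 0 = 0" "summable (\<lambda>n. \<Theta> (1 / 2 ^ n) powr (1 / p))"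
    "\<And>R r. R > 0 \<Longrightarrow> r > 0 \<Longrightarrow> ennreal R < D \<Longrightarrow> ennreal r < D \<Longrightarrow> r \<le> R \<Longrightarrow> \<Phi> R / \<Phi> r \<le> \<Theta> (r / R) * (\<Psi> R / \<Psi> r)"
    using assms(4) unfolding slow_volume_regular_def D_def by blast
  interpret slow_volume m p F E \<Gamma> \<Phi> \<Psi> \<Theta> C\<^sub>\<Phi> C\<^sub>\<Psi> C\<^sub>V D
  proof
    show "D = ediam (UNIV :: 'a set)" by (rule D_def)
    show "\<Phi> r / C\<^sub>V \<le> measure m (ball x r) \<and> measure m (ball x r) \<le> C\<^sub>V * \<Phi> r" if "0 < r" "ennreal r < D" for x :: 'a and r
      using V(2)[OF that, of x] by simp
    show "0 \<le> \<Theta> t" if "0 \<le> t" "t \<le> 1" for t using \<Theta>(3) that by force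
    show "\<Theta> s \<le> \<Theta> t" if "0 \<le> s" "s \<le> t" "t \<le> 1" for s t using mono_onD[OF \<Theta>(1), of s t] that by auto
    show "\<exists>\<delta>>0. \<delta> < 1 \<and> \<Theta> \<delta> < \<epsilon>" if \<epsilon>: "0 < \<epsilon>" for \<epsilon>
    proof -
      obtain d where d: "0 < d" "\<And>t. t \<in> {0..1} \<Longrightarrow> dist t 0 < d \<Longrightarrow> dist (\<Theta> t) (\<Theta> 0) < \<epsilon>"
        using \<Theta>(2) \<epsilon> unfolding continuous_on_iff by (metis atLeastAtMost_iff order_refl zero_le_one)
      show ?thesis
      proof (intro exI conjI)
        have t: "0 < min (d / 2) (1 / 2)" "min (d / 2) (1 / 2) < 1" "min (d / 2) (1 / 2) < d" using d(1) by auto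
        then show "0 < min (d / 2) (1 / 2)" "min (d / 2) (1 / 2) < 1" by auto
        show "\<Theta> (min (d / 2) (1 / 2)) < \<epsilon>"
          using d(2)[of "min (d / 2) (1 / 2)"] t \<Theta>(4) by (simp add: dist_real_def)
      qed
    qed
    show "\<Psi> r / \<Phi> r \<le> \<Theta> (r / R) * (\<Psi> R / \<Phi> R)" if rR: "0 < r" "r \<le> R" "ennreal R < D" for r R
    proof -
      have "ennreal r < D" using rR by (meson ennreal_leI order_le_less_trans)
      then have "\<Phi> R / \<Phi> r \<le> \<Theta> (r / R) * (\<Psi> R / \<Psi> r)" using \<Theta>(6)[of R r] rR by auto
      then show ?thesis using \<Phi>(2) \<Psi>(2) rR by (simp add: field_simps)
    qed
  qed (use \<Phi> \<Psi> V \<Theta> in auto)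
  have res_eq: "\<Psi> r / \<Phi> r = res r" for r by (simp add: res_def)
  have 1: "Poincare p m F \<Gamma> \<Psi> \<and> capacity_upper m F E \<Psi>" if R: "resistance_estimate F E \<Phi> \<Psi>"
  proof -
    obtain C where C: "0 < C" "\<And>x y. x \<noteq> y \<Longrightarrow> ennreal (1 / C * res (dist x y)) \<le> eff_resistance F E {x} {y} \<and>
        eff_resistance F E {x} {y} \<le> ennreal (C * res (dist x y))"
      using R unfolding resistance_estimate_def res_eq by blast
    interpret slow_volume_resistance m p F E \<Gamma> \<Phi> \<Psi> \<Theta> C\<^sub>\<Phi> C\<^sub>\<Psi> C\<^sub>V D C
      by unfold_locales (use C in auto)
    show ?thesis using resistance_imp_Poincare resistance_imp_capacity by blast
  qed
  have 2: "(capacity_upper m F E \<Psi> \<longrightarrow> resistance_estimate F E \<Phi> \<Psi>) \<and>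
      (capacity_upper m F E \<Psi> \<longleftrightarrow> cutoff_Sobolev p m F E \<Gamma> \<Psi>)" if P: "Poincare p m F \<Gamma> \<Psi>"
  proof -
    obtain C A where P: "0 < C" "1 \<le> A"
      "\<And>x r f. 0 < r \<Longrightarrow> ennreal r < ediam (UNIV :: 'a set) / ennreal A \<Longrightarrow> f \<in> F \<Longrightarrow>
        (\<integral>\<^sup>+y\<in>ball x r. ennreal (\<bar>f y - mean_value m (ball x r) f\<bar> powr p) \<partial>m)
                \<le> ennreal (C * \<Psi> r) * emeasure (\<Gamma> f) (ball x (A * r))"
      using P unfolding Poincare_def by blast
    interpret slow_volume_Poincare m p F E \<Gamma> \<Phi> \<Psi> \<Theta> C\<^sub>\<Phi> C\<^sub>\<Psi> C\<^sub>V D C A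
    proof
      show "(\<integral>\<^sup>+y\<in>ball x r. ennreal (\<bar>f y - mean_value m (ball x r) f\<bar> powr p) \<partial>m)
                \<le> ennreal (C * \<Psi> r) * emeasure (\<Gamma> f) (ball x (A * r))"
        if "0 < r" "ennreal (A * r) < D" "f \<in> F" for r f x
        by (rule P(3)) (use that P(2) in \<open>auto simp: less_ediam_divide_iff D_def\<close>)
    qed (use P in auto)
    show ?thesis using capacity_imp_resistance capacity_imp_cutoff_Sobolev cutoff_Sobolev_imp_capacity by blast
  qed
  show ?thesis using 1 2 by blast
qed

end
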